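(* Let $W$ be a positive random variable with $\mathbf{E}[W^2]<\infty$, let $\mathcal{C}_n$ be the cycle-counting point process on $\mathbb{N}_{\geq 3}$ of the generalised random graph on $n$ vertices with weight distribution that of $W$, and let $\eta$ be a Poisson point process on $\mathbb{N}_{\geq 3}$ with intensity measure $\lambda$ given by $\lambda(\{k\})=\lambda_k$, $k\in\mathbb{N}_{\ge 3}$. Then $$\mathcal{C}_n\overset{d}{\longrightarrow}\eta\quad\text{as } n\to\infty.$$
   Context: Generalised random graph: for $n\in\mathbb{N}$ the vertex set is $[n]=\{1,\dots,n\}$, the vertices carry i.i.d. weights $W_1,\dots,W_n$ distributed as the positive random variable $W$, and $L_n=\sum_{i=1}^n W_i$. Conditionally on the weights, any two distinct vertices $i,j\in[n]$ are joined by an edge independently with probability $\frac{W_iW_j}{W_iW_j+L_n}$. $\mathbb{N}_{\geq 3}=\{3,4,\dots\}$. For $A\subseteq\mathbb{N}_{\ge 3}$, $\mathcal{C}_n(A)$ is the number of cycles (as subgraphs, each counted once irrespective of starting vertex and orientation) in the graph whose length lies in $A$. For $k\in\mathbb{N}$, $\lambda_k=\frac{1}{2k}\left(\frac{\mathbf{E}[W^2]}{\mathbf{E}[W]}\right)^k$. The symbol $\overset{d}{\longrightarrow}$ denotes convergence in distribution with respect to the vague topology on the set of counting measures on $\mathbb{N}_{\ge 3}$; this is equivalent to convergence of the finite-dimensional distributions of $(\mathcal{C}_n(\{k\}))_{k\in\mathbb{N}_{\ge3}}$ to those of $(\eta(\{k\}))_{k\in\mathbb{N}_{\geq 3}}$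 (the latter being independent Poisson random variables with parameters $\lambda_k$). *)

theory Defs
  imports "HOL-Probability.Probability"
begin

section \<open>Counting measures on a discrete space and the vague topology\<close>

text \<open>Locally finite counting measures on the discrete space \<open>S\<close>: the compact subsets
  are the finite ones, and on those the values have to be natural numbers. On infinite sets the
  value is then a natural number or infinity by countable additivity if \<open>S\<close> is countable.\<close>

definition counting_measures :: "'a set \<Rightarrow> 'a measure set" where
  "counting_measures S =
     {\<mu>. space \<mu> = S \<and> sets \<mu> = Pow S \<and> (\<forall>A\<subseteq>S. finite A \<longrightarrow> emeasure \<mu> A \<in> range of_nat)}"

text \<open>The coarsest topology making \<open>\<mu> \<mapsto> \<integral>f d\<mu>\<close> continuous for every continuous \<open>f\<close> with compact
  support; on a discrete space these \<open>f\<close> are exactly the functions with finite support.\<close>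

definition vague_topology :: "'a set \<Rightarrow> 'a measure topology" where
  "vague_topology S = topology_generated_by
     {{\<mu> \<in> counting_measures S. (\<integral>x. f x \<partial>\<mu>) \<in> U} | (f :: 'a \<Rightarrow> real) U.
        finite {x \<in> S. f x \<noteq> 0} \<and> open U}"

lemma topspace_vague_topology: "topspace (vague_topology S) = counting_measures S"
proof -
  have "counting_measures S \<in> {{\<mu> \<in> counting_measures S. (\<integral>x. f x \<partial>\<mu>) \<in> U} | (f :: 'a \<Rightarrow> real) U.
        finite {x \<in> S. f x \<noteq> 0} \<and> open U}"
    by (rule CollectI, rule exI[of _ "\<lambda>_. 0"], rule exI[of _ UNIV]) auto
  then show ?thesis
    unfolding vague_topology_def topology_generated_by_topspace by blast
qed

section \<open>Convergence in distribution\<close>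

definition borel_of :: "'a topology \<Rightarrow> 'a measure" where
  "borel_of T = sigma (topspace T) {U. openin T U}"

definition converges_in_distribution ::
  "'a topology \<Rightarrow> (nat \<Rightarrow> 'b measure) \<Rightarrow> (nat \<Rightarrow> 'b \<Rightarrow> 'a) \<Rightarrow> 'c measure \<Rightarrow> ('c \<Rightarrow> 'a) \<Rightarrow> bool" where
  "converges_in_distribution T M X N Y \<longleftrightarrow>
     (\<forall>n. X n \<in> M n \<rightarrow>\<^sub>M borel_of T) \<and> Y \<in> N \<rightarrow>\<^sub>M borel_of T \<and>
     (\<forall>f :: 'a \<Rightarrow> real. continuous_map T euclideanreal f \<and> bounded (f ` topspace T) \<longrightarrow>
        (\<lambda>n. \<integral>\<omega>. f (X n \<omega>) \<partial>M n) \<longlonglongrightarrow> (\<integral>\<omega>. f (Y \<omega>) \<partial>N))"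

section \<open>Poisson point processes\<close>

text \<open>A set of infinite intensity almost surely carries infinitely many points. The Poisson
  weights are written out because the library's \<open>poisson_pmf\<close> excludes rate 0.\<close>

definition poisson_point_process ::
  "'b measure \<Rightarrow> ('b \<Rightarrow> 'a measure) \<Rightarrow> 'a set \<Rightarrow> 'a measure \<Rightarrow> bool" where
  "poisson_point_process N \<eta> S \<Lambda> \<longleftrightarrow>
     prob_space N \<and> space \<Lambda> = S \<and> sets \<Lambda> = Pow S \<and>
     \<eta> \<in> N \<rightarrow>\<^sub>M borel_of (vague_topology S) \<and>
     (\<forall>A\<subseteq>S. emeasure \<Lambda> A < \<infinity> \<longrightarrow>
        (\<forall>m::nat. measure N {\<omega> \<in> space N. emeasure (\<eta> \<omega>) A = of_nat m} =
           measure \<Lambda> A ^ m / fact m * exp (- measure \<Lambda> A))) \<and>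
     (\<forall>A\<subseteq>S. emeasure \<Lambda> A = \<infinity> \<longrightarrow> (AE \<omega> in N. emeasure (\<eta> \<omega>) A = \<infinity>)) \<and>
     (\<forall>A :: nat \<Rightarrow> 'a set. disjoint_family A \<and> range A \<subseteq> Pow S \<longrightarrow>
        prob_space.indep_vars N (\<lambda>_. borel) (\<lambda>i \<omega>. emeasure (\<eta> \<omega>) (A i)) UNIV)"

section \<open>Conditional independence\<close>

definition cond_prob_given :: "'a measure \<Rightarrow> 'a measure \<Rightarrow> 'a set \<Rightarrow> 'a \<Rightarrow> real" where
  "cond_prob_given M F A = real_cond_exp M F (indicator A)"

definition cond_indep_events :: "'a measure \<Rightarrow> 'a measure \<Rightarrow> ('i \<Rightarrow> 'a set) \<Rightarrow> 'i set \<Rightarrow> bool" where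
  "cond_indep_events M F A I \<longleftrightarrow>
     (\<forall>i\<in>I. A i \<in> sets M) \<and>
     (\<forall>J\<subseteq>I. finite J \<and> J \<noteq> {} \<longrightarrow>
        (AE \<omega> in M. cond_prob_given M F (\<Inter>j\<in>J. A j) \<omega> = (\<Prod>j\<in>J. cond_prob_given M F (A j) \<omega>)))"

section \<open>The generalised random graph\<close>

text \<open>A simple graph on the vertex set \<open>{1..n}\<close> is represented by its edge set, a subset of
  \<open>vertex_pairs n\<close>.\<close>

definition vertex_pairs :: "nat \<Rightarrow> nat set set" where
  "vertex_pairs n = {{i, j} | i j. i \<in> {1..n} \<and> j \<in> {1..n} \<and> i \<noteq> j}"

definition edge_prob :: "nat \<Rightarrow> (nat \<Rightarrow> real) \<Rightarrow> nat \<Rightarrow> nat \<Rightarrow> real" where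
  "edge_prob n w i j = w i * w j / (w i * w j + (\<Sum>l=1..n. w l))"

definition weight_algebra :: "'a measure \<Rightarrow> nat \<Rightarrow> (nat \<Rightarrow> 'a \<Rightarrow> real) \<Rightarrow> 'a measure" where
  "weight_algebra M n X =
     vimage_algebra (space M) (\<lambda>\<omega>. \<lambda>i\<in>{1..n}. X i \<omega>) (\<Pi>\<^sub>M i\<in>{1..n}. (borel :: real measure))"

definition generalised_random_graph ::
  "'a measure \<Rightarrow> nat \<Rightarrow> real measure \<Rightarrow> (nat \<Rightarrow> 'a \<Rightarrow> real) \<Rightarrow> ('a \<Rightarrow> nat set set) \<Rightarrow> bool" where
  "generalised_random_graph M n \<nu> X G \<longleftrightarrow>
     prob_space M \<and>
     prob_space.indep_vars M (\<lambda>_. borel) X {1..n} \<and>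
     (\<forall>i\<in>{1..n}. distr M borel (X i) = \<nu>) \<and>
     (\<forall>\<omega>\<in>space M. G \<omega> \<subseteq> vertex_pairs n) \<and>
     cond_indep_events M (weight_algebra M n X) (\<lambda>e. {\<omega> \<in> space M. e \<in> G \<omega>}) (vertex_pairs n) \<and>
     (\<forall>i\<in>{1..n}. \<forall>j\<in>{1..n}. i \<noteq> j \<longrightarrow>
        (AE \<omega> in M. cond_prob_given M (weight_algebra M n X) {\<omega> \<in> space M. {i, j} \<in> G \<omega>} \<omega> =
           edge_prob n (\<lambda>l. X l \<omega>) i j))"

section \<open>Cycles\<close>

text \<open>A cycle, as a subgraph, is identified with its edge set; the lists below that differ only in
  starting vertex or orientation give the same set. The length of a cycle is its number of
  edges.\<close>

definition cycle_edges :: "'v list \<Rightarrow> 'v set set" where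
  "cycle_edges vs = {{vs ! i, vs ! (Suc i mod length vs)} | i. i < length vs}"

definition cycles :: "'v set set \<Rightarrow> 'v set set set" where
  "cycles G = {cycle_edges vs | vs. distinct vs \<and> 3 \<le> length vs \<and> cycle_edges vs \<subseteq> G}"

text \<open>The sum over all cycles of the unit point masses at their lengths.\<close>

definition cycle_process :: "'v set set \<Rightarrow> nat measure" where
  "cycle_process G = distr (count_space (cycles G)) (count_space {3..}) card"

lemma card_cycle_edges:
  assumes "distinct vs" "3 \<le> length vs"
  shows "card (cycle_edges vs) = length vs"
proof -
  let ?k = "length vs"
  have "inj_on (\<lambda>i. {vs ! i, vs ! (Suc i mod ?k)}) {..<?k}"
  proof (rule inj_onI)
    fix i j assume ij: "i \<in> {..<?k}" "j \<in> {..<?k}"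
      "{vs ! i, vs ! (Suc i mod ?k)} = {vs ! j, vs ! (Suc j mod ?k)}"
    have lt: "Suc i mod ?k < ?k" "Suc j mod ?k < ?k"
      using assms(2) by (auto intro!: mod_less_divisor)
    from ij(3) have "vs ! i = vs ! j \<or> vs ! i = vs ! (Suc j mod ?k) \<and> vs ! (Suc i mod ?k) = vs ! j"
      by (auto simp: doubleton_eq_iff)
    then have "i = j \<or> i = Suc j mod ?k \<and> Suc i mod ?k = j"
      using ij(1,2) lt nth_eq_iff_index_eq[OF assms(1)] by auto
    then show "i = j"
      using ij(1,2) assms(2) by (auto simp: mod_Suc split: if_splits)
  qed
  moreover have "cycle_edges vs = (\<lambda>i. {vs ! i, vs ! (Suc i mod ?k)}) ` {..<?k}"
    unfolding cycle_edges_def by auto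
  ultimately show ?thesis
    by (simp add: card_image)
qed

lemma card_cycles_ge: "card ` cycles G \<subseteq> {3..}"
  unfolding cycles_def by (auto simp: card_cycle_edges)

lemma emeasure_cycle_process:
  assumes "finite G" "A \<subseteq> {3..}"
  shows "emeasure (cycle_process G) A = of_nat (card {C \<in> cycles G. card C \<in> A})"
proof -
  have "cycles G \<subseteq> Pow G"
    unfolding cycles_def by auto
  then have fin: "finite (cycles G)"
    using assms(1) by (meson finite_Pow_iff finite_subset)
  have "emeasure (cycle_process G) A =
      emeasure (count_space (cycles G)) (card -` A \<inter> cycles G)"
    unfolding cycle_process_def using assms(2) card_cycles_ge[of G]
    by (subst emeasure_distr) (auto simp: Pi_iff)
  also have "card -` A \<inter> cycles G = {C \<in> cycles G. card C \<in> A}"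
    by auto
  also have "emeasure (count_space (cycles G)) \<dots> = of_nat (card {C \<in> cycles G. card C \<in> A})"
    using fin by (subst emeasure_count_space_finite) auto
  finally show ?thesis .
qed

lemma cycle_process_counting_measure:
  "finite G \<Longrightarrow> cycle_process G \<in> counting_measures {3..}"
  unfolding counting_measures_def
  by (auto simp: emeasure_cycle_process) (auto simp: cycle_process_def)

definition cycle_rate :: "'a measure \<Rightarrow> ('a \<Rightarrow> real) \<Rightarrow> nat \<Rightarrow> real" where
  "cycle_rate P W k =
     1 / (2 * real k) * ((\<integral>\<omega>. (W \<omega>)\<^sup>2 \<partial>P) / (\<integral>\<omega>. W \<omega> \<partial>P)) ^ k"

end

theory Submission
  imports Defs
begin

text \<open>Condition on the weights \<open>w\<close>. With \<open>L\<close> their sum and \<open>y v = w v / sqrt L\<close>, the edges are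
  independent, and the edge \<open>{u, v}\<close> has odds \<open>y u * y v\<close>. Suppose that all \<open>y v\<close> are at most a small
  \<open>d\<close>, and let \<open>S\<close> be the sum of the squares \<open>(y v)\<^sup>2\<close>. The odds along a cycle multiply to the product of
  the \<open>(y v)\<^sup>2\<close> over its vertices. Summing over all lists of \<open>k\<close> vertices gives \<open>S ^ k\<close>, repeated
  vertices cost a factor of order \<open>d\<^sup>2\<close>, and each cycle is traced by \<open>2 k\<close> lists
  (\<open>card_cycle_lists\<close>); so the mean number of \<open>k\<close>-cycles is close to \<open>S ^ k / (2 k)\<close>.

  The Poisson limit comes from Stein's characterisation in recursive form (\<open>stein_bound\<close>): for the
  vector of cycle counts, \<open>a k\<close> times the probability of \<open>a\<close> nearly equals the mean number of
  \<open>k\<close>-cycles times the probability of \<open>a\<close> lowered by one at \<open>k\<close>. Indeed, the presence of a cycle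
  \<open>\<alpha>\<close> is independent of the graph outside \<open>\<alpha>\<close>, and deleting the edges of \<open>\<alpha>\<close> changes no other count
  unless a second cycle shares an edge with \<open>\<alpha>\<close>. Such a cycle has to leave \<open>\<alpha>\<close> somewhere, which
  costs a factor \<open>d\<close> (\<open>overlap_bound\<close>). The recursion together with Markov's inequality for the tails
  forces the point probabilities to converge to products of Poisson weights
  (\<open>Poisson_limit_of_recursion\<close>). This uses the means of single cycles and of pairs of cycles, and no
  higher moments of the counts.

  For random weights, \<open>S\<close> is the quotient of the empirical means of \<open>W\<^sup>2\<close> and \<open>W\<close>, and the largest
  \<open>(y v)\<^sup>2\<close> is the quotient of the maximal squared weight by \<open>L\<close>. As \<open>W\<^sup>2\<close> is integrable, these tend in
  probability to \<open>E W\<^sup>2 / E W\<close> and to 0 (\<open>weak_law_of_large_numbers\<close>, \<open>max_tendsto_0\<close>). Averaging the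
  conditional laws over the weights (\<open>expect_graph_function\<close>) yields the limits of the finite
  dimensional point probabilities, \<open>cycle_counts_tendsto\<close>.

  A neighbourhood in the vague topology contains a cylinder determined by finitely many counts
  (\<open>openin_vague_cylinder\<close>), and there are countably many cylinders. Therefore convergence of the
  point probabilities to those of a probability measure is convergence in distribution
  (\<open>converges_in_distribution_vague\<close>).\<close>

section \<open>Finite product Bernoulli measures\<close>

text \<open>The probability that the random subset of \<open>E\<close> containing each \<open>e\<close> independently with
  probability \<open>p e\<close> equals \<open>g\<close>.\<close>

definition bern_weight :: "('e \<Rightarrow> real) \<Rightarrow> 'e set \<Rightarrow> 'e set \<Rightarrow> real" where
  "bern_weight p E g = (\<Prod>e\<in>g. p e) * (\<Prod>e\<in>E - g. 1 - p e)"

definition bern_expect :: "('e \<Rightarrow> real) \<Rightarrow> 'e set \<Rightarrow> ('e set \<Rightarrow> real) \<Rightarrow> real" where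
  "bern_expect p E \<phi> = (\<Sum>g\<in>Pow E. bern_weight p E g * \<phi> g)"

lemma bern_weight_nonneg:
  assumes "\<And>e. e \<in> E \<Longrightarrow> 0 \<le> p e \<and> p e \<le> 1" "g \<subseteq> E"
  shows "0 \<le> bern_weight p E g"
  unfolding bern_weight_def using assms by (intro mult_nonneg_nonneg prod_nonneg) (auto simp: subset_iff)

lemma sum_bern_weight:
  assumes "finite E"
  shows "(\<Sum>g\<in>Pow E. bern_weight p E g) = 1"
proof -
  have "(\<Sum>g\<in>Pow E. bern_weight p E g) = (\<Prod>e\<in>E. p e + (1 - p e))"
    unfolding bern_weight_def by (rule prod_add[symmetric]) fact
  then show ?thesis by simp
qed

lemma bern_expect_add: "bern_expect p E (\<lambda>g. \<phi> g + \<psi> g) = bern_expect p E \<phi> + bern_expect p E \<psi>"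
  by (simp add: bern_expect_def algebra_simps sum.distrib)

lemma bern_expect_diff: "bern_expect p E (\<lambda>g. \<phi> g - \<psi> g) = bern_expect p E \<phi> - bern_expect p E \<psi>"
  by (simp add: bern_expect_def algebra_simps sum_subtractf)

lemma bern_expect_cmult: "bern_expect p E (\<lambda>g. c * \<phi> g) = c * bern_expect p E \<phi>"
  by (simp add: bern_expect_def algebra_simps sum_distrib_left)

lemma bern_expect_sum: "bern_expect p E (\<lambda>g. \<Sum>i\<in>I. \<phi> i g) = (\<Sum>i\<in>I. bern_expect p E (\<phi> i))"
  unfolding bern_expect_def by (simp add: sum_distrib_left) (rule sum.swap)

lemma bern_expect_const: "finite E \<Longrightarrow> bern_expect p E (\<lambda>g. c) = c"
  using sum_bern_weight[of E p] by (simp add: bern_expect_def flip: sum_distrib_right)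

lemma bern_expect_cong: "(\<And>g. g \<subseteq> E \<Longrightarrow> \<phi> g = \<psi> g) \<Longrightarrow> bern_expect p E \<phi> = bern_expect p E \<psi>"
  by (simp add: bern_expect_def)

lemma bern_expect_cong_prob:
  assumes "\<And>e. e \<in> E \<Longrightarrow> p e = q e"
  shows "bern_expect p E \<phi> = bern_expect q E \<phi>"
proof -
  have "bern_weight p E g = bern_weight q E g" if "g \<subseteq> E" for g
    unfolding bern_weight_def using that assms by (intro arg_cong2[of _ _ _ _ times] prod.cong) auto
  then show ?thesis unfolding bern_expect_def by simp
qed

lemma bern_expect_mono:
  assumes "\<And>e. e \<in> E \<Longrightarrow> 0 \<le> p e \<and> p e \<le> 1" "\<And>g. g \<subseteq> E \<Longrightarrow> \<phi> g \<le> \<psi> g"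
  shows "bern_expect p E \<phi> \<le> bern_expect p E \<psi>"
  unfolding bern_expect_def
  by (intro sum_mono mult_left_mono bern_weight_nonneg assms) auto

lemma bern_expect_abs_diff_le:
  assumes "\<And>e. e \<in> E \<Longrightarrow> 0 \<le> p e \<and> p e \<le> 1"
    and "\<And>g. g \<subseteq> E \<Longrightarrow> \<bar>\<phi> g - \<psi> g\<bar> \<le> \<theta> g"
  shows "\<bar>bern_expect p E \<phi> - bern_expect p E \<psi>\<bar> \<le> bern_expect p E \<theta>"
proof -
  have "bern_expect p E (\<lambda>g. \<phi> g - \<psi> g) \<le> bern_expect p E \<theta>"
    using assms(2) by (intro bern_expect_mono assms(1)) (auto simp: abs_le_iff)
  moreover have "bern_expect p E (\<lambda>g. \<psi> g - \<phi> g) \<le> bern_expect p E \<theta>"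
    using assms(2) by (intro bern_expect_mono assms(1)) (auto simp: abs_le_iff)
  ultimately show ?thesis by (auto simp: bern_expect_diff)
qed

text \<open>The weight of a configuration is the product of its weights on \<open>A\<close> and on \<open>E - A\<close>, and the only
  configuration on \<open>A\<close> with all elements present is \<open>A\<close> itself.\<close>

lemma bern_expect_indep:
  assumes E: "finite E" and A: "A \<subseteq> E"
  shows "bern_expect p E (\<lambda>g. of_bool (A \<subseteq> g) * \<phi> (g - A))
       = (\<Prod>e\<in>A. p e) * bern_expect p E (\<lambda>g. \<phi> (g - A))"
proof -
  have fA: "finite A" using A E by (rule finite_subset)
  have split: "bern_expect p E \<psi> =
      (\<Sum>h\<in>Pow (E - A). \<Sum>b\<in>Pow A. bern_weight p A b * bern_weight p (E - A) h * \<psi> (b \<union> h))" for \<psi>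
  proof -
    have "bern_expect p E \<psi> =
        (\<Sum>(h, b)\<in>Pow (E - A) \<times> Pow A. bern_weight p A b * bern_weight p (E - A) h * \<psi> (b \<union> h))"
      unfolding bern_expect_def
    proof (rule sum.reindex_bij_witness[of _ "\<lambda>(h, b). b \<union> h" "\<lambda>g. (g - A, g \<inter> A)"])
      fix g assume g: "g \<in> Pow E"
      have fg: "finite g" using g E finite_subset by auto
      have "g = (g - A) \<union> (g \<inter> A)" "E - g = ((E - A) - (g - A)) \<union> (A - (g \<inter> A))"
        using A g by auto
      then have "bern_weight p E g =
          (\<Prod>e\<in>(g - A) \<union> (g \<inter> A). p e) * (\<Prod>e\<in>((E - A) - (g - A)) \<union> (A - (g \<inter> A)). 1 - p e)"
        unfolding bern_weight_def by metis
      also have "\<dots> = bern_weight p A (g \<inter> A) * bern_weight p (E - A) (g - A)"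
      proof -
        have "(\<Prod>e\<in>(g - A) \<union> (g \<inter> A). p e) = (\<Prod>e\<in>g - A. p e) * (\<Prod>e\<in>g \<inter> A. p e)"
          using fg by (intro prod.union_disjoint) auto
        moreover have "(\<Prod>e\<in>((E - A) - (g - A)) \<union> (A - (g \<inter> A)). 1 - p e) =
            (\<Prod>e\<in>(E - A) - (g - A). 1 - p e) * (\<Prod>e\<in>A - (g \<inter> A). 1 - p e)"
          using E fA by (intro prod.union_disjoint) auto
        ultimately show ?thesis by (simp add: bern_weight_def mult_ac)
      qed
      finally have w: "bern_weight p E g = bern_weight p A (g \<inter> A) * bern_weight p (E - A) (g - A)" .
      have "(g \<inter> A) \<union> (g - A) = g" by auto
      with w show "(case (g - A, g \<inter> A) of (h, b) \<Rightarrow>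
          bern_weight p A b * bern_weight p (E - A) h * \<psi> (b \<union> h)) = bern_weight p E g * \<psi> g"
        by simp
    qed (use A in auto)
    then show ?thesis using E fA by (simp add: sum.cartesian_product)
  qed
  have "bern_expect p E (\<lambda>g. of_bool (A \<subseteq> g) * \<phi> (g - A)) =
      (\<Sum>h\<in>Pow (E - A). \<Sum>b\<in>Pow A. if b = A then (\<Prod>e\<in>A. p e) * bern_weight p (E - A) h * \<phi> h else 0)"
    unfolding split
  proof (intro sum.cong refl)
    fix h b assume hb: "h \<in> Pow (E - A)" "b \<in> Pow A"
    then have "b \<union> h - A = h" "A \<subseteq> b \<union> h \<longleftrightarrow> b = A" by auto
    then show "bern_weight p A b * bern_weight p (E - A) h * (of_bool (A \<subseteq> b \<union> h) * \<phi> (b \<union> h - A)) =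
        (if b = A then (\<Prod>e\<in>A. p e) * bern_weight p (E - A) h * \<phi> h else 0)"
      by (simp add: bern_weight_def)
  qed
  also have "\<dots> = (\<Sum>h\<in>Pow (E - A). (\<Prod>e\<in>A. p e) * bern_weight p (E - A) h * \<phi> h)"
    using fA by simp
  also have "\<dots> = (\<Prod>e\<in>A. p e) * (\<Sum>h\<in>Pow (E - A). bern_weight p (E - A) h * \<phi> h)"
    by (simp add: sum_distrib_left mult_ac)
  also have "(\<Sum>h\<in>Pow (E - A). bern_weight p (E - A) h * \<phi> h) =
      (\<Sum>h\<in>Pow (E - A). (\<Sum>b\<in>Pow A. bern_weight p A b) * (bern_weight p (E - A) h * \<phi> h))"
    using fA by (simp add: sum_bern_weight)
  also have "\<dots> = bern_expect p E (\<lambda>g. \<phi> (g - A))"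
    unfolding split sum_distrib_right
  proof (intro sum.cong refl)
    fix h b assume hb: "h \<in> Pow (E - A)" "b \<in> Pow A"
    then have "b \<union> h - A = h" by auto
    then show "bern_weight p A b * (bern_weight p (E - A) h * \<phi> h)
      = bern_weight p A b * bern_weight p (E - A) h * \<phi> (b \<union> h - A)" by simp
  qed
  finally show ?thesis .
qed

lemma bern_expect_subset:
  assumes "finite E" "A \<subseteq> E"
  shows "bern_expect p E (\<lambda>g. of_bool (A \<subseteq> g)) = (\<Prod>e\<in>A. p e)"
  using bern_expect_indep[OF assms, of p "\<lambda>_. 1"] assms by (simp add: bern_expect_const)

section \<open>Poisson limits from the Stein recursion\<close>

text \<open>The recursion determines the limits of the point probabilities up to the common factor
  \<open>Q m (\<lambda>_. 0)\<close>. The tail bound keeps mass from escaping to infinity and thereby fixes this factor.\<close>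

lemma Poisson_limit_of_recursion:
  fixes Q :: "nat \<Rightarrow> ('i \<Rightarrow> nat) \<Rightarrow> real" and l :: "nat \<Rightarrow> 'i \<Rightarrow> real"
  assumes J: "finite J"
    and ext: "\<And>m a b. (\<And>j. j \<in> J \<Longrightarrow> a j = b j) \<Longrightarrow> Q m a = Q m b"
    and Q01: "\<And>m a. 0 \<le> Q m a" "\<And>m a. Q m a \<le> 1"
    and lim: "\<And>j. j \<in> J \<Longrightarrow> (\<lambda>m. l m j) \<longlonglongrightarrow> \<mu> j"
    and rec: "\<And>a k. k \<in> J \<Longrightarrow> 0 < a k \<Longrightarrow>
        (\<lambda>m. real (a k) * Q m a - l m k * Q m (a(k := a k - 1))) \<longlonglongrightarrow> 0"
    and box_le: "\<And>m T. (\<Sum>a\<in>PiE J (\<lambda>_. {..T}). Q m a) \<le> 1"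
    and box_ge: "\<And>m T. (\<Sum>a\<in>PiE J (\<lambda>_. {..T}). Q m a) \<ge> 1 - (\<Sum>j\<in>J. l m j) / real (Suc T)"
  shows "(\<lambda>m. Q m a) \<longlonglongrightarrow> (\<Prod>j\<in>J. \<mu> j ^ a j / fact (a j) * exp (- \<mu> j))"
proof -
  define c where "c m = Q m (\<lambda>_. 0)" for m
  define q where "q a = (\<Prod>j\<in>J. \<mu> j ^ a j / fact (a j))" for a :: "'i \<Rightarrow> nat"
  define \<Lambda> where "\<Lambda> = (\<Sum>j\<in>J. \<mu> j)"
  define \<sigma> where "\<sigma> T = (\<Sum>a\<in>PiE J (\<lambda>_. {..T::nat}). q a)" for T
  have c01: "0 \<le> c m" "c m \<le> 1" for m using Q01 by (auto simp: c_def)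
  \<comment> \<open>Lowering a positive coordinate by one multiplies both sides by the same factor in the limit.\<close>
  have one: "(\<lambda>m. Q m a - c m * q a) \<longlonglongrightarrow> 0" for a
  proof (induction "\<Sum>j\<in>J. a j" arbitrary: a)
    case 0
    then have z: "a j = 0" if "j \<in> J" for j using J that by auto
    have "Q m a = c m" for m unfolding c_def by (rule ext) (use z in auto)
    moreover have "q a = 1" unfolding q_def using z by simp
    ultimately show ?case by simp
  next
    case (Suc s)
    have "\<exists>k\<in>J. 0 < a k"
    proof (rule ccontr)
      assume "\<not> ?thesis"
      then have "(\<Sum>j\<in>J. a j) = 0" by auto
      with Suc(2) show False by simp
    qed
    then obtain k where k: "k \<in> J" "0 < a k" by auto
    define a' where "a' = a(k := a k - 1)"
    have "(\<Sum>j\<in>J. a j) = a k + (\<Sum>j\<in>J - {k}. a j)" using J k by (simp add: sum.remove)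
    moreover have "(\<Sum>j\<in>J. a' j) = a' k + (\<Sum>j\<in>J - {k}. a' j)" using J k by (simp add: sum.remove)
    moreover have "(\<Sum>j\<in>J - {k}. a' j) = (\<Sum>j\<in>J - {k}. a j)" by (intro sum.cong) (auto simp: a'_def)
    ultimately have "s = (\<Sum>j\<in>J. a' j)" using Suc(2) k by (simp add: a'_def)
    from Suc(1)[OF this] have IH: "(\<lambda>m. Q m a' - c m * q a') \<longlonglongrightarrow> 0" .
    have "q a = \<mu> k ^ a k / fact (a k) * (\<Prod>j\<in>J - {k}. \<mu> j ^ a j / fact (a j))"
      unfolding q_def using J k by (simp add: prod.remove)
    moreover have "q a' = \<mu> k ^ (a k - 1) / fact (a k - 1) * (\<Prod>j\<in>J - {k}. \<mu> j ^ a' j / fact (a' j))"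
      unfolding q_def using J k by (simp add: prod.remove a'_def)
    moreover have "(\<Prod>j\<in>J - {k}. \<mu> j ^ a' j / fact (a' j)) = (\<Prod>j\<in>J - {k}. \<mu> j ^ a j / fact (a j))"
      by (intro prod.cong) (auto simp: a'_def)
    moreover have "\<mu> k ^ a k / fact (a k) = \<mu> k / real (a k) * (\<mu> k ^ (a k - 1) / fact (a k - 1))"
      using k by (cases "a k") auto
    ultimately have qq: "q a = \<mu> k / real (a k) * q a'" by simp
    have z: "(\<lambda>m. (l m k - \<mu> k) * Q m a') \<longlonglongrightarrow> 0"
    proof (rule lim_null_mult_right_bounded[where B = 1])
      show "(\<lambda>m. l m k - \<mu> k) \<longlonglongrightarrow> 0" using lim[OF k(1)] by (simp add: LIM_zero)
      show "\<forall>\<^sub>F m in sequentially. norm (Q m a') \<le> 1" using Q01 by simp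
    qed
    have "(\<lambda>m. ((real (a k) * Q m a - l m k * Q m a') + (l m k - \<mu> k) * Q m a'
        + \<mu> k * (Q m a' - c m * q a')) / real (a k)) \<longlonglongrightarrow> (0 + 0 + \<mu> k * 0) / real (a k)"
      by (intro tendsto_intros rec[where k=k and a=a, OF k, folded a'_def] z IH) (use k in auto)
    moreover have "((real (a k) * Q m a - l m k * Q m a') + (l m k - \<mu> k) * Q m a'
        + \<mu> k * (Q m a' - c m * q a')) / real (a k) = Q m a - c m * q a" for m
      unfolding qq using k by (simp add: field_simps)
    ultimately show ?case by simp
  qed
  have \<sigma>_prod: "\<sigma> T = (\<Prod>j\<in>J. \<Sum>t\<le>T. \<mu> j ^ t / fact t)" for T
    unfolding \<sigma>_def q_def using J by (simp add: prod_sum_PiE)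
  have \<sigma>_lim: "\<sigma> \<longlonglongrightarrow> exp \<Lambda>"
  proof -
    have "(\<lambda>T. \<Sum>t\<le>T. \<mu> j ^ t / fact t) \<longlonglongrightarrow> exp (\<mu> j)" for j
      using exp_converges[of "\<mu> j"] by (simp add: sums_def_le divide_inverse mult.commute)
    then have "(\<lambda>T. \<Prod>j\<in>J. \<Sum>t\<le>T. \<mu> j ^ t / fact t) \<longlonglongrightarrow> (\<Prod>j\<in>J. exp (\<mu> j))"
      by (intro tendsto_prod)
    moreover have "\<sigma> = (\<lambda>T. \<Prod>j\<in>J. \<Sum>t\<le>T. \<mu> j ^ t / fact t)"
      by (rule HOL.ext) (rule \<sigma>_prod)
    ultimately show ?thesis using J by (simp add: \<Lambda>_def exp_sum)
  qed
  have c_\<sigma>: "(\<lambda>m. (\<Sum>a\<in>PiE J (\<lambda>_. {..T}). Q m a) - c m * \<sigma> T) \<longlonglongrightarrow> 0" for T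
  proof -
    have "(\<lambda>m. \<Sum>a\<in>PiE J (\<lambda>_. {..T}). (Q m a - c m * q a)) \<longlonglongrightarrow> (\<Sum>a\<in>PiE J (\<lambda>_. {..T}). 0)"
      by (intro tendsto_sum one)
    then show ?thesis by (simp add: \<sigma>_def sum_subtractf sum_distrib_left)
  qed
  \<comment> \<open>A box \<open>{0..T}\<close> in each coordinate has, for large \<open>T\<close>, \<open>Q m\<close>-mass close to 1 by the tail bound, and close to
    \<open>c m * exp \<Lambda>\<close> by the recursion.\<close>
  have c_lim: "(\<lambda>m. c m * exp \<Lambda> - 1) \<longlonglongrightarrow> 0"
  proof (rule LIMSEQ_I)
    fix r :: real assume r: "0 < r"
    have "(\<lambda>T. \<bar>exp \<Lambda> - \<sigma> T\<bar> + (\<bar>\<Lambda>\<bar> + 1) / real (Suc T)) \<longlonglongrightarrow> \<bar>exp \<Lambda> - exp \<Lambda>\<bar> + 0"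
      by (intro tendsto_intros \<sigma>_lim LIMSEQ_Suc[OF lim_const_over_n])
    then have "\<forall>\<^sub>F T in sequentially. \<bar>exp \<Lambda> - \<sigma> T\<bar> + (\<bar>\<Lambda>\<bar> + 1) / real (Suc T) < r / 2"
      by (rule order_tendstoD) (use r in auto)
    then obtain T where T: "\<bar>exp \<Lambda> - \<sigma> T\<bar> + (\<bar>\<Lambda>\<bar> + 1) / real (Suc T) < r / 2"
      by (auto simp: eventually_sequentially)
    have "(\<lambda>m. \<Sum>j\<in>J. l m j) \<longlonglongrightarrow> \<Lambda>" unfolding \<Lambda>_def by (intro tendsto_sum lim)
    then have "\<forall>\<^sub>F m in sequentially. (\<Sum>j\<in>J. l m j) < \<bar>\<Lambda>\<bar> + 1"
      by (rule order_tendstoD) auto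
    moreover have "\<forall>\<^sub>F m in sequentially. \<bar>(\<Sum>a\<in>PiE J (\<lambda>_. {..T}). Q m a) - c m * \<sigma> T\<bar> < r / 2"
      using tendsto_rabs_zero[OF c_\<sigma>[of T]] by (rule order_tendstoD) (use r in auto)
    ultimately have "\<forall>\<^sub>F m in sequentially. norm (c m * exp \<Lambda> - 1 - 0) < r"
    proof eventually_elim
      case (elim m)
      let ?s = "\<Sum>a\<in>PiE J (\<lambda>_. {..T}). Q m a"
      have "(\<Sum>j\<in>J. l m j) / real (Suc T) \<le> (\<bar>\<Lambda>\<bar> + 1) / real (Suc T)"
        using elim by (intro divide_right_mono) auto
      then have s: "\<bar>?s - 1\<bar> \<le> (\<bar>\<Lambda>\<bar> + 1) / real (Suc T)"
        using box_le[of m T] box_ge[of m T] by linarith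
      have "\<bar>c m * (exp \<Lambda> - \<sigma> T)\<bar> \<le> 1 * \<bar>exp \<Lambda> - \<sigma> T\<bar>"
        unfolding abs_mult by (intro mult_right_mono) (use c01[of m] in auto)
      moreover have "c m * exp \<Lambda> - 1 = c m * (exp \<Lambda> - \<sigma> T) - (?s - c m * \<sigma> T) + (?s - 1)"
        by (simp add: algebra_simps)
      moreover have "\<bar>x - y + z\<bar> \<le> X + \<bar>y\<bar> + \<bar>z\<bar>" if "\<bar>x\<bar> \<le> X" for x y z X :: real
        using that by linarith
      ultimately have "\<bar>c m * exp \<Lambda> - 1\<bar> \<le> \<bar>exp \<Lambda> - \<sigma> T\<bar> + \<bar>?s - c m * \<sigma> T\<bar> + \<bar>?s - 1\<bar>"
        by (metis mult_1)
      then have "\<bar>c m * exp \<Lambda> - 1\<bar> < r" using s elim T by linarith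
      then show ?case by simp
    qed
    then show "\<exists>no. \<forall>n\<ge>no. norm (c n * exp \<Lambda> - 1 - 0) < r" by (simp add: eventually_sequentially)
  qed
  have "(\<lambda>m. (Q m a - c m * q a) + ((c m * exp \<Lambda> - 1) + 1) * (exp (- \<Lambda>) * q a))
      \<longlonglongrightarrow> 0 + (0 + 1) * (exp (- \<Lambda>) * q a)"
    by (intro tendsto_intros one c_lim)
  moreover have "(Q m a - c m * q a) + ((c m * exp \<Lambda> - 1) + 1) * (exp (- \<Lambda>) * q a) = Q m a" for m
    by (simp add: exp_minus mult.assoc)
  moreover have "exp (- \<Lambda>) * q a = (\<Prod>j\<in>J. \<mu> j ^ a j / fact (a j) * exp (- \<mu> j))"
    using J by (simp only: q_def \<Lambda>_def prod.distrib sum_negf[symmetric] exp_sum mult.commute)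
  ultimately show ?thesis by (simp only: add_0 mult_1)
qed

section \<open>Cycles and the lists that trace them\<close>

lemma cycle_edges_image:
  "cycle_edges vs = (\<lambda>i. {vs ! i, vs ! (Suc i mod length vs)}) ` {..<length vs}"
  unfolding cycle_edges_def by auto

lemma inj_on_cycle_edges:
  assumes "distinct vs" "3 \<le> length vs"
  shows "inj_on (\<lambda>i. {vs ! i, vs ! (Suc i mod length vs)}) {..<length vs}"
  by (rule eq_card_imp_inj_on)
    (use card_cycle_edges[OF assms] in \<open>simp_all add: cycle_edges_image\<close>)

lemma bij_betw_Suc_mod:
  assumes "0 < k" shows "bij_betw (\<lambda>i. Suc i mod k) {..<k} {..<k}"
proof -
  have "inj_on (\<lambda>i. Suc i mod k) {..<k}"
    by (rule inj_onI) (auto simp: mod_Suc split: if_splits)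
  moreover have "(\<lambda>i. Suc i mod k) ` {..<k} \<subseteq> {..<k}" using assms by auto
  ultimately show ?thesis
    by (simp add: bij_betw_def endo_inj_surj)
qed

lemma Union_cycle_edges:
  shows "\<Union> (cycle_edges vs) = set vs"
proof
  show "\<Union> (cycle_edges vs) \<subseteq> set vs"
    unfolding cycle_edges_def by (auto intro!: nth_mem mod_less_divisor)
  show "set vs \<subseteq> \<Union> (cycle_edges vs)"
    unfolding cycle_edges_image by (auto simp: in_set_conv_nth)
qed

lemma card_edge_cycle_edges:
  assumes "distinct vs" "3 \<le> length vs" "e \<in> cycle_edges vs"
  shows "card e = 2"
proof -
  obtain i where i: "i < length vs" "e = {vs ! i, vs ! (Suc i mod length vs)}"
    using assms(3) unfolding cycle_edges_def by auto
  have "Suc i mod length vs < length vs" "Suc i mod length vs \<noteq> i"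
    using assms(2) i(1) by (auto intro!: mod_less_divisor simp: mod_Suc split: if_splits)
  then show ?thesis using assms(1) i by (auto simp: nth_eq_iff_index_eq card_2_iff)
qed

text \<open>The edges at a vertex are those with the index of the vertex or of its predecessor. Writing the
  vertex as a successor avoids a case distinction for the first entry.\<close>

lemma cycle_edges_at:
  assumes d: "distinct vs" and k: "3 \<le> length vs" and i: "i < length vs"
  shows "{e \<in> cycle_edges vs. vs ! (Suc i mod length vs) \<in> e} =
    {{vs ! i, vs ! (Suc i mod length vs)},
     {vs ! (Suc i mod length vs), vs ! (Suc (Suc i mod length vs) mod length vs)}}"
    (is "?L = ?R")
proof -
  let ?k = "length vs" let ?j = "Suc i mod length vs"
  have j: "?j < ?k" using k by (auto intro!: mod_less_divisor)
  show ?thesis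
  proof
    show "?R \<subseteq> ?L" unfolding cycle_edges_def using i j by auto
    show "?L \<subseteq> ?R"
    proof
      fix e assume "e \<in> ?L"
      then obtain h where h: "h < ?k" "e = {vs ! h, vs ! (Suc h mod ?k)}" "vs ! ?j \<in> e"
        unfolding cycle_edges_def by auto
      have h': "Suc h mod ?k < ?k" using k by (auto intro!: mod_less_divisor)
      have "?j = h \<or> ?j = Suc h mod ?k"
        using h j h' d by (auto simp: nth_eq_iff_index_eq)
      moreover have "h = i" if "?j = Suc h mod ?k"
        using that h(1) i by (auto simp: mod_Suc split: if_splits)
      ultimately show "e \<in> ?R" using h(2) by auto
    qed
  qed
qed

lemma cycle_edges_at_card:
  assumes d: "distinct vs" and k: "3 \<le> length vs" and v: "v \<in> set vs"
  shows "card {e \<in> cycle_edges vs. v \<in> e} = 2"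
proof -
  let ?k = "length vs"
  obtain j where j: "j < ?k" "v = vs ! j" using v by (auto simp: in_set_conv_nth)
  obtain i where i: "i < ?k" "j = Suc i mod ?k"
  proof -
    have "j \<in> (\<lambda>i. Suc i mod ?k) ` {..<?k}"
    proof -
      have "0 < ?k" using k by linarith
      then show ?thesis using bij_betw_imp_surj_on[OF bij_betw_Suc_mod[of ?k]] j by simp
    qed
    then show thesis using that by auto
  qed
  have "{vs ! i, vs ! j} \<noteq> {vs ! j, vs ! (Suc j mod ?k)}"
  proof
    assume "{vs ! i, vs ! j} = {vs ! j, vs ! (Suc j mod ?k)}"
    then have "vs ! i = vs ! (Suc j mod ?k)" by (auto simp: doubleton_eq_iff)
    moreover have "Suc j mod ?k < ?k" using k by (intro mod_less_divisor) linarith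
    ultimately have "i = Suc j mod ?k" using nth_eq_iff_index_eq[OF d] i(1) by blast
    then show False using i k by (auto simp: mod_Suc split: if_splits)
  qed
  then show ?thesis
    using cycle_edges_at[OF d k i(1)] unfolding i(2)[symmetric] j(2)[symmetric] by simp
qed

text \<open>A vertex of the smaller cycle has degree two in both cycles, so the larger cycle has no further
  edge there. Hence a walk along the larger cycle never leaves the smaller one.\<close>

lemma cycle_edges_subset_imp_eq:
  assumes vs: "distinct vs" "3 \<le> length vs" and ws: "distinct ws" "3 \<le> length ws"
    and sub: "cycle_edges vs \<subseteq> cycle_edges ws"
  shows "cycle_edges vs = cycle_edges ws"
proof -
  let ?C = "cycle_edges vs" and ?D = "cycle_edges ws" and ?l = "length ws"
  have fin: "finite ?D" unfolding cycle_edges_image by simp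
  have sv: "set vs \<subseteq> set ws" using sub Union_cycle_edges by (metis Union_mono)
  have at: "{e \<in> ?C. v \<in> e} = {e \<in> ?D. v \<in> e}" if "v \<in> set vs" for v
    using cycle_edges_at_card[OF vs that] cycle_edges_at_card[OF ws, of v] that sv sub fin
    by (intro card_subset_eq) auto
  have step: "{ws ! i, ws ! (Suc i mod ?l)} \<in> ?C" if "i < ?l" "ws ! i \<in> set vs" for i
    using at[OF that(2)] that(1) unfolding cycle_edges_def[of ws] by blast
  have nxt: "ws ! (Suc i mod ?l) \<in> set vs" if "i < ?l" "ws ! i \<in> set vs" for i
    using step[OF that] Union_cycle_edges[of vs] by blast
  have "vs ! 0 \<in> set vs" using vs(2) by (intro nth_mem) linarith
  then obtain s where s: "s < ?l" "ws ! s \<in> set vs"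
    using sv by (metis in_set_conv_nth subsetD)
  have all: "ws ! ((s + m) mod ?l) \<in> set vs" for m
  proof (induction m)
    case 0 then show ?case using s by simp
  next
    case (Suc m)
    have "(s + m) mod ?l < ?l" using s by (intro mod_less_divisor) linarith
    then show ?case using nxt[OF _ Suc] by (simp add: mod_Suc_eq)
  qed
  have "ws ! i \<in> set vs" if "i < ?l" for i
    using all[of "?l - s + i"] s that by (simp add: add.assoc[symmetric])
  then have "?D \<subseteq> ?C" using step unfolding cycle_edges_def[of ws] by blast
  with sub show ?thesis by auto
qed

lemma cycle_edges_rotate1: "cycle_edges (rotate1 vs) = cycle_edges vs"
proof (cases "vs = []")
  case False
  let ?k = "length vs"
  have k: "0 < ?k" using False by simp
  have "cycle_edges (rotate1 vs) = (\<lambda>i. {vs ! (Suc i mod ?k), vs ! (Suc (Suc i mod ?k) mod ?k)}) ` {..<?k}"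
    unfolding cycle_edges_image
  proof (rule image_cong)
    fix i assume "i \<in> {..<?k}"
    then have i: "i < ?k" by simp
    have "Suc i mod ?k < ?k" using k by (rule mod_less_divisor)
    then show "{rotate1 vs ! i, rotate1 vs ! (Suc i mod length (rotate1 vs))} =
        {vs ! (Suc i mod ?k), vs ! (Suc (Suc i mod ?k) mod ?k)}"
      using i by (simp only: nth_rotate1 length_rotate1)
  qed simp
  also have "\<dots> = (\<lambda>i. {vs ! i, vs ! (Suc i mod ?k)}) ` ((\<lambda>i. Suc i mod ?k) ` {..<?k})"
    by (simp add: image_image)
  also have "(\<lambda>i. Suc i mod ?k) ` {..<?k} = {..<?k}"
    using bij_betw_Suc_mod[OF k] by (simp add: bij_betw_def)
  finally show ?thesis by (simp add: cycle_edges_image)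
qed simp

lemma cycle_edges_rotate: "cycle_edges (rotate m vs) = cycle_edges vs"
  by (induction m) (simp_all add: cycle_edges_rotate1)

lemma cycle_edges_rev: "cycle_edges (rev vs) = cycle_edges vs"
proof -
  have sub: "cycle_edges (rev ws) \<subseteq> cycle_edges ws" for ws :: "'a list"
  proof
    fix e assume "e \<in> cycle_edges (rev ws)"
    then obtain i where i: "i < length ws" "e = {rev ws ! i, rev ws ! (Suc i mod length ws)}"
      unfolding cycle_edges_def by auto
    let ?k = "length ws"
    have lt: "Suc i mod ?k < ?k" using i by (auto intro!: mod_less_divisor)
    define j where "j = ?k - Suc (Suc i mod ?k)"
    have j: "j < ?k" "Suc j mod ?k = ?k - Suc i"
      using i lt unfolding j_def by (auto simp: mod_Suc split: if_splits)
    have "e = {ws ! j, ws ! (Suc j mod ?k)}"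
      using i lt j unfolding j_def by (auto simp: rev_nth)
    then show "e \<in> cycle_edges ws" using j unfolding cycle_edges_def by auto
  qed
  show ?thesis using sub[of vs] sub[of "rev vs"] by simp
qed

text \<open>Each further vertex is reached by the edge at the current vertex other than the one just used.\<close>

lemma cycle_list_unique:
  assumes vs: "distinct vs" "3 \<le> length vs" and ws: "distinct ws" "length ws = length vs"
    and eq: "cycle_edges vs = cycle_edges ws" and "vs ! 0 = ws ! 0" "vs ! 1 = ws ! 1"
  shows "vs = ws"
proof -
  let ?k = "length vs"
  have "Suc i < ?k \<Longrightarrow> vs ! i = ws ! i \<and> vs ! Suc i = ws ! Suc i" for i
  proof (induction i)
    case 0 show ?case using assms(6,7) by (simp only: One_nat_def simp_thms)
  next
    case (Suc i)
    then have IH: "vs ! i = ws ! i" "vs ! Suc i = ws ! Suc i" by auto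
    have *: "{e \<in> cycle_edges us. us ! Suc i \<in> e} = {{us ! i, us ! Suc i}, {us ! Suc i, us ! Suc (Suc i)}}"
      if "distinct us" "length us = ?k" for us
    proof -
      have "Suc i mod length us = Suc i" "Suc (Suc i) mod length us = Suc (Suc i)"
        using that(2) Suc(2) by auto
      then show ?thesis
        using cycle_edges_at[of us i] that Suc(2) vs(2) by (simp only:) 
    qed
    have 1: "{{vs ! i, vs ! Suc i}, {vs ! Suc i, vs ! Suc (Suc i)}}
        = {{vs ! i, vs ! Suc i}, {vs ! Suc i, ws ! Suc (Suc i)}}"
      using *[OF vs(1) refl] *[OF ws] unfolding eq IH by (simp only:)
    have 2: "vs ! i \<noteq> vs ! Suc (Suc i)" using vs Suc(2) by (simp add: nth_eq_iff_index_eq)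
    have cd: "c = d" if "{{a, b}, {b, c}} = {{a, b}, {b, d}}" "a \<noteq> c" for a b c d :: 'a
    proof -
      have "{b, c} \<in> {{a, b}, {b, d}}" unfolding that(1)[symmetric] by simp
      then have "{b, c} = {a, b} \<or> {b, c} = {b, d}" by (simp only: insert_iff empty_iff simp_thms)
      then show ?thesis using that(2) unfolding doubleton_eq_iff by metis
    qed
    have "vs ! Suc (Suc i) = ws ! Suc (Suc i)" by (rule cd[OF 1 2])
    with IH(2) show ?case by (rule conjI)
  qed
  then have step: "vs ! Suc i = ws ! Suc i" if "Suc i < ?k" for i
    using that by blast
  have "vs ! i = ws ! i" if "i < ?k" for i
  proof (cases i)
    case 0 then show ?thesis using assms(6) by (simp only:)
  next
    case (Suc j) then show ?thesis using step[of j] that by (simp only:)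
  qed
  then show ?thesis using ws(2) by (intro nth_equalityI) (simp_all only:)
qed

text \<open>A list tracing the cycle is determined by its first step, which is an edge with a direction, and
  every directed edge occurs as a first step after a rotation and possibly a reversal of \<open>ws\<close>.\<close>

lemma card_cycle_lists:
  assumes ws: "distinct ws" "3 \<le> length ws"
  shows "card {vs. distinct vs \<and> length vs = length ws \<and> cycle_edges vs = cycle_edges ws} = 2 * length ws"
proof -
  let ?k = "length ws" and ?C = "cycle_edges ws"
  let ?L = "{vs. distinct vs \<and> length vs = ?k \<and> cycle_edges vs = ?C}"
  let ?P = "\<Union>e\<in>?C. {(u, v). {u, v} = e}"
  have "bij_betw (\<lambda>vs. (vs ! 0, vs ! 1)) ?L ?P"
    unfolding bij_betw_def
  proof
    show "inj_on (\<lambda>vs. (vs ! 0, vs ! 1)) ?L"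
      by (rule inj_onI) (use ws in \<open>auto intro!: cycle_list_unique\<close>)
    show "(\<lambda>vs. (vs ! 0, vs ! 1)) ` ?L = ?P"
    proof
      show "(\<lambda>vs. (vs ! 0, vs ! 1)) ` ?L \<subseteq> ?P"
      proof
        fix x assume "x \<in> (\<lambda>vs. (vs ! 0, vs ! 1)) ` ?L"
        then obtain vs where vs: "x = (vs ! 0, vs ! 1)" "length vs = ?k" "cycle_edges vs = ?C" by auto
        have "{vs ! 0, vs ! (Suc 0 mod length vs)} \<in> cycle_edges vs"
          unfolding cycle_edges_def using vs ws by (intro CollectI exI[of _ 0]) auto
        then show "x \<in> ?P" using vs ws by auto
      qed
      have fwd: "(us ! i, us ! (Suc i mod ?k)) \<in> (\<lambda>vs. (vs ! 0, vs ! 1)) ` ?L"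
        if us: "us \<in> ?L" and i: "i < ?k" for us i
      proof (rule image_eqI)
        show "(us ! i, us ! (Suc i mod ?k)) = (rotate i us ! 0, rotate i us ! 1)"
          proof -
        have "rotate i us ! 0 = us ! i" "rotate i us ! 1 = us ! (Suc i mod ?k)"
        proof -
          have l: "length us = ?k" "0 < ?k" "1 < ?k" using us ws(2) by auto
          show "rotate i us ! 0 = us ! i" using nth_rotate[of 0 us i] l i by simp
          show "rotate i us ! 1 = us ! (Suc i mod ?k)" using nth_rotate[of 1 us i] l i by simp
        qed
        then show ?thesis by simp
      qed
        show "rotate i us \<in> ?L" using us by (auto simp: cycle_edges_rotate)
      qed
      show "?P \<subseteq> (\<lambda>vs. (vs ! 0, vs ! 1)) ` ?L"
      proof safe
        fix u v assume "{u, v} \<in> ?C"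
        then obtain i where i: "i < ?k" "{u, v} = {ws ! i, ws ! (Suc i mod ?k)}"
          unfolding cycle_edges_def by auto
        from i(2) consider "u = ws ! i" "v = ws ! (Suc i mod ?k)" | "v = ws ! i" "u = ws ! (Suc i mod ?k)"
          by (auto simp: doubleton_eq_iff)
        then show "(u, v) \<in> (\<lambda>vs. (vs ! 0, vs ! 1)) ` ?L"
        proof cases
          case 1 then show ?thesis using fwd[of ws i] ws i by simp
        next
          case 2
          let ?h = "Suc i mod ?k"
          have lt: "?h < ?k" using ws by (auto intro!: mod_less_divisor)
          have "Suc (?k - Suc ?h) mod ?k = ?k - Suc i"
            using i lt by (auto simp: mod_Suc split: if_splits)
          then show ?thesis using fwd[of "rev ws" "?k - Suc ?h"] ws i lt 2
            by (auto simp: rev_nth cycle_edges_rev)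
        qed
      qed
    qed
  qed
  then have "card ?L = card ?P" by (rule bij_betw_same_card)
  also have "card ?P = (\<Sum>e\<in>?C. card {(u, v). {u, v} = e})"
  proof (rule card_UN_disjoint)
    show "finite ?C" unfolding cycle_edges_image by simp
    show "\<forall>e\<in>?C. finite {(u, v). {u, v} = e}"
    proof
      fix e assume "e \<in> ?C"
      then have "finite e" using card_edge_cycle_edges[OF ws] by (metis card.infinite zero_neq_numeral)
      then have "finite (e \<times> e)" by simp
      moreover have "{(u, v). {u, v} = e} \<subseteq> e \<times> e" by blast
      ultimately show "finite {(u, v). {u, v} = e}" using finite_subset by blast
    qed
    show "\<forall>e\<in>?C. \<forall>f\<in>?C. e \<noteq> f \<longrightarrow> {(u, v). {u, v} = e} \<inter> {(u, v). {u, v} = f} = {}"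
      by blast
  qed
  also have "\<dots> = (\<Sum>e\<in>?C. 2)"
  proof (rule sum.cong[OF refl])
    fix e assume "e \<in> ?C"
    then obtain a b where ab: "e = {a, b}" "a \<noteq> b"
      using card_edge_cycle_edges[OF ws] by (metis card_2_iff)
    have "{(u, v). {u, v} = e} = {(a, b), (b, a)}" using ab by (auto simp: doubleton_eq_iff)
    then show "card {(u, v). {u, v} = e} = 2" using ab by simp
  qed
  also have "\<dots> = 2 * ?k" using card_cycle_edges[OF ws] by simp
  finally show ?thesis .
qed

lemma cycles_restrict: "g \<subseteq> E \<Longrightarrow> cycles g = {C \<in> cycles E. C \<subseteq> g}"
  unfolding cycles_def by blast

lemma finite_cycles: "finite E \<Longrightarrow> finite (cycles E)"
  by (rule finite_subset[of _ "Pow E"]) (auto simp: cycles_def)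

lemma cycles_antichain: "C \<in> cycles E \<Longrightarrow> D \<in> cycles E \<Longrightarrow> C \<subseteq> D \<Longrightarrow> C = D"
  unfolding cycles_def using cycle_edges_subset_imp_eq by blast

definition complete_graph :: "'v set \<Rightarrow> 'v set set" where
  "complete_graph V = {{u, v} | u v. u \<in> V \<and> v \<in> V \<and> u \<noteq> v}"

definition cycles_of_length :: "'v set set \<Rightarrow> nat \<Rightarrow> 'v set set set" where
  "cycles_of_length g k = {C \<in> cycles g. card C = k}"

definition distinct_lists :: "'v set \<Rightarrow> nat \<Rightarrow> 'v list set" where
  "distinct_lists V k = {vs. set vs \<subseteq> V \<and> distinct vs \<and> length vs = k}"

lemma finite_distinct_lists: "finite V \<Longrightarrow> finite (distinct_lists V k)"
  unfolding distinct_lists_def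
  by (rule finite_subset[OF _ finite_lists_length_eq[of V k]]) auto

lemma finite_complete_graph: "finite V \<Longrightarrow> finite (complete_graph V)"
  by (rule finite_subset[of _ "Pow V"]) (auto simp: complete_graph_def)

lemma cycle_edges_in_complete_graph:
  assumes "distinct vs" "3 \<le> length vs"
  shows "cycle_edges vs \<subseteq> complete_graph V \<longleftrightarrow> set vs \<subseteq> V"
proof
  assume "cycle_edges vs \<subseteq> complete_graph V"
  then have "\<Union> (cycle_edges vs) \<subseteq> \<Union> (complete_graph V)" by blast
  then show "set vs \<subseteq> V" unfolding Union_cycle_edges by (auto simp: complete_graph_def)
next
  assume V: "set vs \<subseteq> V"
  show "cycle_edges vs \<subseteq> complete_graph V"
  proof
    fix e assume e: "e \<in> cycle_edges vs"
    then obtain a b where "e = {a, b}" "a \<noteq> b"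
      using card_edge_cycle_edges[OF assms] by (metis card_2_iff)
    then show "e \<in> complete_graph V" using e V Union_cycle_edges[of vs] 
      unfolding complete_graph_def by blast
  qed
qed

lemma cycles_of_length_complete_graph:
  assumes "3 \<le> k"
  shows "cycles_of_length (complete_graph V) k = cycle_edges ` distinct_lists V k"
proof
  show "cycles_of_length (complete_graph V) k \<subseteq> cycle_edges ` distinct_lists V k"
  proof
    fix C assume "C \<in> cycles_of_length (complete_graph V) k"
    then obtain vs where vs: "C = cycle_edges vs" "distinct vs" "3 \<le> length vs"
        "cycle_edges vs \<subseteq> complete_graph V" "card C = k"
      unfolding cycles_of_length_def cycles_def by blast
    then have "vs \<in> distinct_lists V k"
      unfolding distinct_lists_def
      using cycle_edges_in_complete_graph[of vs V] card_cycle_edges[of vs] by simp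
    with vs(1) show "C \<in> cycle_edges ` distinct_lists V k" by (rule image_eqI)
  qed
  show "cycle_edges ` distinct_lists V k \<subseteq> cycles_of_length (complete_graph V) k"
  proof
    fix C assume "C \<in> cycle_edges ` distinct_lists V k"
    then obtain vs where vs: "C = cycle_edges vs" "set vs \<subseteq> V" "distinct vs" "length vs = k"
      unfolding distinct_lists_def by auto
    then have "C \<in> cycles (complete_graph V)"
      unfolding cycles_def using assms cycle_edges_in_complete_graph[of vs V] by blast
    then show "C \<in> cycles_of_length (complete_graph V) k"
      unfolding cycles_of_length_def using vs assms card_cycle_edges[of vs] by simp
  qed
qed

text \<open>Sums over cycles become sums over lists, which can be built up one vertex at a time.\<close>

lemma sum_over_cycle_lists:
  fixes F :: "'v set set \<Rightarrow> real"
  assumes V: "finite V" and k: "3 \<le> k"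
  shows "(\<Sum>vs\<in>distinct_lists V k. F (cycle_edges vs)) =
    2 * real k * (\<Sum>C\<in>cycles_of_length (complete_graph V) k. F C)"
proof -
  have "(\<Sum>vs\<in>distinct_lists V k. F (cycle_edges vs)) =
      (\<Sum>C\<in>cycle_edges ` distinct_lists V k. \<Sum>vs\<in>{vs \<in> distinct_lists V k. cycle_edges vs = C}. F (cycle_edges vs))"
    by (rule sum.image_gen[OF finite_distinct_lists[OF V]])
  also have "\<dots> = (\<Sum>C\<in>cycle_edges ` distinct_lists V k. 2 * real k * F C)"
  proof (rule sum.cong[OF refl])
    fix C :: "'v set set" assume "C \<in> cycle_edges ` distinct_lists V k"
    then obtain ws where ws: "C = cycle_edges ws" "set ws \<subseteq> V" "distinct ws" "length ws = k"
      unfolding distinct_lists_def by auto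
    have "{vs \<in> distinct_lists V k. cycle_edges vs = C}
        = {vs. distinct vs \<and> length vs = length ws \<and> cycle_edges vs = cycle_edges ws}"
    proof -
      have "set vs \<subseteq> V" if "cycle_edges vs = cycle_edges ws" for vs
        using Union_cycle_edges[of vs] Union_cycle_edges[of ws] that ws(2) by simp
      then have "set vs \<subseteq> V \<and> distinct vs \<and> length vs = k \<and> cycle_edges vs = cycle_edges ws \<longleftrightarrow>
          distinct vs \<and> length vs = k \<and> cycle_edges vs = cycle_edges ws" for vs
        by metis
      then show ?thesis unfolding distinct_lists_def ws(1,4) by simp
    qed
    then have "card {vs \<in> distinct_lists V k. cycle_edges vs = C} = 2 * k"
      using card_cycle_lists[of ws] ws(3,4) k by (simp only:)
    moreover have "(\<Sum>vs\<in>{vs \<in> distinct_lists V k. cycle_edges vs = C}. F (cycle_edges vs)) =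
        (\<Sum>vs\<in>{vs \<in> distinct_lists V k. cycle_edges vs = C}. F C)"
      by (intro sum.cong) auto
    ultimately show "(\<Sum>vs\<in>{vs \<in> distinct_lists V k. cycle_edges vs = C}. F (cycle_edges vs)) = 2 * real k * F C"
      by (simp only: sum_constant of_nat_mult of_nat_numeral)
  qed
  finally show ?thesis
    by (simp add: cycles_of_length_complete_graph[OF k] sum_distrib_left)
qed

section \<open>Random graphs with edge odds of rank one\<close>

lemma sum_prod_list_all:
  fixes f :: "'v \<Rightarrow> real"
  assumes V: "finite V"
  shows "(\<Sum>vs\<in>{vs. set vs \<subseteq> V \<and> length vs = k}. prod_list (map f vs)) = (\<Sum>v\<in>V. f v) ^ k"
proof (induction k)
  case 0
  have "{vs. set vs \<subseteq> V \<and> length vs = 0} = {[]}" by auto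
  then show ?case by simp
next
  case (Suc k)
  let ?L = "{vs. set vs \<subseteq> V \<and> length vs = k}"
  have "(\<Sum>vs\<in>{vs. set vs \<subseteq> V \<and> length vs = Suc k}. prod_list (map f vs)) =
      (\<Sum>(v, vs)\<in>V \<times> ?L. f v * prod_list (map f vs))"
    by (rule sum.reindex_bij_witness[of _ "\<lambda>(v, vs). v # vs" "\<lambda>vs. (hd vs, tl vs)"])
      (auto simp: length_Suc_conv)
  also have "\<dots> = (\<Sum>v\<in>V. f v) * (\<Sum>vs\<in>?L. prod_list (map f vs))"
    by (simp add: sum_product sum.cartesian_product)
  finally show ?case using Suc by simp
qed

text \<open>This is \<open>k!\<close> times the \<open>k\<close>-th elementary symmetric polynomial in the values of \<open>f\<close> on \<open>V\<close>.\<close>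

definition list_mass :: "'v set \<Rightarrow> ('v \<Rightarrow> real) \<Rightarrow> nat \<Rightarrow> real" where
  "list_mass V f k = (\<Sum>vs\<in>distinct_lists V k. prod_list (map f vs))"

lemma list_mass_0: "list_mass V f 0 = 1"
proof -
  have "distinct_lists V 0 = {[]}" by (auto simp: distinct_lists_def)
  then show ?thesis by (simp add: list_mass_def)
qed

lemma prod_list_nonneg_on:
  fixes f :: "'v \<Rightarrow> real"
  shows "(\<And>v. v \<in> set vs \<Longrightarrow> 0 \<le> f v) \<Longrightarrow> 0 \<le> prod_list (map f vs)"
  by (induction vs) auto

lemma list_mass_Suc:
  assumes V: "finite V"
  shows "list_mass V f (Suc k) =
    (\<Sum>vs\<in>distinct_lists V k. (\<Sum>v\<in>V - set vs. f v) * prod_list (map f vs))"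
proof -
  have "list_mass V f (Suc k) =
      (\<Sum>(vs, v)\<in>Sigma (distinct_lists V k) (\<lambda>vs. V - set vs). f v * prod_list (map f vs))"
    unfolding list_mass_def
    by (rule sum.reindex_bij_witness[of _ "\<lambda>(vs, v). v # vs" "\<lambda>vs. (tl vs, hd vs)"])
      (auto simp: length_Suc_conv distinct_lists_def)
  also have "\<dots> = (\<Sum>vs\<in>distinct_lists V k. (\<Sum>v\<in>V - set vs. f v * prod_list (map f vs)))"
    using V finite_distinct_lists[OF V] by (subst sum.Sigma) auto
  finally show ?thesis by (simp add: sum_distrib_right)
qed

text \<open>A list is extended by any vertex except the \<open>k\<close> ones already used, and these have mass at most
  \<open>k \<delta>\<close> together.\<close>

lemma list_mass_Suc_bounds:
  assumes V: "finite V" and f: "\<And>v. v \<in> V \<Longrightarrow> 0 \<le> f v" "\<And>v. v \<in> V \<Longrightarrow> f v \<le> \<delta>"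
  shows "list_mass V f (Suc k) \<le> (\<Sum>v\<in>V. f v) * list_mass V f k"
    and "((\<Sum>v\<in>V. f v) - real k * \<delta>) * list_mass V f k \<le> list_mass V f (Suc k)"
proof -
  have nn: "0 \<le> prod_list (map f vs)" if "vs \<in> distinct_lists V k" for vs
    using that f by (intro prod_list_nonneg_on) (auto simp: distinct_lists_def)
  have up: "(\<Sum>v\<in>V - set vs. f v) \<le> (\<Sum>v\<in>V. f v)" for vs
    using V f by (intro sum_mono2) auto
  have lo: "(\<Sum>v\<in>V. f v) - real k * \<delta> \<le> (\<Sum>v\<in>V - set vs. f v)" if "vs \<in> distinct_lists V k" for vs
  proof -
    have vs: "set vs \<subseteq> V" "card (set vs) = k"
      using that by (auto simp: distinct_lists_def distinct_card)
    have "(\<Sum>v\<in>set vs. f v) \<le> real (card (set vs)) * \<delta>"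
      by (rule sum_bounded_above) (use f vs in auto)
    then show ?thesis using vs V by (simp add: sum_diff)
  qed
  show "list_mass V f (Suc k) \<le> (\<Sum>v\<in>V. f v) * list_mass V f k"
    unfolding list_mass_Suc[OF V] unfolding list_mass_def sum_distrib_left
    by (intro sum_mono mult_right_mono up nn)
  show "((\<Sum>v\<in>V. f v) - real k * \<delta>) * list_mass V f k \<le> list_mass V f (Suc k)"
    unfolding list_mass_Suc[OF V] unfolding list_mass_def sum_distrib_left
    by (intro sum_mono mult_right_mono lo nn)
qed

lemma prod_cycle_edges:
  fixes F :: "'v set \<Rightarrow> real"
  assumes "distinct vs" "3 \<le> length vs"
  shows "(\<Prod>e\<in>cycle_edges vs. F e) = (\<Prod>i<length vs. F {vs ! i, vs ! (Suc i mod length vs)})"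
  unfolding cycle_edges_image by (subst prod.reindex[OF inj_on_cycle_edges[OF assms]]) simp

lemma prod_list_map_nth:
  fixes f :: "'v \<Rightarrow> real"
  shows "prod_list (map f vs) = (\<Prod>i<length vs. f (vs ! i))"
  by (simp add: prod.list_conv_set_nth atLeast0LessThan)

lemma prod_nth_Suc_mod:
  fixes f :: "'v \<Rightarrow> real"
  assumes "0 < k"
  shows "(\<Prod>i<k. f (vs ! (Suc i mod k))) = (\<Prod>i<k. f (vs ! i))"
  using prod.reindex_bij_betw[OF bij_betw_Suc_mod[OF assms], of "\<lambda>i. f (vs ! i)"] .

text \<open>Given weights \<open>w\<close> with sum \<open>L\<close>, put \<open>y v = w v / sqrt L\<close>. The probability
  \<open>w u w v / (w u w v + L)\<close> of the edge \<open>{u, v}\<close> then is \<open>r / (1 + r)\<close> for the odds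
  \<open>r = y u y v\<close>, so the parameters \<open>y\<close> carry all the information about the weights. The bound \<open>d\<close>
  on them is the small quantity in all error estimates.\<close>

locale rank_one_graph =
  fixes V :: "'v set" and y :: "'v \<Rightarrow> real" and d :: real
  assumes finite_V: "finite V"
    and y_nonneg: "v \<in> V \<Longrightarrow> 0 \<le> y v"
    and y_le: "v \<in> V \<Longrightarrow> y v \<le> d"
    and d_nonneg: "0 \<le> d" and d_le_1: "d \<le> 1"
begin

definition E :: "'v set set" where "E = complete_graph V"

definition r :: "'v set \<Rightarrow> real" where "r e = (\<Prod>v\<in>e. y v)"

definition p :: "'v set \<Rightarrow> real" where "p e = r e / (1 + r e)"

definition S :: real where "S = (\<Sum>v\<in>V. (y v)\<^sup>2)"

definition rate :: "nat \<Rightarrow> real" where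
  "rate k = (\<Sum>C\<in>cycles_of_length E k. \<Prod>e\<in>C. p e)"

definition law :: "nat \<Rightarrow> (nat \<Rightarrow> nat) \<Rightarrow> real" where
  "law K a = bern_expect p E (\<lambda>g. of_bool (\<forall>j\<in>{3..K}. card (cycles_of_length g j) = a j))"

lemma finite_E: "finite E"
  unfolding E_def by (rule finite_complete_graph[OF finite_V])

lemma finite_cycles_of_length: "finite (cycles_of_length E k)"
  unfolding cycles_of_length_def using finite_cycles[OF finite_E] by simp

lemma r_pair: "u \<noteq> v \<Longrightarrow> r {u, v} = y u * y v"
  by (simp add: r_def)

lemma y_le_1: "v \<in> V \<Longrightarrow> y v \<le> 1"
  using y_le d_le_1 by force

lemma r_bounds:
  assumes "e \<in> E"
  shows "0 \<le> r e" "r e \<le> d\<^sup>2" "r e \<le> d" "r e \<le> 1"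
proof -
  obtain u v where uv: "e = {u, v}" "u \<noteq> v" "u \<in> V" "v \<in> V"
    using assms by (auto simp: E_def complete_graph_def)
  show "0 \<le> r e" using uv y_nonneg by (simp add: r_pair)
  show *: "r e \<le> d\<^sup>2"
    using uv y_nonneg y_le d_nonneg by (simp add: r_pair power2_eq_square mult_mono)
  have "d\<^sup>2 \<le> d * 1" unfolding power2_eq_square using d_nonneg d_le_1 by (intro mult_left_mono)
  with * show "r e \<le> d" by simp
  with d_le_1 show "r e \<le> 1" by simp
qed

lemma p_bounds:
  assumes "e \<in> E"
  shows "0 \<le> p e" "p e \<le> 1" "p e \<le> r e" "r e / (1 + d\<^sup>2) \<le> p e"
proof -
  note b = r_bounds[OF assms]
  show "0 \<le> p e" "p e \<le> 1" using b by (simp_all add: p_def)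
  have "r e * 1 \<le> r e * (1 + r e)" using b by (intro mult_left_mono) auto
  then show "p e \<le> r e" using b by (simp add: p_def divide_le_eq)
  show "r e / (1 + d\<^sup>2) \<le> p e" unfolding p_def using b by (intro divide_left_mono) auto
qed

lemma p01: "e \<in> E \<Longrightarrow> 0 \<le> p e \<and> p e \<le> 1"
  using p_bounds by blast

lemma cycle_subset_E: "C \<in> cycles E \<Longrightarrow> C \<subseteq> E"
  by (auto simp: cycles_def)

lemma cycle_obtain:
  assumes "C \<in> cycles E"
  obtains vs where "C = cycle_edges vs" "distinct vs" "3 \<le> length vs" "set vs \<subseteq> V" "length vs = card C"
proof -
  obtain vs where vs: "C = cycle_edges vs" "distinct vs" "3 \<le> length vs" "cycle_edges vs \<subseteq> E"
    using assms by (auto simp: cycles_def)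
  have "set vs \<subseteq> V"
    using vs(4) cycle_edges_in_complete_graph[OF vs(2,3), of V] by (simp only: E_def)
  moreover have "length vs = card C" unfolding vs(1) card_cycle_edges[OF vs(2,3)] ..
  ultimately show thesis using that[OF vs(1-3)] by blast
qed

text \<open>Every vertex of a cycle lies on two of its edges.\<close>

lemma prod_r_cycle_edges:
  assumes vs: "distinct vs" "3 \<le> length vs"
  shows "(\<Prod>e\<in>cycle_edges vs. r e) = prod_list (map (\<lambda>v. (y v)\<^sup>2) vs)"
proof -
  let ?k = "length vs"
  have k: "0 < ?k" using vs by linarith
  have "(\<Prod>e\<in>cycle_edges vs. r e) = (\<Prod>i<?k. y (vs ! i) * y (vs ! (Suc i mod ?k)))"
    unfolding prod_cycle_edges[OF vs]
  proof (intro prod.cong refl r_pair)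
    fix i assume i: "i \<in> {..<?k}"
    have "Suc i mod ?k < ?k" using k by (rule mod_less_divisor)
    moreover have "Suc i mod ?k \<noteq> i" using i vs(2) by (auto simp: mod_Suc split: if_splits)
    ultimately show "vs ! i \<noteq> vs ! (Suc i mod ?k)"
      using i vs(1) by (auto simp: nth_eq_iff_index_eq)
  qed
  also have "\<dots> = (\<Prod>i<?k. y (vs ! i)) * (\<Prod>i<?k. y (vs ! i))"
    by (simp add: prod.distrib prod_nth_Suc_mod[OF k])
  finally show ?thesis
    by (simp add: prod_list_map_nth power2_eq_square prod.distrib)
qed

text \<open>Edge probability and edge odds differ by a factor between \<open>1 / (1 + d\<^sup>2)\<close> and 1, and each cycle
  is traced by \<open>2 k\<close> lists.\<close>

lemma rate_bounds:
  assumes k: "3 \<le> k"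
  shows "rate k \<le> list_mass V (\<lambda>v. (y v)\<^sup>2) k / (2 * real k)"
    and "list_mass V (\<lambda>v. (y v)\<^sup>2) k / (2 * real k) / (1 + d\<^sup>2) ^ k \<le> rate k"
proof -
  let ?R = "\<Sum>C\<in>cycles_of_length E k. \<Prod>e\<in>C. r e"
  have "list_mass V (\<lambda>v. (y v)\<^sup>2) k = (\<Sum>vs\<in>distinct_lists V k. \<Prod>e\<in>cycle_edges vs. r e)"
    unfolding list_mass_def
    by (intro sum.cong refl prod_r_cycle_edges[symmetric]) (use k in \<open>auto simp: distinct_lists_def\<close>)
  also have "\<dots> = 2 * real k * ?R"
    unfolding E_def by (rule sum_over_cycle_lists[OF finite_V k])
  finally have *: "list_mass V (\<lambda>v. (y v)\<^sup>2) k / (2 * real k) = ?R" using k by simp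
  show "rate k \<le> list_mass V (\<lambda>v. (y v)\<^sup>2) k / (2 * real k)"
    unfolding * rate_def
    by (intro sum_mono prod_mono) (auto simp: cycles_of_length_def dest!: cycle_subset_E intro: p_bounds)
  have "?R / (1 + d\<^sup>2) ^ k = (\<Sum>C\<in>cycles_of_length E k. \<Prod>e\<in>C. r e / (1 + d\<^sup>2))"
    unfolding sum_divide_distrib
    by (intro sum.cong refl) (simp add: prod_dividef cycles_of_length_def)
  also have "\<dots> \<le> rate k"
    unfolding rate_def
    by (intro sum_mono prod_mono conjI)
      (auto simp: cycles_of_length_def dest!: cycle_subset_E intro: p_bounds intro!: divide_nonneg_nonneg r_bounds)
  finally show "list_mass V (\<lambda>v. (y v)\<^sup>2) k / (2 * real k) / (1 + d\<^sup>2) ^ k \<le> rate k"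
    unfolding * .
qed

text \<open>Otherwise every step from a vertex of \<open>\<alpha>\<close> would use an edge of \<open>\<alpha>\<close>, so the walk would remain in
  \<open>\<alpha>\<close> and the whole cycle would be contained in \<open>\<alpha>\<close>, hence equal to it.\<close>

lemma cycle_leaves:
  assumes \<alpha>: "\<alpha> \<in> cycles E" and \<beta>: "cycle_edges vs \<in> cycles E" and vs: "distinct vs" "3 \<le> length vs"
    and ne: "cycle_edges vs \<noteq> \<alpha>" and meet: "cycle_edges vs \<inter> \<alpha> \<noteq> {}"
  shows "\<exists>i<length vs. vs ! i \<in> \<Union>\<alpha> \<and> {vs ! i, vs ! (Suc i mod length vs)} \<notin> \<alpha>"
proof (rule ccontr)
  let ?k = "length vs"
  let ?e = "\<lambda>i. {vs ! i, vs ! (Suc i mod ?k)}"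
  assume "\<not> ?thesis"
  then have stay: "?e i \<in> \<alpha>" if "i < ?k" "vs ! i \<in> \<Union>\<alpha>" for i using that by blast
  have k: "0 < ?k" using vs by linarith
  obtain s where s: "s < ?k" "?e s \<in> \<alpha>" using meet by (auto simp: cycle_edges_def)
  have all: "vs ! ((s + m) mod ?k) \<in> \<Union>\<alpha>" for m
  proof (induction m)
    case 0
    have "vs ! s \<in> ?e s" by simp
    then show ?case using s by (auto intro: UnionI[OF s(2)])
  next
    case (Suc m)
    have "(s + m) mod ?k < ?k" using k by (rule mod_less_divisor)
    from stay[OF this Suc] have "?e ((s + m) mod ?k) \<in> \<alpha>" .
    then have "vs ! (Suc ((s + m) mod ?k) mod ?k) \<in> \<Union>\<alpha>" by (rule UnionI) simp
    then show ?case by (simp only: mod_Suc_eq add_Suc_right)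
  qed
  have "?e i \<in> \<alpha>" if i: "i < ?k" for i
  proof (rule stay[OF i])
    have "(s + (?k - s + i)) mod ?k = i" using s i by simp
    then show "vs ! i \<in> \<Union>\<alpha>" using all[of "?k - s + i"] by (simp only:)
  qed
  then have "cycle_edges vs \<subseteq> \<alpha>" unfolding cycle_edges_image by blast
  with cycles_antichain[OF \<beta> \<alpha>] ne show False by blast
qed

text \<open>Split the odds of each edge outside \<open>\<alpha>\<close> into the contributions of its two ends. Some step leaves
  a vertex of \<open>\<alpha>\<close> along an edge outside \<open>\<alpha>\<close>, and this end contributes at most \<open>d\<close>. All other
  contributions of vertices of \<open>\<alpha>\<close> are at most 1, whereas a vertex outside \<open>\<alpha>\<close> has both its edges
  outside \<open>\<alpha>\<close> and contributes \<open>(y v)\<^sup>2\<close>.\<close>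

lemma prod_r_diff_le:
  assumes \<alpha>: "\<alpha> \<in> cycles E" and \<beta>: "cycle_edges vs \<in> cycles E" and vs: "distinct vs" "3 \<le> length vs"
    and V: "set vs \<subseteq> V"
    and ne: "cycle_edges vs \<noteq> \<alpha>" and meet: "cycle_edges vs \<inter> \<alpha> \<noteq> {}"
  shows "(\<Prod>e\<in>cycle_edges vs - \<alpha>. r e) \<le>
    d * prod_list (map (\<lambda>v. if v \<in> \<Union>\<alpha> then 1 else (y v)\<^sup>2) vs)"
proof -
  let ?k = "length vs"
  let ?e = "\<lambda>i. {vs ! i, vs ! (Suc i mod ?k)}"
  define u where "u v = (if v \<in> \<Union>\<alpha> then 1 else y v)" for v
  \<comment> \<open>\<open>A i\<close> and \<open>B i\<close> are the contributions of the first and the second end of the \<open>i\<close>-th edge.\<close>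
  define A where "A i = (if ?e i \<in> \<alpha> then 1 else y (vs ! i))" for i
  define B where "B i = (if ?e i \<in> \<alpha> then 1 else y (vs ! (Suc i mod ?k)))" for i
  have k: "0 < ?k" using vs by linarith
  have j: "Suc i mod ?k < ?k" for i using k by (rule mod_less_divisor)
  have inV: "vs ! i \<in> V" if "i < ?k" for i using V that nth_mem by blast
  have fin: "finite (cycle_edges vs)" unfolding cycle_edges_image by simp
  have "(\<Prod>e\<in>cycle_edges vs - \<alpha>. r e) = (\<Prod>e\<in>cycle_edges vs. if e \<in> \<alpha> then 1 else r e)"
    using fin by (intro prod.mono_neutral_cong_left) auto
  also have "\<dots> = (\<Prod>i<?k. A i * B i)"
    unfolding prod_cycle_edges[OF vs]
  proof (intro prod.cong refl)
    fix i assume i: "i \<in> {..<?k}"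
    have "Suc i mod ?k \<noteq> i" using i vs(2) by (auto simp: mod_Suc split: if_splits)
    then have "vs ! i \<noteq> vs ! (Suc i mod ?k)"
      using i j[of i] vs(1) by (auto simp: nth_eq_iff_index_eq)
    then show "(if ?e i \<in> \<alpha> then 1 else r (?e i)) = A i * B i"
      by (simp add: A_def B_def r_pair)
  qed
  finally have eq: "(\<Prod>e\<in>cycle_edges vs - \<alpha>. r e) = (\<Prod>i<?k. A i) * (\<Prod>i<?k. B i)"
    by (simp add: prod.distrib)
  have u: "0 \<le> u (vs ! i)" "u (vs ! i) \<le> 1" "y (vs ! i) \<le> u (vs ! i)" if "i < ?k" for i
    using y_nonneg[OF inV[OF that]] y_le_1[OF inV[OF that]] by (auto simp: u_def)
  have A: "0 \<le> A i" "A i \<le> u (vs ! i)" if i: "i < ?k" for i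
  proof -
    have "vs ! i \<in> \<Union>\<alpha>" if "?e i \<in> \<alpha>" using that by (rule UnionI) simp
    then show "0 \<le> A i" "A i \<le> u (vs ! i)"
      using y_nonneg[OF inV[OF i]] y_le_1[OF inV[OF i]] by (auto simp: A_def u_def)
  qed
  have B: "0 \<le> B i" "B i \<le> u (vs ! (Suc i mod ?k))" if i: "i < ?k" for i
  proof -
    have "vs ! (Suc i mod ?k) \<in> \<Union>\<alpha>" if "?e i \<in> \<alpha>" using that by (rule UnionI) simp
    then show "0 \<le> B i" "B i \<le> u (vs ! (Suc i mod ?k))"
      using y_nonneg[OF inV[OF j]] y_le_1[OF inV[OF j]] by (auto simp: B_def u_def)
  qed
  have PB: "(\<Prod>i<?k. B i) \<le> (\<Prod>i<?k. u (vs ! i))"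
  proof -
    have "(\<Prod>i<?k. B i) \<le> (\<Prod>i<?k. u (vs ! (Suc i mod ?k)))"
      using B by (intro prod_mono) auto
    then show ?thesis by (simp add: prod_nth_Suc_mod[OF k])
  qed
  have PA: "(\<Prod>i<?k. A i) \<le> d * (\<Prod>i<?k. u (vs ! i))"
  proof -
    obtain h where h: "h < ?k" "vs ! h \<in> \<Union>\<alpha>" "?e h \<notin> \<alpha>"
      using cycle_leaves[OF \<alpha> \<beta> vs ne meet] by blast
    have "(\<Prod>i<?k. A i) = A h * (\<Prod>i\<in>{..<?k} - {h}. A i)"
      using h by (simp add: prod.remove)
    also have "\<dots> \<le> d * (\<Prod>i\<in>{..<?k} - {h}. u (vs ! i))"
    proof (intro mult_mono prod_mono)
      show "A h \<le> d" using h y_le[OF inV[OF h(1)]] by (simp add: A_def)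
    qed (use A d_nonneg in \<open>auto intro!: prod_nonneg\<close>)
    also have "(\<Prod>i\<in>{..<?k} - {h}. u (vs ! i)) = (\<Prod>i<?k. u (vs ! i))"
    proof -
      have "u (vs ! h) = 1" using h(2) by (simp add: u_def)
      then show ?thesis using h prod.remove[of "{..<?k}" h "\<lambda>i. u (vs ! i)"] by simp
    qed
    finally show ?thesis .
  qed
  have "(\<Prod>e\<in>cycle_edges vs - \<alpha>. r e) \<le> (d * (\<Prod>i<?k. u (vs ! i))) * (\<Prod>i<?k. u (vs ! i))"
    unfolding eq by (intro mult_mono PA PB prod_nonneg mult_nonneg_nonneg d_nonneg) (use B u in auto)
  also have "\<dots> = d * (\<Prod>i<?k. (u (vs ! i))\<^sup>2)"
    by (simp add: power2_eq_square prod.distrib)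
  also have "(\<lambda>v. (u v)\<^sup>2) = (\<lambda>v. if v \<in> \<Union>\<alpha> then 1 else (y v)\<^sup>2)"
    by (auto simp: u_def fun_eq_iff)
  then have "(\<Prod>i<?k. (u (vs ! i))\<^sup>2) = prod_list (map (\<lambda>v. if v \<in> \<Union>\<alpha> then 1 else (y v)\<^sup>2) vs)"
    by (simp add: prod_list_map_nth fun_eq_iff)
  finally show ?thesis .
qed

text \<open>Summing over all lists instead of cycles only, the bound of \<open>prod_r_diff_le\<close> becomes a power of the
  total mass, in which each vertex of \<open>\<alpha>\<close> counts at most 1 in addition to \<open>S\<close>.\<close>

lemma overlap_bound:
  assumes \<alpha>: "\<alpha> \<in> cycles E" and l: "3 \<le> l"
  shows "(\<Sum>\<beta>\<in>{\<beta> \<in> cycles_of_length E l. \<beta> \<noteq> \<alpha> \<and> \<beta> \<inter> \<alpha> \<noteq> {}}. \<Prod>e\<in>\<beta> - \<alpha>. r e)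
    \<le> d * (S + real (card \<alpha>)) ^ l"
proof -
  let ?B = "{\<beta> \<in> cycles_of_length E l. \<beta> \<noteq> \<alpha> \<and> \<beta> \<inter> \<alpha> \<noteq> {}}"
  let ?z = "\<lambda>v. if v \<in> \<Union>\<alpha> then 1 else (y v)\<^sup>2"
  let ?L = "{vs. set vs \<subseteq> V \<and> length vs = l}"
  define f where "f = inv_into (distinct_lists V l) cycle_edges"
  have im: "cycles_of_length E l = cycle_edges ` distinct_lists V l"
    unfolding E_def by (rule cycles_of_length_complete_graph[OF l])
  have f: "f \<beta> \<in> distinct_lists V l" "cycle_edges (f \<beta>) = \<beta>" if "\<beta> \<in> ?B" for \<beta>
  proof -
    have "\<beta> \<in> cycle_edges ` distinct_lists V l" using that im by simp
    then show "f \<beta> \<in> distinct_lists V l" "cycle_edges (f \<beta>) = \<beta>"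
      unfolding f_def by (rule inv_into_into, rule f_inv_into_f)
  qed
  have inj: "inj_on f ?B" by (rule inj_on_inverseI[where g = cycle_edges]) (rule f(2))
  have "(\<Sum>\<beta>\<in>?B. \<Prod>e\<in>\<beta> - \<alpha>. r e) \<le> (\<Sum>\<beta>\<in>?B. d * prod_list (map ?z (f \<beta>)))"
  proof (rule sum_mono)
    fix \<beta> assume b: "\<beta> \<in> ?B"
    have "(\<Prod>e\<in>cycle_edges (f \<beta>) - \<alpha>. r e) \<le> d * prod_list (map ?z (f \<beta>))"
    proof (rule prod_r_diff_le[OF \<alpha>])
      show "distinct (f \<beta>)" "3 \<le> length (f \<beta>)" "set (f \<beta>) \<subseteq> V"
        using f(1)[OF b] l by (simp_all add: distinct_lists_def)
      show "cycle_edges (f \<beta>) \<in> cycles E" "cycle_edges (f \<beta>) \<noteq> \<alpha>" "cycle_edges (f \<beta>) \<inter> \<alpha> \<noteq> {}"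
        using b unfolding f(2)[OF b] by (simp_all add: cycles_of_length_def)
    qed
    then show "(\<Prod>e\<in>\<beta> - \<alpha>. r e) \<le> d * prod_list (map ?z (f \<beta>))" using f(2)[OF b] by (simp only:)
  qed
  also have "\<dots> = (\<Sum>vs\<in>f ` ?B. d * prod_list (map ?z vs))"
    by (simp add: sum.reindex[OF inj])
  also have "\<dots> \<le> (\<Sum>vs\<in>?L. d * prod_list (map ?z vs))"
  proof (rule sum_mono2)
    show "finite ?L" by (rule finite_lists_length_eq[OF finite_V])
    have "f ` ?B \<subseteq> distinct_lists V l" using f(1) by (rule image_subsetI)
    then show "f ` ?B \<subseteq> ?L" unfolding distinct_lists_def by blast
    show "0 \<le> d * prod_list (map ?z vs)" for vs
      by (intro mult_nonneg_nonneg d_nonneg prod_list_nonneg_on) simp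
  qed
  also have "\<dots> = d * (\<Sum>v\<in>V. ?z v) ^ l"
    by (simp add: sum_prod_list_all[OF finite_V] flip: sum_distrib_left)
  also have "\<dots> \<le> d * (S + real (card \<alpha>)) ^ l"
  proof (intro mult_left_mono power_mono d_nonneg)
    obtain ws where ws: "\<alpha> = cycle_edges ws" "distinct ws" "length ws = card \<alpha>"
      using cycle_obtain[OF \<alpha>] by metis
    have U: "finite (\<Union>\<alpha>)" "card (\<Union>\<alpha>) = card \<alpha>"
      using ws Union_cycle_edges[of ws] by (simp_all add: distinct_card)
    have "(\<Sum>v\<in>V. ?z v) \<le> (\<Sum>v\<in>V. (y v)\<^sup>2 + of_bool (v \<in> \<Union>\<alpha>))"
      by (intro sum_mono) auto
    also have "\<dots> = S + real (card (V \<inter> \<Union>\<alpha>))"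
      using finite_V by (simp add: S_def sum.distrib sum.If_cases of_bool_def del: Union_iff)
    also have "\<dots> \<le> S + real (card (\<Union>\<alpha>))" using card_mono[OF U(1), of "V \<inter> \<Union>\<alpha>"] by simp
    finally show "(\<Sum>v\<in>V. ?z v) \<le> S + real (card \<alpha>)" using U by simp
    show "0 \<le> (\<Sum>v\<in>V. ?z v)" by (intro sum_nonneg) auto
  qed
  finally show ?thesis .
qed

end

section \<open>The Stein recursion for the cycle counts\<close>

context rank_one_graph
begin

lemma cycles_of_length_restrict:
  "g \<subseteq> E \<Longrightarrow> cycles_of_length g k = {C \<in> cycles_of_length E k. C \<subseteq> g}"
  unfolding cycles_of_length_def using cycles_restrict[of g E] by blast

definition overlapping :: "nat \<Rightarrow> 'v set set \<Rightarrow> 'v set set set" where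
  "overlapping K \<alpha> = {\<beta> \<in> cycles E. card \<beta> \<in> {3..K} \<and> \<beta> \<noteq> \<alpha> \<and> \<beta> \<inter> \<alpha> \<noteq> {}}"

lemma finite_overlapping: "finite (overlapping K \<alpha>)"
  unfolding overlapping_def using finite_cycles[OF finite_E] by simp

lemma cycle_nonempty: "\<alpha> \<in> cycles E \<Longrightarrow> \<alpha> \<noteq> {}"
  using card_cycles_ge[of E] by force

text \<open>Unless some other cycle overlapping \<open>\<alpha>\<close> is present, removing the edges of \<open>\<alpha>\<close> destroys only \<open>\<alpha>\<close>
  itself.\<close>

lemma card_cycles_remove:
  assumes \<alpha>: "\<alpha> \<in> cycles E" and g: "g \<subseteq> E" and j: "j \<in> {3..K}"
    and none: "\<And>\<beta>. \<beta> \<in> overlapping K \<alpha> \<Longrightarrow> \<not> \<beta> \<subseteq> g"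
  shows "card (cycles_of_length g j) =
    card (cycles_of_length (g - \<alpha>) j) + of_bool (\<alpha> \<subseteq> g \<and> j = card \<alpha>)"
proof -
  have g': "g - \<alpha> \<subseteq> E" using g by auto
  have "cycles_of_length g j =
      cycles_of_length (g - \<alpha>) j \<union> (if \<alpha> \<subseteq> g \<and> j = card \<alpha> then {\<alpha>} else {})" (is "_ = ?R")
  proof (intro equalityI subsetI)
    fix C assume "C \<in> cycles_of_length g j"
    then have C: "C \<in> cycles E" "card C = j" "C \<subseteq> g"
      unfolding cycles_of_length_restrict[OF g] by (simp_all add: cycles_of_length_def)
    show "C \<in> ?R"
    proof (cases "C = \<alpha>")
      case True then show ?thesis using C by simp
    next
      case False
      then have "C \<inter> \<alpha> = {}" using none[of C] C j by (auto simp: overlapping_def)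
      then have "C \<subseteq> g - \<alpha>" using C by blast
      then show ?thesis unfolding cycles_of_length_restrict[OF g'] using C
        by (simp add: cycles_of_length_def)
    qed
  next
    fix C assume "C \<in> ?R"
    then have "C \<in> cycles_of_length (g - \<alpha>) j \<or> C = \<alpha> \<and> \<alpha> \<subseteq> g \<and> j = card \<alpha>"
      by (simp split: if_splits)
    then show "C \<in> cycles_of_length g j"
      unfolding cycles_of_length_restrict[OF g'] cycles_of_length_restrict[OF g] using \<alpha>
      by (auto simp: cycles_of_length_def)
  qed
  moreover have "\<alpha> \<notin> cycles_of_length (g - \<alpha>) j"
    unfolding cycles_of_length_restrict[OF g'] using cycle_nonempty[OF \<alpha>] by blast
  moreover have "finite (cycles_of_length (g - \<alpha>) j)"
    unfolding cycles_of_length_restrict[OF g'] using finite_cycles_of_length by simp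
  moreover have "card (X \<union> (if b then {x} else {})) = card X + of_bool b" if "x \<notin> X" "finite X"
    for X :: "'v set set set" and x b using that by simp
  ultimately show ?thesis by (simp only:)
qed

text \<open>Expand \<open>a k * law K a\<close> as a sum over \<open>k\<close>-cycles \<open>\<alpha>\<close> of the probability that \<open>\<alpha>\<close> is present and the
  counts are \<open>a\<close>. Replacing the counts of \<open>g\<close> by those of \<open>g - \<alpha>\<close>, which drops one from \<open>a k\<close>, makes
  the two events independent; replacing them back afterwards gives \<open>rate k * law K (a(k := a k - 1))\<close>.
  Either replacement matters only if a cycle overlapping \<open>\<alpha>\<close>, or in the second case \<open>\<alpha>\<close> itself, is
  present, and this costs a factor \<open>d\<close>.\<close>

lemma stein_bound:
  assumes k: "k \<in> {3..K}" and ak: "0 < a k"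
  shows "\<bar>real (a k) * law K a - rate k * law K (a(k := a k - 1))\<bar>
    \<le> rate k * (d + 2 * (\<Sum>l\<in>{3..K}. d * (S + real k) ^ l))"
proof -
  define a' where "a' = a(k := a k - 1)"
  define Z where "Z b g = (of_bool (\<forall>j\<in>{3..K}. card (cycles_of_length g j) = b j) :: real)" for b and g :: "'v set set"
  define Cs where "Cs = cycles_of_length E k"
  define Rr where "Rr \<alpha> g = (\<Sum>\<beta>\<in>overlapping K \<alpha>. of_bool (\<beta> \<subseteq> g) :: real)" for \<alpha> g
  define P where "P \<alpha> = (\<Prod>e\<in>\<alpha>. p e)" for \<alpha>
  define D where "D = (\<Sum>l\<in>{3..K}. d * (S + real k) ^ l)"
  have law: "law K b = bern_expect p E (Z b)" for b unfolding law_def Z_def ..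
  have Z01: "0 \<le> Z b g" "Z b g \<le> 1" for b g by (auto simp: Z_def)
  have \<alpha>_cyc: "\<alpha> \<in> cycles E" "card \<alpha> = k" "\<alpha> \<subseteq> E" if "\<alpha> \<in> Cs" for \<alpha>
    using that cycle_subset_E by (auto simp: Cs_def cycles_of_length_def)
  have finCs: "finite Cs" unfolding Cs_def by (rule finite_cycles_of_length)
  have P0: "0 \<le> P C" if "C \<subseteq> E" for C
    unfolding P_def using that p_bounds(1) by (intro prod_nonneg) auto
  have rate: "rate k = (\<Sum>\<alpha>\<in>Cs. P \<alpha>)" unfolding rate_def Cs_def P_def ..
  have Rr_nonneg: "0 \<le> Rr \<alpha> g" for \<alpha> g unfolding Rr_def by (intro sum_nonneg) auto
  have Rr_ge: "1 \<le> Rr \<alpha> g" if "\<beta> \<in> overlapping K \<alpha>" "\<beta> \<subseteq> g" for \<alpha> \<beta> g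
  proof -
    have "of_bool (\<beta> \<subseteq> g) \<le> Rr \<alpha> g"
      unfolding Rr_def by (rule member_le_sum[OF that(1) _ finite_overlapping]) simp
    then show ?thesis using that by simp
  qed
  have overl: "(\<Sum>\<beta>\<in>overlapping K \<alpha>. P (\<beta> - \<alpha>)) \<le> D" if \<alpha>: "\<alpha> \<in> Cs" for \<alpha>
  proof -
    let ?B = "\<lambda>l. {\<beta> \<in> cycles_of_length E l. \<beta> \<noteq> \<alpha> \<and> \<beta> \<inter> \<alpha> \<noteq> {}}"
    have "overlapping K \<alpha> = (\<Union>l\<in>{3..K}. ?B l)"
      unfolding overlapping_def cycles_of_length_def by blast
    then have "(\<Sum>\<beta>\<in>overlapping K \<alpha>. P (\<beta> - \<alpha>)) = (\<Sum>l\<in>{3..K}. \<Sum>\<beta>\<in>?B l. P (\<beta> - \<alpha>))"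
    proof (simp only:, intro sum.UNION_disjoint ballI impI)
      show "finite (?B l)" for l using finite_cycles_of_length by simp
      show "?B l \<inter> ?B l' = {}" if "l \<noteq> l'" for l l'
        using that unfolding cycles_of_length_def by blast
    qed simp
    also have "\<dots> \<le> (\<Sum>l\<in>{3..K}. \<Sum>\<beta>\<in>?B l. \<Prod>e\<in>\<beta> - \<alpha>. r e)"
      unfolding P_def
      by (intro sum_mono prod_mono)
        (auto simp: cycles_of_length_def dest!: cycle_subset_E intro: p_bounds)
    also have "\<dots> \<le> D"
      unfolding D_def using overlap_bound[OF \<alpha>_cyc(1)[OF \<alpha>]] \<alpha>_cyc(2)[OF \<alpha>]
      by (intro sum_mono) auto
    finally show ?thesis .
  qed
  have P_le: "P C \<le> P (C - \<alpha>)" if "C \<subseteq> E" for C \<alpha>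
  proof -
    have fC: "finite C" using that finite_E finite_subset by blast
    have "P C = P (C \<inter> \<alpha>) * P (C - \<alpha>)"
    proof -
      have "C = (C \<inter> \<alpha>) \<union> (C - \<alpha>)" by blast
      then show ?thesis unfolding P_def using fC
        by (metis finite_Int finite_Diff prod.union_disjoint Int_Diff_disjoint)
    qed
    also have "\<dots> \<le> 1 * P (C - \<alpha>)"
    proof (intro mult_right_mono)
      show "P (C \<inter> \<alpha>) \<le> 1" unfolding P_def using that p_bounds by (intro prod_le_1) auto
      show "0 \<le> P (C - \<alpha>)" using that by (intro P0) auto
    qed
    finally show ?thesis by simp
  qed
  have P_le_d: "P \<alpha> \<le> d" if \<alpha>: "\<alpha> \<in> Cs" for \<alpha>
  proof -
    obtain e where e: "e \<in> \<alpha>" using cycle_nonempty[OF \<alpha>_cyc(1)[OF \<alpha>]] by blast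
    have "P \<alpha> \<le> P (\<alpha> - (\<alpha> - {e}))" using \<alpha>_cyc(3)[OF \<alpha>] by (rule P_le)
    also have "\<alpha> - (\<alpha> - {e}) = {e}" using e by blast
    also have "P {e} = p e" by (simp add: P_def)
    also have "p e \<le> d" using e \<alpha>_cyc(3)[OF \<alpha>] p_bounds(3)[of e] r_bounds(3)[of e] by force
    finally show ?thesis .
  qed
  have E_sub: "bern_expect p E (\<lambda>g. of_bool (C \<subseteq> g)) = P C" if "C \<subseteq> E" for C
    unfolding P_def by (rule bern_expect_subset[OF finite_E that])
  have main: "\<bar>bern_expect p E (\<lambda>g. of_bool (\<alpha> \<subseteq> g) * Z a g) - P \<alpha> * law K a'\<bar> \<le> P \<alpha> * (d + 2 * D)"
    if \<alpha>: "\<alpha> \<in> Cs" for \<alpha>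
  proof -
    note \<alpha>' = \<alpha>_cyc[OF \<alpha>]
    have ov: "\<beta> \<subseteq> E" if "\<beta> \<in> overlapping K \<alpha>" for \<beta>
      using that cycle_subset_E by (auto simp: overlapping_def)
    have same: "Z a g = Z a' (g - \<alpha>)" if h: "g \<subseteq> E" "\<alpha> \<subseteq> g" "\<And>\<beta>. \<beta> \<in> overlapping K \<alpha> \<Longrightarrow> \<not> \<beta> \<subseteq> g" for g
    proof -
      have "card (cycles_of_length g j) = a j \<longleftrightarrow> card (cycles_of_length (g - \<alpha>) j) = a' j"
        if j: "j \<in> {3..K}" for j
        using card_cycles_remove[OF \<alpha>'(1) h(1) j h(3)] h(2) \<alpha>'(2) ak
        by (auto simp: a'_def)
      then show ?thesis unfolding Z_def by (intro arg_cong[where f = of_bool] ball_cong refl)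
    qed
    have same': "Z a' (g - \<alpha>) = Z a' g" if h: "g \<subseteq> E" "\<not> \<alpha> \<subseteq> g" "\<And>\<beta>. \<beta> \<in> overlapping K \<alpha> \<Longrightarrow> \<not> \<beta> \<subseteq> g" for g
    proof -
      have "card (cycles_of_length g j) = card (cycles_of_length (g - \<alpha>) j)"
        if j: "j \<in> {3..K}" for j
        using card_cycles_remove[OF \<alpha>'(1) h(1) j h(3)] h(2) by simp
      then show ?thesis unfolding Z_def by simp
    qed
    have "\<bar>bern_expect p E (\<lambda>g. of_bool (\<alpha> \<subseteq> g) * Z a g)
        - bern_expect p E (\<lambda>g. of_bool (\<alpha> \<subseteq> g) * Z a' (g - \<alpha>))\<bar>
        \<le> bern_expect p E (\<lambda>g. of_bool (\<alpha> \<subseteq> g) * Rr \<alpha> g)"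
    proof (rule bern_expect_abs_diff_le[OF p01])
      fix g assume g: "g \<subseteq> E"
      show "\<bar>of_bool (\<alpha> \<subseteq> g) * Z a g - of_bool (\<alpha> \<subseteq> g) * Z a' (g - \<alpha>)\<bar> \<le> of_bool (\<alpha> \<subseteq> g) * Rr \<alpha> g"
      proof (cases "\<alpha> \<subseteq> g \<and> (\<exists>\<beta>\<in>overlapping K \<alpha>. \<beta> \<subseteq> g)")
        case True
        then have "1 \<le> Rr \<alpha> g" using Rr_ge by blast
        then show ?thesis using True Z01[of a g] Z01[of a' "g - \<alpha>"] by (auto simp: abs_le_iff)
      next
        case False
        then show ?thesis using same[OF g] Rr_nonneg[of \<alpha> g] by auto
      qed
    qed
    also have "bern_expect p E (\<lambda>g. of_bool (\<alpha> \<subseteq> g) * Rr \<alpha> g)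
        = (\<Sum>\<beta>\<in>overlapping K \<alpha>. bern_expect p E (\<lambda>g. of_bool (\<alpha> \<union> \<beta> \<subseteq> g)))"
      unfolding Rr_def sum_distrib_left bern_expect_sum by (simp flip: of_bool_conj)
    also have "\<dots> = (\<Sum>\<beta>\<in>overlapping K \<alpha>. P \<alpha> * P (\<beta> - \<alpha>))"
    proof (rule sum.cong[OF refl])
      fix \<beta> assume b: "\<beta> \<in> overlapping K \<alpha>"
      have "bern_expect p E (\<lambda>g. of_bool (\<alpha> \<union> \<beta> \<subseteq> g)) = P (\<alpha> \<union> (\<beta> - \<alpha>))"
        using E_sub[of "\<alpha> \<union> \<beta>"] ov[OF b] \<alpha>'(3) by simp
      also have "\<dots> = P \<alpha> * P (\<beta> - \<alpha>)"
        unfolding P_def using ov[OF b] \<alpha>'(3) finite_E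
        by (intro prod.union_disjoint) (auto intro: finite_subset)
      finally show "bern_expect p E (\<lambda>g. of_bool (\<alpha> \<union> \<beta> \<subseteq> g)) = P \<alpha> * P (\<beta> - \<alpha>)" .
    qed
    also have "\<dots> = P \<alpha> * (\<Sum>\<beta>\<in>overlapping K \<alpha>. P (\<beta> - \<alpha>))" by (simp add: sum_distrib_left)
    also have "\<dots> \<le> P \<alpha> * D" by (intro mult_left_mono overl \<alpha> P0 \<alpha>'(3))
    also have "bern_expect p E (\<lambda>g. of_bool (\<alpha> \<subseteq> g) * Z a' (g - \<alpha>))
        = P \<alpha> * bern_expect p E (\<lambda>g. Z a' (g - \<alpha>))"
      unfolding P_def by (rule bern_expect_indep[OF finite_E \<alpha>'(3)])
    finally have 1: "\<bar>bern_expect p E (\<lambda>g. of_bool (\<alpha> \<subseteq> g) * Z a g)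
        - P \<alpha> * bern_expect p E (\<lambda>g. Z a' (g - \<alpha>))\<bar> \<le> P \<alpha> * D" .
    have "\<bar>bern_expect p E (\<lambda>g. Z a' (g - \<alpha>)) - bern_expect p E (Z a')\<bar>
        \<le> bern_expect p E (\<lambda>g. of_bool (\<alpha> \<subseteq> g) + Rr \<alpha> g)"
    proof (rule bern_expect_abs_diff_le[OF p01])
      fix g assume g: "g \<subseteq> E"
      show "\<bar>Z a' (g - \<alpha>) - Z a' g\<bar> \<le> of_bool (\<alpha> \<subseteq> g) + Rr \<alpha> g"
      proof (cases "\<alpha> \<subseteq> g \<or> (\<exists>\<beta>\<in>overlapping K \<alpha>. \<beta> \<subseteq> g)")
        case True
        then have "1 \<le> of_bool (\<alpha> \<subseteq> g) + Rr \<alpha> g" using Rr_ge[of _ \<alpha> g] Rr_nonneg[of \<alpha> g] by auto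
        moreover have "\<bar>Z a' (g - \<alpha>) - Z a' g\<bar> \<le> 1"
          using Z01[of a' g] Z01[of a' "g - \<alpha>"] by (simp add: abs_le_iff)
        ultimately show ?thesis by linarith
      next
        case False
        then show ?thesis using same'[OF g] Rr_nonneg[of \<alpha> g] by auto
      qed
    qed
    also have "\<dots> = P \<alpha> + (\<Sum>\<beta>\<in>overlapping K \<alpha>. P \<beta>)"
      unfolding bern_expect_add Rr_def bern_expect_sum using ov \<alpha>'(3) by (simp add: E_sub)
    also have "\<dots> \<le> d + D"
    proof (rule add_mono[OF P_le_d[OF \<alpha>]])
      have "(\<Sum>\<beta>\<in>overlapping K \<alpha>. P \<beta>) \<le> (\<Sum>\<beta>\<in>overlapping K \<alpha>. P (\<beta> - \<alpha>))"
        by (intro sum_mono P_le ov)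
      also have "\<dots> \<le> D" by (rule overl[OF \<alpha>])
      finally show "(\<Sum>\<beta>\<in>overlapping K \<alpha>. P \<beta>) \<le> D" .
    qed
    finally have "P \<alpha> * \<bar>bern_expect p E (\<lambda>g. Z a' (g - \<alpha>)) - law K a'\<bar> \<le> P \<alpha> * (d + D)"
      unfolding law by (intro mult_left_mono P0 \<alpha>'(3))
    then have "\<bar>P \<alpha> * bern_expect p E (\<lambda>g. Z a' (g - \<alpha>)) - P \<alpha> * law K a'\<bar> \<le> P \<alpha> * (d + D)"
      using P0[OF \<alpha>'(3)] by (simp add: abs_mult flip: right_diff_distrib)
    with 1 have "\<bar>bern_expect p E (\<lambda>g. of_bool (\<alpha> \<subseteq> g) * Z a g) - P \<alpha> * law K a'\<bar>
        \<le> P \<alpha> * D + P \<alpha> * (d + D)" by linarith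
    then show ?thesis by (simp add: algebra_simps)
  qed
  have "real (a k) * law K a = (\<Sum>\<alpha>\<in>Cs. bern_expect p E (\<lambda>g. of_bool (\<alpha> \<subseteq> g) * Z a g))"
    unfolding law bern_expect_sum[symmetric] bern_expect_cmult[symmetric]
  proof (rule bern_expect_cong)
    fix g assume g: "g \<subseteq> E"
    have "real (card (cycles_of_length g k)) = (\<Sum>\<alpha>\<in>Cs. of_bool (\<alpha> \<subseteq> g))"
      unfolding cycles_of_length_restrict[OF g] Cs_def using finite_cycles_of_length[of k]
      by (simp add: of_bool_def sum.If_cases Int_def)
    moreover have "real (a k) * Z a g = real (card (cycles_of_length g k)) * Z a g"
    proof (cases "\<forall>j\<in>{3..K}. card (cycles_of_length g j) = a j")
      case True
      then have "card (cycles_of_length g k) = a k" using k by (rule bspec)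
      then show ?thesis by simp
    qed (simp add: Z_def)
    ultimately show "real (a k) * Z a g = (\<Sum>\<alpha>\<in>Cs. of_bool (\<alpha> \<subseteq> g) * Z a g)"
      by (simp add: sum_distrib_right)
  qed
  then have "\<bar>real (a k) * law K a - rate k * law K a'\<bar> =
      \<bar>\<Sum>\<alpha>\<in>Cs. (bern_expect p E (\<lambda>g. of_bool (\<alpha> \<subseteq> g) * Z a g) - P \<alpha> * law K a')\<bar>"
    unfolding rate by (simp add: sum_subtractf sum_distrib_right)
  also have "\<dots> \<le> (\<Sum>\<alpha>\<in>Cs. P \<alpha> * (d + 2 * D))"
    by (rule order_trans[OF sum_abs]) (intro sum_mono main)
  also have "\<dots> = rate k * (d + 2 * D)" unfolding rate by (simp add: sum_distrib_right)
  finally show ?thesis unfolding a'_def D_def .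
qed

lemma law_01: "0 \<le> law K a" "law K a \<le> 1"
proof -
  have "bern_expect p E (\<lambda>_. 0) \<le> law K a" "law K a \<le> bern_expect p E (\<lambda>_. 1)"
    unfolding law_def by (intro bern_expect_mono p01; simp)+
  then show "0 \<le> law K a" "law K a \<le> 1" by (simp_all add: bern_expect_const finite_E)
qed

lemma sum_law_box:
  "(\<Sum>a\<in>PiE {3..K} (\<lambda>_. {..T}). law K a) =
    bern_expect p E (\<lambda>g. of_bool (\<forall>j\<in>{3..K}. card (cycles_of_length g j) \<le> T))"
  unfolding law_def bern_expect_sum[symmetric]
proof (rule bern_expect_cong)
  fix g
  let ?c = "\<lambda>j\<in>{3..K}. card (cycles_of_length g j)"
  have "(\<forall>j\<in>{3..K}. card (cycles_of_length g j) = a j) \<longleftrightarrow> a = ?c"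
    if "a \<in> PiE {3..K} (\<lambda>_. {..T})" for a
    using that by (auto simp: PiE_def extensional_def fun_eq_iff)
  then have "(\<Sum>a\<in>PiE {3..K} (\<lambda>_. {..T}). of_bool (\<forall>j\<in>{3..K}. card (cycles_of_length g j) = a j)) =
      (\<Sum>a\<in>PiE {3..K} (\<lambda>_. {..T}). of_bool (a = ?c) :: real)"
    by (intro sum.cong) auto
  also have "\<dots> = of_bool (?c \<in> PiE {3..K} (\<lambda>_. {..T}))"
    by (simp add: of_bool_def sum.delta finite_PiE)
  also have "?c \<in> PiE {3..K} (\<lambda>_. {..T}) \<longleftrightarrow> (\<forall>j\<in>{3..K}. card (cycles_of_length g j) \<le> T)"
    by (auto simp: PiE_iff)
  finally show "(\<Sum>a\<in>PiE {3..K} (\<lambda>_. {..T}). of_bool (\<forall>j\<in>{3..K}. card (cycles_of_length g j) = a j)) =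
      (of_bool (\<forall>j\<in>{3..K}. card (cycles_of_length g j) \<le> T) :: real)" .
qed

lemma expect_count: "bern_expect p E (\<lambda>g. real (card (cycles_of_length g k))) = rate k"
proof -
  have "bern_expect p E (\<lambda>g. real (card (cycles_of_length g k))) =
      bern_expect p E (\<lambda>g. \<Sum>C\<in>cycles_of_length E k. of_bool (C \<subseteq> g))"
  proof (rule bern_expect_cong)
    fix g assume g: "g \<subseteq> E"
    show "real (card (cycles_of_length g k)) = (\<Sum>C\<in>cycles_of_length E k. of_bool (C \<subseteq> g))"
      unfolding cycles_of_length_restrict[OF g] using finite_cycles_of_length[of k]
      by (simp add: of_bool_def sum.If_cases Int_def)
  qed
  also have "\<dots> = rate k"
    unfolding bern_expect_sum rate_def
    by (intro sum.cong refl bern_expect_subset finite_E)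
      (auto simp: cycles_of_length_def dest: cycle_subset_E)
  finally show ?thesis .
qed

lemma sum_law_box_le: "(\<Sum>a\<in>PiE {3..K} (\<lambda>_. {..T}). law K a) \<le> 1"
proof -
  have "(\<Sum>a\<in>PiE {3..K} (\<lambda>_. {..T}). law K a) \<le> bern_expect p E (\<lambda>_. 1)"
    unfolding sum_law_box by (intro bern_expect_mono p01) auto
  then show ?thesis by (simp add: bern_expect_const finite_E)
qed

text \<open>Markov's inequality: if some count exceeds \<open>T\<close>, then so does the sum of the counts.\<close>

lemma sum_law_box_ge:
  "1 - (\<Sum>j\<in>{3..K}. rate j) / real (Suc T) \<le> (\<Sum>a\<in>PiE {3..K} (\<lambda>_. {..T}). law K a)"
proof -
  let ?N = "\<lambda>g j. real (card (cycles_of_length g j))"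
  have "bern_expect p E (\<lambda>g. 1 - (1 / real (Suc T)) * (\<Sum>j\<in>{3..K}. ?N g j)) \<le>
      (\<Sum>a\<in>PiE {3..K} (\<lambda>_. {..T}). law K a)"
    unfolding sum_law_box
  proof (intro bern_expect_mono p01)
    fix g
    have nn: "0 \<le> (\<Sum>j\<in>{3..K}. ?N g j)" by (intro sum_nonneg) auto
    show "1 - (1 / real (Suc T)) * (\<Sum>j\<in>{3..K}. ?N g j) \<le>
        of_bool (\<forall>j\<in>{3..K}. card (cycles_of_length g j) \<le> T)"
    proof (cases "\<forall>j\<in>{3..K}. card (cycles_of_length g j) \<le> T")
      case True then show ?thesis using nn by simp
    next
      case False
      then obtain j where j: "j \<in> {3..K}" "Suc T \<le> card (cycles_of_length g j)" by force
      have "real (Suc T) \<le> ?N g j" using j by linarith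
      also have "\<dots> \<le> (\<Sum>j\<in>{3..K}. ?N g j)" using j by (intro member_le_sum) auto
      finally have "1 \<le> (1 / real (Suc T)) * (\<Sum>j\<in>{3..K}. ?N g j)" by (simp add: field_simps)
      then show ?thesis by simp
    qed
  qed
  moreover have "bern_expect p E (\<lambda>g. 1 - (1 / real (Suc T)) * (\<Sum>j\<in>{3..K}. ?N g j)) =
      1 - (1 / real (Suc T)) * (\<Sum>j\<in>{3..K}. rate j)"
    by (simp only: bern_expect_diff bern_expect_cmult bern_expect_sum expect_count
        bern_expect_const[OF finite_E])
  ultimately show ?thesis by simp
qed

end

lemma list_mass_tendsto:
  fixes V :: "nat \<Rightarrow> 'v set" and f :: "nat \<Rightarrow> 'v \<Rightarrow> real"
  assumes V: "\<And>m. finite (V m)" and f: "\<And>m v. v \<in> V m \<Longrightarrow> 0 \<le> f m v" "\<And>m v. v \<in> V m \<Longrightarrow> f m v \<le> \<delta> m"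
    and \<delta>: "\<delta> \<longlonglongrightarrow> 0" and S: "(\<lambda>m. \<Sum>v\<in>V m. f m v) \<longlonglongrightarrow> \<beta>"
  shows "(\<lambda>m. list_mass (V m) (f m) k) \<longlonglongrightarrow> \<beta> ^ k"
proof (induction k)
  case 0 then show ?case by (simp add: list_mass_0)
next
  case (Suc k)
  have "(\<lambda>m. ((\<Sum>v\<in>V m. f m v) - real k * \<delta> m) * list_mass (V m) (f m) k) \<longlonglongrightarrow> (\<beta> - real k * 0) * \<beta> ^ k"
    by (intro tendsto_intros S \<delta> Suc)
  then have lo: "(\<lambda>m. ((\<Sum>v\<in>V m. f m v) - real k * \<delta> m) * list_mass (V m) (f m) k) \<longlonglongrightarrow> \<beta> ^ Suc k"
    by simp
  have "(\<lambda>m. (\<Sum>v\<in>V m. f m v) * list_mass (V m) (f m) k) \<longlonglongrightarrow> \<beta> * \<beta> ^ k"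
    by (intro tendsto_intros S Suc)
  then have up: "(\<lambda>m. (\<Sum>v\<in>V m. f m v) * list_mass (V m) (f m) k) \<longlonglongrightarrow> \<beta> ^ Suc k"
    by simp
  show ?case
  proof (rule tendsto_sandwich[OF always_eventually always_eventually lo up]; intro allI)
    fix m
    show "((\<Sum>v\<in>V m. f m v) - real k * \<delta> m) * list_mass (V m) (f m) k \<le> list_mass (V m) (f m) (Suc k)"
      by (rule list_mass_Suc_bounds(2)[OF V f])
    show "list_mass (V m) (f m) (Suc k) \<le> (\<Sum>v\<in>V m. f m v) * list_mass (V m) (f m) k"
      by (rule list_mass_Suc_bounds(1)[OF V f])
  qed
qed

text \<open>The error in \<open>stein_bound\<close> contains the factor \<open>d\<close>, so the recursion becomes exact in the limit.\<close>

theorem rank_one_law_tendsto: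
  fixes V :: "nat \<Rightarrow> 'v set" and y :: "nat \<Rightarrow> 'v \<Rightarrow> real"
  assumes G: "\<And>m. rank_one_graph (V m) (y m) (d m)"
    and d: "d \<longlonglongrightarrow> 0" and S: "(\<lambda>m. \<Sum>v\<in>V m. (y m v)\<^sup>2) \<longlonglongrightarrow> \<beta>"
  shows "(\<lambda>m. rank_one_graph.law (V m) (y m) K a) \<longlonglongrightarrow>
    (\<Prod>j\<in>{3..K}. (\<beta> ^ j / (2 * real j)) ^ a j / fact (a j) * exp (- (\<beta> ^ j / (2 * real j))))"
proof -
  let ?rate = "\<lambda>m. rank_one_graph.rate (V m) (y m)"
  let ?law = "\<lambda>m. rank_one_graph.law (V m) (y m) K"
  let ?S = "\<lambda>m. \<Sum>v\<in>V m. (y m v)\<^sup>2"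
  have rate: "(\<lambda>m. ?rate m j) \<longlonglongrightarrow> \<beta> ^ j / (2 * real j)" if j: "j \<in> {3..K}" for j
  proof -
    have L: "(\<lambda>m. list_mass (V m) (\<lambda>v. (y m v)\<^sup>2) j) \<longlonglongrightarrow> \<beta> ^ j"
    proof (rule list_mass_tendsto[where \<delta> = "\<lambda>m. (d m)\<^sup>2"])
      fix m v assume v: "v \<in> V m"
      show "(y m v)\<^sup>2 \<le> (d m)\<^sup>2"
        using rank_one_graph.y_nonneg[OF G v] rank_one_graph.y_le[OF G v] by (rule power_mono[rotated])
    next
      show "(\<lambda>m. (d m)\<^sup>2) \<longlonglongrightarrow> 0" using tendsto_power[OF d, of 2] by simp
    qed (use S rank_one_graph.finite_V[OF G] in auto)
    have up: "(\<lambda>m. list_mass (V m) (\<lambda>v. (y m v)\<^sup>2) j / (2 * real j)) \<longlonglongrightarrow> \<beta> ^ j / (2 * real j)"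
      using j by (intro tendsto_intros L) auto
    have "(\<lambda>m. list_mass (V m) (\<lambda>v. (y m v)\<^sup>2) j / (2 * real j) / (1 + (d m)\<^sup>2) ^ j)
        \<longlonglongrightarrow> \<beta> ^ j / (2 * real j) / (1 + 0\<^sup>2) ^ j"
      using j by (intro tendsto_intros L d) auto
    then have lo: "(\<lambda>m. list_mass (V m) (\<lambda>v. (y m v)\<^sup>2) j / (2 * real j) / (1 + (d m)\<^sup>2) ^ j)
        \<longlonglongrightarrow> \<beta> ^ j / (2 * real j)" by simp
    have j3: "3 \<le> j" using j by simp
    show ?thesis
      by (rule tendsto_sandwich[OF always_eventually always_eventually lo up])
        (intro allI rank_one_graph.rate_bounds[OF G j3])+
  qed
  show ?thesis
  proof (rule Poisson_limit_of_recursion[where l = ?rate])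
    fix m and a b :: "nat \<Rightarrow> nat" assume "\<And>j. j \<in> {3..K} \<Longrightarrow> a j = b j"
    then show "?law m a = ?law m b" unfolding rank_one_graph.law_def[OF G] by simp
  next
    fix a :: "nat \<Rightarrow> nat" and k assume k: "k \<in> {3..K}" "0 < a k"
    let ?b = "\<lambda>m. ?rate m k * (d m + 2 * (\<Sum>l\<in>{3..K}. d m * (?S m + real k) ^ l))"
    have "?b \<longlonglongrightarrow> \<beta> ^ k / (2 * real k) * (0 + 2 * (\<Sum>l\<in>{3..K}. 0 * (\<beta> + real k) ^ l))"
      by (intro tendsto_intros rate k d S)
    then have "?b \<longlonglongrightarrow> 0" by simp
    then show "(\<lambda>m. real (a k) * ?law m a - ?rate m k * ?law m (a(k := a k - 1))) \<longlonglongrightarrow> 0"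
      by (rule Lim_null_comparison[rotated])
        (use rank_one_graph.stein_bound[OF G, of k K a] k rank_one_graph.S_def[OF G] in auto)
  next
    fix m T
    show "(\<Sum>a\<in>PiE {3..K} (\<lambda>_. {..T}). ?law m a) \<le> 1"
      by (rule rank_one_graph.sum_law_box_le[OF G])
    show "1 - (\<Sum>j\<in>{3..K}. ?rate m j) / real (Suc T) \<le> (\<Sum>a\<in>PiE {3..K} (\<lambda>_. {..T}). ?law m a)"
      by (rule rank_one_graph.sum_law_box_ge[OF G])
  next
    fix m a
    show "0 \<le> ?law m a" "?law m a \<le> 1" by (rule rank_one_graph.law_01[OF G])+
  qed (simp_all only: rate finite_atLeastAtMost)
qed

section \<open>Triangular arrays of i.i.d. variables with one finite moment\<close>

lemma integral_excess_tendsto_0: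
  fixes f :: "'a \<Rightarrow> real"
  assumes f: "integrable \<nu> f" "\<And>x. 0 \<le> f x" and T: "filterlim T at_top sequentially" "\<And>n. 0 \<le> T n"
  shows "(\<lambda>n. \<integral>x. f x - min (f x) (T n) \<partial>\<nu>) \<longlonglongrightarrow> 0"
proof -
  have [measurable]: "f \<in> borel_measurable \<nu>" using f by simp
  have "(\<lambda>n. \<integral>x. f x - min (f x) (T n) \<partial>\<nu>) \<longlonglongrightarrow> (\<integral>x. 0 \<partial>\<nu>)"
  proof (rule integral_dominated_convergence[where w = f])
    show "AE x in \<nu>. (\<lambda>n. f x - min (f x) (T n)) \<longlonglongrightarrow> 0"
    proof (rule AE_I2)
      fix x
      have "\<forall>\<^sub>F n in sequentially. f x \<le> T n" using T(1) by (simp add: filterlim_at_top)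
      then have "\<forall>\<^sub>F n in sequentially. f x - min (f x) (T n) = 0" by eventually_elim simp
      then show "(\<lambda>n. f x - min (f x) (T n)) \<longlonglongrightarrow> 0" by (rule tendsto_eventually)
    qed
    show "AE x in \<nu>. norm (f x - min (f x) (T n)) \<le> f x" for n
      using f(2) T(2)[of n] by (intro AE_I2) (auto simp: min_def)
  qed (use f in auto)
  then show ?thesis by simp
qed

text \<open>The rows live on unrelated probability spaces; they share only the law \<open>\<nu>\<close> of their entries.\<close>

locale iid_array =
  fixes M :: "nat \<Rightarrow> 'b measure" and X :: "nat \<Rightarrow> nat \<Rightarrow> 'b \<Rightarrow> real" and \<nu> :: "real measure"
  assumes prob: "prob_space (M n)"
    and indep: "prob_space.indep_vars (M n) (\<lambda>_. borel) (X n) {1..n}"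
    and distr: "i \<in> {1..n} \<Longrightarrow> distr (M n) borel (X n i) = \<nu>"
begin

lemma measurable_X [measurable]: "i \<in> {1..n} \<Longrightarrow> X n i \<in> borel_measurable (M n)"
  using indep[of n] by (simp add: prob_space.indep_vars_def2[OF prob])

lemma integral_X:
  assumes "i \<in> {1..n}" "f \<in> borel_measurable borel"
  shows "(\<integral>\<omega>. f (X n i \<omega>) \<partial>M n) = (\<integral>x. f x \<partial>\<nu> :: real)"
  unfolding distr[OF assms(1), symmetric] using assms by (subst integral_distr) auto

lemma integrable_X:
  assumes "i \<in> {1..n}" "integrable \<nu> f" "f \<in> borel_measurable borel"
  shows "integrable (M n) (\<lambda>\<omega>. f (X n i \<omega>) :: real)"
  using assms(2) unfolding distr[OF assms(1), symmetric] using assms by (subst (asm) integrable_distr_eq) auto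

lemma prob_space_\<nu>: "prob_space \<nu>"
  using distr[of 1 1] measurable_X[of 1 1] prob_space.prob_space_distr[OF prob[of 1], of "X 1 1" borel] by simp

lemma sets_\<nu>: "sets \<nu> = sets borel"
  using distr[of 1 1] by (metis atLeastAtMost_iff order_refl sets_distr)

text \<open>Cut \<open>f\<close> off at a level \<open>T\<close>. The bounded part obeys Hoeffding's inequality, and the excess over \<open>T\<close>
  has a small mean and is controlled by Markov's inequality. A first moment of \<open>f\<close> is enough for
  this, so the law covers the squared weights.\<close>

theorem weak_law_of_large_numbers:
  assumes f: "integrable \<nu> f" "\<And>x. 0 \<le> f x" and [measurable]: "f \<in> borel_measurable borel"
    and \<tau>: "0 < \<tau>"
  shows "(\<lambda>n. measure (M n) {\<omega> \<in> space (M n). \<tau> \<le> \<bar>(\<Sum>i=1..n. f (X n i \<omega>)) / real n - (\<integral>x. f x \<partial>\<nu>)\<bar>})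
    \<longlonglongrightarrow> 0"
proof (rule LIMSEQ_I)
  fix \<epsilon> :: real assume \<epsilon>: "0 < \<epsilon>"
  have "(\<lambda>T. \<integral>x. f x - min (f x) (real T) \<partial>\<nu>) \<longlonglongrightarrow> 0"
    by (rule integral_excess_tendsto_0[OF f filterlim_real_sequentially]) simp
  moreover have "0 < min (\<tau> / 3) (\<epsilon> * \<tau> / 6)" using \<epsilon> \<tau> by simp
  ultimately have "\<forall>\<^sub>F T in sequentially. (\<integral>x. f x - min (f x) (real T) \<partial>\<nu>) < min (\<tau> / 3) (\<epsilon> * \<tau> / 6)"
    by (rule order_tendstoD(2))
  then obtain T where T: "0 < T" "(\<integral>x. f x - min (f x) (real T) \<partial>\<nu>) < min (\<tau> / 3) (\<epsilon> * \<tau> / 6)"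
    using eventually_happens'[OF sequentially_bot eventually_conj[OF eventually_gt_at_top[of 0]]] by blast
  define c where "c x = min (f x) (real T)" for x
  define h where "h x = f x - c x" for x
  have [measurable]: "c \<in> borel_measurable borel" "h \<in> borel_measurable borel"
    unfolding c_def h_def by measurable
  have c: "0 \<le> c x" "c x \<le> real T" and h: "0 \<le> h x" for x
    using f(2) by (auto simp: c_def h_def min_def)
  have meas\<nu>: "g \<in> borel_measurable \<nu>" if "g \<in> borel_measurable borel" for g :: "real \<Rightarrow> real"
    using that sets_\<nu> by (simp cong: measurable_cong_sets)
  have ic: "integrable \<nu> c"
    by (rule Bochner_Integration.integrable_bound[OF f(1)])
      (use f(2) in \<open>auto simp: c_def intro!: meas\<nu>\<close>)
  have ih: "integrable \<nu> h" unfolding h_def using f(1) ic by simp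
  have \<mu>: "(\<integral>x. f x \<partial>\<nu>) = (\<integral>x. c x \<partial>\<nu>) + (\<integral>x. h x \<partial>\<nu>)"
    unfolding h_def using f(1) ic by simp
  have eh: "(\<integral>x. h x \<partial>\<nu>) < \<tau> / 3" "(\<integral>x. h x \<partial>\<nu>) < \<epsilon> * \<tau> / 6" "0 \<le> (\<integral>x. h x \<partial>\<nu>)"
    using T(2) h by (auto simp: h_def c_def intro!: integral_nonneg_AE)
  define B1 where "B1 n = {\<omega> \<in> space (M n). real n * \<tau> / 3 \<le> \<bar>(\<Sum>i=1..n. c (X n i \<omega>)) - real n * (\<integral>x. c x \<partial>\<nu>)\<bar>}" for n
  define B2 where "B2 n = {\<omega> \<in> space (M n). real n * \<tau> / 3 \<le> (\<Sum>i=1..n. h (X n i \<omega>))}" for n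
  have meas: "B1 n \<in> sets (M n)" "B2 n \<in> sets (M n)" for n unfolding B1_def B2_def by measurable
  have P1: "measure (M n) (B1 n) \<le> 2 * exp (- 2 * (\<tau> / 3)\<^sup>2 / (real T)\<^sup>2 * real n)" if n: "1 \<le> n" for n
  proof -
    interpret prob_space "M n" by (rule prob)
    interpret H: Hoeffding_ineq "M n" "{1..n}" "\<lambda>i \<omega>. c (X n i \<omega>)" "\<lambda>_. 0" "\<lambda>_. real T" "real n * (\<integral>x. c x \<partial>\<nu>)"
    proof unfold_locales
      show "indep_vars (\<lambda>_. borel) (\<lambda>i \<omega>. c (X n i \<omega>)) {1..n}"
        by (rule indep_vars_compose2[OF indep]) simp
      have "(\<Sum>i\<in>{1..n}. expectation (\<lambda>\<omega>. c (X n i \<omega>))) = (\<Sum>i\<in>{1..n}. (\<integral>x. c x \<partial>\<nu>))"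
        by (intro sum.cong refl integral_X) auto
      then show "real n * (\<integral>x. c x \<partial>\<nu>) \<equiv> (\<Sum>i\<in>{1..n}. expectation (\<lambda>\<omega>. c (X n i \<omega>)))"
        by (simp add: atomize_eq)
    qed (use c in auto)
    have "measure (M n) (B1 n) \<le> 2 * exp (- 2 * (real n * \<tau> / 3)\<^sup>2 / (\<Sum>i\<in>{1..n}. (real T - 0)\<^sup>2))"
      unfolding B1_def using n T \<tau> by (intro H.Hoeffding_ineq_abs_ge) auto
    also have "- 2 * (real n * \<tau> / 3)\<^sup>2 / (\<Sum>i\<in>{1..n}. (real T - 0)\<^sup>2) = - 2 * (\<tau> / 3)\<^sup>2 / (real T)\<^sup>2 * real n"
      using n T by (simp add: power2_eq_square field_simps)
    finally show ?thesis .
  qed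
  have P2: "measure (M n) (B2 n) \<le> \<epsilon> / 2" if n: "1 \<le> n" for n
  proof -
    have "measure (M n) (B2 n) \<le> (\<integral>\<omega>. (\<Sum>i=1..n. h (X n i \<omega>)) \<partial>M n) / (real n * \<tau> / 3)"
      unfolding B2_def
    proof (rule integral_Markov_inequality_measure[where A = "{}"])
      show "integrable (M n) (\<lambda>\<omega>. \<Sum>i=1..n. h (X n i \<omega>))"
        by (intro Bochner_Integration.integrable_sum integrable_X ih) auto
    qed (use n \<tau> h in \<open>auto intro!: sum_nonneg\<close>)
    also have "(\<integral>\<omega>. (\<Sum>i=1..n. h (X n i \<omega>)) \<partial>M n) = (\<Sum>i=1..n. (\<integral>x. h x \<partial>\<nu>))"
    proof (subst Bochner_Integration.integral_sum)
      show "integrable (M n) (\<lambda>\<omega>. h (X n i \<omega>))" if "i \<in> {1..n}" for i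
        using that by (intro integrable_X ih) auto
      show "(\<Sum>i=1..n. (\<integral>\<omega>. h (X n i \<omega>) \<partial>M n)) = (\<Sum>i=1..n. (\<integral>x. h x \<partial>\<nu>))"
        by (intro sum.cong refl integral_X) auto
    qed
    also have "\<dots> / (real n * \<tau> / 3) = 3 * (\<integral>x. h x \<partial>\<nu>) / \<tau>"
      using n \<tau> by (simp add: field_simps)
    also have "\<dots> \<le> \<epsilon> / 2" using eh \<tau> by (simp add: field_simps)
    finally show ?thesis .
  qed
  have sub: "{\<omega> \<in> space (M n). \<tau> \<le> \<bar>(\<Sum>i=1..n. f (X n i \<omega>)) / real n - (\<integral>x. f x \<partial>\<nu>)\<bar>} \<subseteq> B1 n \<union> B2 n"
    if n: "1 \<le> n" for n
  proof
    fix \<omega> assume \<omega>: "\<omega> \<in> {\<omega> \<in> space (M n). \<tau> \<le> \<bar>(\<Sum>i=1..n. f (X n i \<omega>)) / real n - (\<integral>x. f x \<partial>\<nu>)\<bar>}"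
    show "\<omega> \<in> B1 n \<union> B2 n"
    proof (rule ccontr)
      assume "\<omega> \<notin> B1 n \<union> B2 n"
      then have 1: "\<bar>(\<Sum>i=1..n. c (X n i \<omega>)) - real n * (\<integral>x. c x \<partial>\<nu>)\<bar> < real n * \<tau> / 3"
        and 2: "(\<Sum>i=1..n. h (X n i \<omega>)) < real n * \<tau> / 3"
        using \<omega> by (auto simp: B1_def B2_def not_le)
      have 3: "0 \<le> (\<Sum>i=1..n. h (X n i \<omega>))" by (intro sum_nonneg h)
      have 4: "(\<Sum>i=1..n. f (X n i \<omega>)) = (\<Sum>i=1..n. c (X n i \<omega>)) + (\<Sum>i=1..n. h (X n i \<omega>))"
        by (simp add: h_def sum_subtractf)
      have 5: "real n * (\<integral>x. h x \<partial>\<nu>) \<le> real n * \<tau> / 3" "0 \<le> real n * (\<integral>x. h x \<partial>\<nu>)"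
        using eh n mult_left_mono[of "\<integral>x. h x \<partial>\<nu>" "\<tau> / 3" "real n"] by auto
      have tri: "\<bar>(x + y) - (u + v)\<bar> < t" if "\<bar>x - u\<bar> < t / 3" "y < t / 3" "0 \<le> y" "v \<le> t / 3" "0 \<le> v"
        for x y u v t :: real using that by linarith
      have "\<bar>(\<Sum>i=1..n. f (X n i \<omega>)) - real n * (\<integral>x. f x \<partial>\<nu>)\<bar> < real n * \<tau>"
        unfolding 4 \<mu> distrib_left by (rule tri[OF 1 2 3 5])
      moreover have "(\<Sum>i=1..n. f (X n i \<omega>)) / real n - (\<integral>x. f x \<partial>\<nu>) =
          ((\<Sum>i=1..n. f (X n i \<omega>)) - real n * (\<integral>x. f x \<partial>\<nu>)) / real n"
        using n by (simp add: diff_divide_distrib)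
      ultimately have "\<bar>(\<Sum>i=1..n. f (X n i \<omega>)) / real n - (\<integral>x. f x \<partial>\<nu>)\<bar> < \<tau>"
        using n by (simp add: divide_less_eq mult.commute)
      then show False using \<omega> by simp
    qed
  qed
  have "(\<lambda>n. exp (- 2 * (\<tau> / 3)\<^sup>2 / (real T)\<^sup>2 * real n)) \<longlonglongrightarrow> 0"
  proof -
    have "- 2 * (\<tau> / 3)\<^sup>2 / (real T)\<^sup>2 < 0" using \<tau> T by (simp add: divide_neg_pos)
    then have "filterlim (\<lambda>n. - 2 * (\<tau> / 3)\<^sup>2 / (real T)\<^sup>2 * real n) at_bot sequentially"
      by (rule filterlim_tendsto_neg_mult_at_bot[OF tendsto_const _ filterlim_real_sequentially])
    then show ?thesis by (rule filterlim_compose[OF exp_at_bot])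
  qed
  then have "(\<lambda>n. 2 * exp (- 2 * (\<tau> / 3)\<^sup>2 / (real T)\<^sup>2 * real n)) \<longlonglongrightarrow> 2 * 0"
    by (intro tendsto_intros)
  then have "\<forall>\<^sub>F n in sequentially. 2 * exp (- 2 * (\<tau> / 3)\<^sup>2 / (real T)\<^sup>2 * real n) < \<epsilon> / 2"
    by (rule order_tendstoD) (use \<epsilon> in auto)
  with eventually_ge_at_top[of 1]
  have "\<forall>\<^sub>F n in sequentially. norm (measure (M n)
      {\<omega> \<in> space (M n). \<tau> \<le> \<bar>(\<Sum>i=1..n. f (X n i \<omega>)) / real n - (\<integral>x. f x \<partial>\<nu>)\<bar>} - 0) < \<epsilon>"
  proof eventually_elim
    case (elim n)
    interpret prob_space "M n" by (rule prob)
    have "measure (M n) {\<omega> \<in> space (M n). \<tau> \<le> \<bar>(\<Sum>i=1..n. f (X n i \<omega>)) / real n - (\<integral>x. f x \<partial>\<nu>)\<bar>}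
        \<le> measure (M n) (B1 n \<union> B2 n)"
      using elim meas by (intro finite_measure_mono sub) auto
    also have "\<dots> \<le> measure (M n) (B1 n) + measure (M n) (B2 n)"
      using meas by (intro measure_Un_le) auto
    also have "\<dots> < \<epsilon>" using P1[of n] P2[of n] elim by simp
    finally show ?case by simp
  qed
  then show "\<exists>no. \<forall>n\<ge>no. norm (measure (M n)
      {\<omega> \<in> space (M n). \<tau> \<le> \<bar>(\<Sum>i=1..n. f (X n i \<omega>)) / real n - (\<integral>x. f x \<partial>\<nu>)\<bar>} - 0) < \<epsilon>"
    by (simp add: eventually_sequentially)
qed

text \<open>A value above \<open>\<tau> n\<close> exceeds the level \<open>\<tau> n / 2\<close> by more than \<open>\<tau> n / 2\<close>. By Markov's inequality this
  has probability at most \<open>2 / (\<tau> n)\<close> times the mean excess over that level, which tends to 0; the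
  factor \<open>1 / n\<close> pays for the union bound over the row.\<close>

theorem max_tendsto_0:
  assumes f: "integrable \<nu> f" "\<And>x. 0 \<le> f x" and [measurable]: "f \<in> borel_measurable borel"
    and \<tau>: "0 < \<tau>"
  shows "(\<lambda>n. measure (M n) {\<omega> \<in> space (M n). \<exists>i\<in>{1..n}. \<tau> * real n < f (X n i \<omega>)}) \<longlonglongrightarrow> 0"
proof (rule tendsto_sandwich[OF always_eventually always_eventually tendsto_const]; (intro allI)?)
  let ?ex = "\<lambda>n. \<integral>x. f x - min (f x) (\<tau> / 2 * real n) \<partial>\<nu>"
  show "0 \<le> measure (M n) {\<omega> \<in> space (M n). \<exists>i\<in>{1..n}. \<tau> * real n < f (X n i \<omega>)}" for n by simp
  have "filterlim (\<lambda>n. \<tau> / 2 * real n) at_top sequentially"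
    using \<tau> by (intro filterlim_tendsto_pos_mult_at_top[OF tendsto_const _ filterlim_real_sequentially]) simp
  then have "?ex \<longlonglongrightarrow> 0" using f \<tau> by (intro integral_excess_tendsto_0) auto
  then have "(\<lambda>n. 2 / \<tau> * ?ex n) \<longlonglongrightarrow> 2 / \<tau> * 0" by (intro tendsto_intros)
  then show "(\<lambda>n. 2 / \<tau> * ?ex n) \<longlonglongrightarrow> 0" by simp
  fix n
  interpret prob_space "M n" by (rule prob)
  let ?h = "\<lambda>x. f x - min (f x) (\<tau> / 2 * real n)"
  have [measurable]: "?h \<in> borel_measurable borel" by measurable
  have meas\<nu>: "g \<in> borel_measurable \<nu>" if "g \<in> borel_measurable borel" for g :: "real \<Rightarrow> real"
    using that sets_\<nu> by (simp cong: measurable_cong_sets)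
  have ih: "integrable \<nu> ?h"
    by (rule Bochner_Integration.integrable_bound[OF f(1)])
      (use f(2) \<tau> in \<open>auto simp: min_def intro!: meas\<nu>\<close>)
  show "measure (M n) {\<omega> \<in> space (M n). \<exists>i\<in>{1..n}. \<tau> * real n < f (X n i \<omega>)} \<le> 2 / \<tau> * ?ex n"
  proof (cases "n = 0")
    case True
    then show ?thesis using f \<tau> by (auto intro!: mult_nonneg_nonneg integral_nonneg_AE)
  next
    case False
    have one: "measure (M n) {\<omega> \<in> space (M n). \<tau> / 2 * real n \<le> ?h (X n i \<omega>)} \<le> ?ex n / (\<tau> / 2 * real n)"
      if i: "i \<in> {1..n}" for i
    proof -
      have "measure (M n) {\<omega> \<in> space (M n). \<tau> / 2 * real n \<le> ?h (X n i \<omega>)} \<le>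
          (\<integral>\<omega>. ?h (X n i \<omega>) \<partial>M n) / (\<tau> / 2 * real n)"
        using False \<tau> i by (intro integral_Markov_inequality_measure[where A = "{}"] integrable_X ih) auto
      also have "(\<integral>\<omega>. ?h (X n i \<omega>) \<partial>M n) = ?ex n" using i by (intro integral_X) auto
      finally show ?thesis .
    qed
    have "measure (M n) {\<omega> \<in> space (M n). \<exists>i\<in>{1..n}. \<tau> * real n < f (X n i \<omega>)} \<le>
        measure (M n) (\<Union>i\<in>{1..n}. {\<omega> \<in> space (M n). \<tau> / 2 * real n \<le> ?h (X n i \<omega>)})"
    proof (rule finite_measure_mono)
      have "\<tau> / 2 * real n \<le> ?h x" if "\<tau> * real n < f x" for x
        using that \<tau> by (simp add: min_def field_simps)
      then show "{\<omega> \<in> space (M n). \<exists>i\<in>{1..n}. \<tau> * real n < f (X n i \<omega>)} \<subseteq>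
          (\<Union>i\<in>{1..n}. {\<omega> \<in> space (M n). \<tau> / 2 * real n \<le> ?h (X n i \<omega>)})" by blast
    qed measurable
    also have "\<dots> \<le> (\<Sum>i\<in>{1..n}. measure (M n) {\<omega> \<in> space (M n). \<tau> / 2 * real n \<le> ?h (X n i \<omega>)})"
      by (intro finite_measure_subadditive_finite) auto
    also have "\<dots> \<le> (\<Sum>i\<in>{1..n}. ?ex n / (\<tau> / 2 * real n))" by (intro sum_mono one)
    also have "\<dots> = 2 / \<tau> * ?ex n" using False \<tau> by (simp add: field_simps)
    finally show ?thesis .
  qed
qed

end

section \<open>Averaging the edge probabilities over the weights\<close>

definition weighted_edge_prob :: "nat \<Rightarrow> (nat \<Rightarrow> real) \<Rightarrow> nat set \<Rightarrow> real" where
  "weighted_edge_prob n w e = (\<Prod>v\<in>e. w v) / ((\<Prod>v\<in>e. w v) + (\<Sum>l=1..n. w l))"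

lemma weighted_edge_prob_pair: "i \<noteq> j \<Longrightarrow> weighted_edge_prob n w {i, j} = edge_prob n w i j"
  by (simp add: weighted_edge_prob_def edge_prob_def)

lemma weighted_edge_prob_01:
  assumes "\<And>i. i \<in> {1..n} \<Longrightarrow> 0 < w i" "e \<in> vertex_pairs n"
  shows "0 \<le> weighted_edge_prob n w e" "weighted_edge_prob n w e \<le> 1"
proof -
  have "0 \<le> (\<Prod>v\<in>e. w v)"
    using assms by (intro prod_nonneg) (force simp: vertex_pairs_def less_imp_le)
  moreover have "0 \<le> (\<Sum>l=1..n. w l)" using assms(1) by (intro sum_nonneg) (simp add: less_imp_le)
  ultimately show "0 \<le> weighted_edge_prob n w e" "weighted_edge_prob n w e \<le> 1"
    unfolding weighted_edge_prob_def by (auto simp: divide_le_eq_1)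
qed

lemma finite_vertex_pairs: "finite (vertex_pairs n)"
  by (rule finite_subset[of _ "Pow {1..n}"]) (auto simp: vertex_pairs_def)

lemma vertex_pairs_complete_graph: "vertex_pairs n = complete_graph {1..n}"
  unfolding vertex_pairs_def complete_graph_def by blast

locale random_graph =
  fixes M :: "'b measure" and n :: nat and \<nu> :: "real measure" and X :: "nat \<Rightarrow> 'b \<Rightarrow> real"
    and G :: "'b \<Rightarrow> nat set set"
  assumes grg: "generalised_random_graph M n \<nu> X G"
    and pos: "AE x in \<nu>. 0 < x"
begin

sublocale prob_space M
  using grg by (simp add: generalised_random_graph_def)

abbreviation "P \<omega> e \<equiv> weighted_edge_prob n (\<lambda>i. X i \<omega>) e"

abbreviation "present e \<equiv> {\<omega> \<in> space M. e \<in> G \<omega>}"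

lemma measurable_X [measurable]: "i \<in> {1..n} \<Longrightarrow> X i \<in> borel_measurable M"
  using grg by (simp add: generalised_random_graph_def indep_vars_def2)

lemma AE_pos: "AE \<omega> in M. \<forall>i\<in>{1..n}. 0 < X i \<omega>"
proof (rule AE_finite_allI)
  fix i assume i: "i \<in> {1..n}"
  have "AE x in distr M borel (X i). 0 < x"
  proof -
    have "distr M borel (X i) = \<nu>" using grg i unfolding generalised_random_graph_def by blast
    then show ?thesis using pos by (simp only:)
  qed
  then show "AE \<omega> in M. 0 < X i \<omega>" using i by (subst (asm) AE_distr_iff) auto
qed simp

lemma measurable_P [measurable]:
  assumes "e \<in> vertex_pairs n"
  shows "(\<lambda>\<omega>. P \<omega> e) \<in> borel_measurable M"
proof -
  have "X v \<in> borel_measurable M" if "v \<in> e" for v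
    using that assms by (intro measurable_X) (auto simp: vertex_pairs_def)
  then show ?thesis unfolding weighted_edge_prob_def
    by (intro borel_measurable_divide borel_measurable_add borel_measurable_prod borel_measurable_sum) auto
qed

lemma sets_present [measurable]: "e \<in> vertex_pairs n \<Longrightarrow> present e \<in> sets M"
  using grg by (simp add: generalised_random_graph_def cond_indep_events_def)

lemma G_subset: "\<omega> \<in> space M \<Longrightarrow> G \<omega> \<subseteq> vertex_pairs n"
  using grg by (simp add: generalised_random_graph_def)

lemma subalgebra_weights: "finite_measure_subalgebra M (weight_algebra M n X)"
proof -
  have "(\<lambda>\<omega>. \<lambda>i\<in>{1..n}. X i \<omega>) \<in> measurable M (\<Pi>\<^sub>M i\<in>{1..n}. (borel :: real measure))"
    by (rule measurable_restrict) simp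
  then have "subalgebra M (weight_algebra M n X)"
    unfolding subalgebra_def weight_algebra_def
    using sets_image_in_sets[OF refl] by (intro conjI space_vimage_algebra) blast
  then show ?thesis
    using finite_measure_axioms by (simp add: finite_measure_subalgebra_def finite_measure_subalgebra_axioms_def)
qed

lemma cond_prob_present:
  assumes "e \<in> vertex_pairs n"
  shows "AE \<omega> in M. cond_prob_given M (weight_algebra M n X) (present e) \<omega> = P \<omega> e"
proof -
  obtain i j where ij: "e = {i, j}" "i \<in> {1..n}" "j \<in> {1..n}" "i \<noteq> j"
    using assms by (auto simp: vertex_pairs_def)
  show ?thesis using grg ij(2-4) unfolding ij(1) weighted_edge_prob_pair[OF ij(4)]
    by (simp add: generalised_random_graph_def)
qed

text \<open>Integrate the product formula for the conditional probabilities.\<close>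

lemma expect_all_present:
  assumes A: "A \<subseteq> vertex_pairs n"
  shows "expectation (\<lambda>\<omega>. \<Prod>e\<in>A. of_bool (e \<in> G \<omega>)) = expectation (\<lambda>\<omega>. \<Prod>e\<in>A. P \<omega> e)"
proof (cases "A = {}")
  case False
  interpret S: finite_measure_subalgebra M "weight_algebra M n X" by (rule subalgebra_weights)
  have fin: "finite A" using A finite_vertex_pairs by (rule finite_subset)
  have meas: "(\<Inter>e\<in>A. present e) \<in> sets M"
    using False fin A by (intro sets.finite_INT) auto
  have "AE \<omega> in M. \<forall>e\<in>A. cond_prob_given M (weight_algebra M n X) (present e) \<omega> = P \<omega> e"
    using A by (intro AE_finite_allI[OF fin] cond_prob_present) auto
  moreover have "AE \<omega> in M. cond_prob_given M (weight_algebra M n X) (\<Inter>e\<in>A. present e) \<omega> =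
      (\<Prod>e\<in>A. cond_prob_given M (weight_algebra M n X) (present e) \<omega>)"
    using grg A fin False by (simp add: generalised_random_graph_def cond_indep_events_def)
  ultimately have eq: "AE \<omega> in M. real_cond_exp M (weight_algebra M n X) (indicator (\<Inter>e\<in>A. present e)) \<omega>
      = (\<Prod>e\<in>A. P \<omega> e)"
    by eventually_elim (simp add: cond_prob_given_def)
  have "expectation (\<lambda>\<omega>. \<Prod>e\<in>A. of_bool (e \<in> G \<omega>)) = expectation (indicator (\<Inter>e\<in>A. present e) :: 'b \<Rightarrow> real)"
  proof (rule Bochner_Integration.integral_cong[OF refl])
    fix \<omega> assume \<omega>: "\<omega> \<in> space M"
    show "(\<Prod>e\<in>A. of_bool (e \<in> G \<omega>)) = (indicator (\<Inter>e\<in>A. present e) \<omega> :: real)"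
    proof (cases "\<forall>e\<in>A. e \<in> G \<omega>")
      case True then show ?thesis using \<omega> by simp
    next
      case F: False
      then have "(\<Prod>e\<in>A. of_bool (e \<in> G \<omega>) :: real) = 0" using fin by (intro prod_zero) auto
      then show ?thesis using F by (auto simp: indicator_def)
    qed
  qed
  also have "\<dots> = expectation (real_cond_exp M (weight_algebra M n X) (indicator (\<Inter>e\<in>A. present e)))"
    by (rule S.real_cond_exp_int(2)[symmetric])
      (use meas in \<open>simp add: integrable_indicator_iff less_top[symmetric]\<close>)
  also have "\<dots> = expectation (\<lambda>\<omega>. \<Prod>e\<in>A. P \<omega> e)"
    using A eq by (intro integral_cong_AE) (auto intro!: borel_measurable_prod measurable_P)
  finally show ?thesis .
qed simp

lemma AE_P_01: "AE \<omega> in M. \<forall>e\<in>vertex_pairs n. 0 \<le> P \<omega> e \<and> P \<omega> e \<le> 1"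
  using AE_pos by eventually_elim (auto intro!: weighted_edge_prob_01)

lemma integrable_P_prod:
  assumes "A \<subseteq> vertex_pairs n" "B \<subseteq> vertex_pairs n"
  shows "integrable M (\<lambda>\<omega>. (\<Prod>e\<in>A. P \<omega> e) * (\<Prod>e\<in>B. 1 - P \<omega> e))"
proof (rule integrable_const_bound[where B = 1])
  show "AE \<omega> in M. norm ((\<Prod>e\<in>A. P \<omega> e) * (\<Prod>e\<in>B. 1 - P \<omega> e)) \<le> 1"
    using AE_P_01
  proof eventually_elim
    case (elim \<omega>)
    have "0 \<le> (\<Prod>e\<in>A. P \<omega> e)" "(\<Prod>e\<in>A. P \<omega> e) \<le> 1" "0 \<le> (\<Prod>e\<in>B. 1 - P \<omega> e)" "(\<Prod>e\<in>B. 1 - P \<omega> e) \<le> 1"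
      using elim assms by (intro prod_nonneg prod_le_1; force)+
    then show ?case by (simp add: abs_mult mult_le_one)
  qed
  show "(\<lambda>\<omega>. (\<Prod>e\<in>A. P \<omega> e) * (\<Prod>e\<in>B. 1 - P \<omega> e)) \<in> borel_measurable M"
    using assms by (intro borel_measurable_times borel_measurable_prod borel_measurable_diff measurable_P) auto
qed

lemma integrable_present_prod:
  assumes "A \<subseteq> vertex_pairs n" "B \<subseteq> vertex_pairs n"
  shows "integrable M (\<lambda>\<omega>. (\<Prod>e\<in>A. of_bool (e \<in> G \<omega>)) * (\<Prod>e\<in>B. 1 - of_bool (e \<in> G \<omega>)) :: real)"
proof (rule integrable_const_bound[where B = 1])
  show "AE \<omega> in M. norm ((\<Prod>e\<in>A. of_bool (e \<in> G \<omega>)) * (\<Prod>e\<in>B. 1 - of_bool (e \<in> G \<omega>)) :: real) \<le> 1"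
  proof (rule AE_I2)
    fix \<omega>
    have "0 \<le> (\<Prod>e\<in>A. of_bool (e \<in> G \<omega>) :: real)" "(\<Prod>e\<in>A. of_bool (e \<in> G \<omega>) :: real) \<le> 1"
        "0 \<le> (\<Prod>e\<in>B. 1 - of_bool (e \<in> G \<omega>) :: real)" "(\<Prod>e\<in>B. 1 - of_bool (e \<in> G \<omega>) :: real) \<le> 1"
      by (intro prod_nonneg prod_le_1; force)+
    then show "norm ((\<Prod>e\<in>A. of_bool (e \<in> G \<omega>)) * (\<Prod>e\<in>B. 1 - of_bool (e \<in> G \<omega>)) :: real) \<le> 1"
      by (simp add: abs_mult mult_le_one)
  qed
  have "(\<lambda>\<omega>. of_bool (e \<in> G \<omega>) :: real) \<in> borel_measurable M" if "e \<in> vertex_pairs n" for e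
  proof -
    have "(\<lambda>\<omega>. indicator (present e) \<omega> :: real) \<in> borel_measurable M" using that by simp
    then show ?thesis by (rule measurable_cong[THEN iffD1, rotated]) (simp add: indicator_def)
  qed
  then show "(\<lambda>\<omega>. (\<Prod>e\<in>A. of_bool (e \<in> G \<omega>)) * (\<Prod>e\<in>B. 1 - of_bool (e \<in> G \<omega>)) :: real) \<in> borel_measurable M"
    using assms by (intro borel_measurable_times borel_measurable_prod borel_measurable_diff) auto
qed

text \<open>Inclusion and exclusion, one absent edge at a time.\<close>

lemma expect_present_absent:
  assumes A: "A \<subseteq> vertex_pairs n" and B: "B \<subseteq> vertex_pairs n" "A \<inter> B = {}"
  shows "expectation (\<lambda>\<omega>. (\<Prod>e\<in>A. of_bool (e \<in> G \<omega>)) * (\<Prod>e\<in>B. 1 - of_bool (e \<in> G \<omega>))) =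
    expectation (\<lambda>\<omega>. (\<Prod>e\<in>A. P \<omega> e) * (\<Prod>e\<in>B. 1 - P \<omega> e))"
proof -
  have "finite B" using B(1) finite_vertex_pairs by (rule finite_subset)
  then show ?thesis using A B
  proof (induction B arbitrary: A)
    case empty
    then show ?case using expect_all_present[of A] by simp
  next
    case (insert b B)
    have fA: "finite A" using insert.prems(1) finite_vertex_pairs by (rule finite_subset)
    have bA: "b \<notin> A" using insert.prems by auto
    have sub: "insert b A \<subseteq> vertex_pairs n" "B \<subseteq> vertex_pairs n" "insert b A \<inter> B = {}" "A \<inter> B = {}"
      using insert by auto
    have split: "(\<Prod>e\<in>A. x e) * (\<Prod>e\<in>insert b B. 1 - x e) =
        (\<Prod>e\<in>A. x e) * (\<Prod>e\<in>B. 1 - x e) - (\<Prod>e\<in>insert b A. x e) * (\<Prod>e\<in>B. 1 - x e)" for x :: "nat set \<Rightarrow> real"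
      using insert.hyps fA bA by (simp add: algebra_simps)
    show ?case
      unfolding split
      using insert.prems sub
      by (simp only: Bochner_Integration.integral_diff integrable_present_prod integrable_P_prod insert.IH)
  qed
qed

text \<open>Given the weights the graph is a product Bernoulli configuration, so its law is the mean of these
  product laws.\<close>

theorem expect_graph_function:
  fixes \<phi> :: "nat set set \<Rightarrow> real"
  shows "expectation (\<lambda>\<omega>. \<phi> (G \<omega>)) = expectation (\<lambda>\<omega>. bern_expect (P \<omega>) (vertex_pairs n) \<phi>)"
proof -
  let ?E = "vertex_pairs n"
  let ?F = "\<lambda>g \<omega>. (\<Prod>e\<in>g. of_bool (e \<in> G \<omega>)) * (\<Prod>e\<in>?E - g. 1 - of_bool (e \<in> G \<omega>)) :: real"
  have F: "?F g \<omega> = of_bool (G \<omega> = g)" if g: "g \<subseteq> ?E" and \<omega>: "\<omega> \<in> space M" for g \<omega>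
  proof (cases "G \<omega> = g")
    case False
    then have "(\<exists>e\<in>g. e \<notin> G \<omega>) \<or> (\<exists>e\<in>?E - g. e \<in> G \<omega>)" using G_subset[OF \<omega>] g by blast
    moreover have "finite g" using g finite_vertex_pairs by (rule finite_subset)
    ultimately have "?F g \<omega> = 0" using finite_vertex_pairs by auto
    then show ?thesis using False by simp
  qed auto
  have "expectation (\<lambda>\<omega>. \<phi> (G \<omega>)) = expectation (\<lambda>\<omega>. \<Sum>g\<in>Pow ?E. \<phi> g * ?F g \<omega>)"
  proof (rule Bochner_Integration.integral_cong[OF refl])
    fix \<omega> assume \<omega>: "\<omega> \<in> space M"
    have "(\<Sum>g\<in>Pow ?E. \<phi> g * ?F g \<omega>) = (\<Sum>g\<in>Pow ?E. if g = G \<omega> then \<phi> g else 0)"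
      using F[OF _ \<omega>] by (intro sum.cong) auto
    also have "\<dots> = \<phi> (G \<omega>)" using G_subset[OF \<omega>] finite_vertex_pairs[of n] by simp
    finally show "\<phi> (G \<omega>) = (\<Sum>g\<in>Pow ?E. \<phi> g * ?F g \<omega>)" ..
  qed
  also have "\<dots> = (\<Sum>g\<in>Pow ?E. \<phi> g * expectation (?F g))"
    by (simp add: Bochner_Integration.integral_sum integrable_present_prod)
  also have "\<dots> = (\<Sum>g\<in>Pow ?E. \<phi> g * expectation (\<lambda>\<omega>. (\<Prod>e\<in>g. P \<omega> e) * (\<Prod>e\<in>?E - g. 1 - P \<omega> e)))"
    by (intro sum.cong refl arg_cong2[of _ _ _ _ times] expect_present_absent) auto
  also have "\<dots> = expectation (\<lambda>\<omega>. \<Sum>g\<in>Pow ?E. \<phi> g * ((\<Prod>e\<in>g. P \<omega> e) * (\<Prod>e\<in>?E - g. 1 - P \<omega> e)))"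
    by (simp add: Bochner_Integration.integral_sum integrable_P_prod)
  also have "\<dots> = expectation (\<lambda>\<omega>. bern_expect (P \<omega>) ?E \<phi>)"
    unfolding bern_expect_def bern_weight_def by (simp add: mult_ac)
  finally show ?thesis .
qed

lemma measurable_bern_expect [measurable]:
  "(\<lambda>\<omega>. bern_expect (P \<omega>) (vertex_pairs n) \<phi>) \<in> borel_measurable M"
  unfolding bern_expect_def bern_weight_def
  by (intro borel_measurable_sum borel_measurable_times borel_measurable_prod borel_measurable_diff measurable_P)
    auto

end

section \<open>The limit of the cycle counts\<close>

definition poisson_product :: "(nat \<Rightarrow> real) \<Rightarrow> nat \<Rightarrow> (nat \<Rightarrow> nat) \<Rightarrow> real" where
  "poisson_product l K a = (\<Prod>j\<in>{3..K}. l j ^ a j / fact (a j) * exp (- l j))"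

definition has_counts :: "nat \<Rightarrow> (nat \<Rightarrow> nat) \<Rightarrow> 'v set set \<Rightarrow> bool" where
  "has_counts K a g \<longleftrightarrow> (\<forall>j\<in>{3..K}. card (cycles_of_length g j) = a j)"

lemma weighted_edge_prob_rank_one:
  assumes w: "\<And>i. i \<in> {1..n} \<Longrightarrow> 0 < w i" and n: "1 \<le> n" and e: "e \<in> vertex_pairs n"
  defines "L \<equiv> (\<Sum>l=1..n. w l)"
  shows "weighted_edge_prob n w e =
    (\<Prod>v\<in>e. w v / sqrt L) / (1 + (\<Prod>v\<in>e. w v / sqrt L))"
proof -
  have L: "0 < L" unfolding L_def using w n by (intro sum_pos) auto
  obtain i j where ij: "e = {i, j}" "i \<noteq> j" using e by (auto simp: vertex_pairs_def)
  have "w i / sqrt L * (w j / sqrt L) = w i * w j / L"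
    using L by (simp add: real_sqrt_mult[symmetric])
  then have "(\<Prod>v\<in>e. w v / sqrt L) = w i * w j / L" using ij by simp
  moreover have "(\<Prod>v\<in>e. w v) = w i * w j" using ij by simp
  moreover have "w i * w j / (w i * w j + L) = (w i * w j / L) / (1 + w i * w j / L)"
    using L by (simp add: field_simps)
  ultimately show ?thesis unfolding weighted_edge_prob_def L_def by simp
qed

text \<open>If the conclusion failed for every \<open>\<tau>\<close>, counterexamples for a sequence of \<open>\<tau>\<close> tending to 0 would
  form a sequence of rank one graphs contradicting \<open>rank_one_law_tendsto\<close>.\<close>

lemma law_close_for_typical_weights:
  fixes \<mu>\<^sub>1 \<mu>\<^sub>2 \<epsilon> :: real and K :: nat and a :: "nat \<Rightarrow> nat"
  assumes \<mu>1: "0 < \<mu>\<^sub>1" and \<epsilon>: "0 < \<epsilon>"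
  defines "\<pi> \<equiv> poisson_product (\<lambda>j. (\<mu>\<^sub>2 / \<mu>\<^sub>1) ^ j / (2 * real j)) K a"
  shows "\<exists>\<tau>>0. \<forall>n w. 1 \<le> n \<longrightarrow> (\<forall>i\<in>{1..n}. 0 < w i) \<longrightarrow>
      \<bar>(\<Sum>i=1..n. w i) / real n - \<mu>\<^sub>1\<bar> < \<tau> \<longrightarrow> \<bar>(\<Sum>i=1..n. (w i)\<^sup>2) / real n - \<mu>\<^sub>2\<bar> < \<tau> \<longrightarrow>
      (\<forall>i\<in>{1..n}. (w i)\<^sup>2 \<le> \<tau> * real n) \<longrightarrow>
      \<bar>bern_expect (weighted_edge_prob n w) (vertex_pairs n) (\<lambda>g. of_bool (has_counts K a g)) - \<pi>\<bar> < \<epsilon>"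
proof (rule ccontr)
  assume contra: "\<not> ?thesis"
  \<comment> \<open>The bound \<open>\<mu>\<^sub>1 / 2\<close> on \<open>\<tau>\<close> keeps the mean weight at least \<open>\<mu>\<^sub>1 / 2\<close> and so \<open>d\<close> at most 1.\<close>
  define \<tau> where "\<tau> m = \<mu>\<^sub>1 / 2 / real (Suc m)" for m
  have \<tau>: "0 < \<tau> m" "\<tau> m \<le> \<mu>\<^sub>1 / 2" for m
    using \<mu>1 by (auto simp: \<tau>_def divide_le_eq mult_le_cancel_left1)
  have \<tau>0: "\<tau> \<longlonglongrightarrow> 0" unfolding \<tau>_def by (intro LIMSEQ_Suc lim_const_over_n)
  have "\<exists>n w. 1 \<le> n \<and> (\<forall>i\<in>{1..n}. 0 < w i) \<and>
      \<bar>(\<Sum>i=1..n. w i) / real n - \<mu>\<^sub>1\<bar> < \<tau> m \<and> \<bar>(\<Sum>i=1..n. (w i)\<^sup>2) / real n - \<mu>\<^sub>2\<bar> < \<tau> m \<and>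
      (\<forall>i\<in>{1..n}. (w i)\<^sup>2 \<le> \<tau> m * real n) \<and>
      \<epsilon> \<le> \<bar>bern_expect (weighted_edge_prob n w) (vertex_pairs n) (\<lambda>g. of_bool (has_counts K a g)) - \<pi>\<bar>"
    for m
    using contra \<tau>(1)[of m] by (meson not_less)
  then obtain n w where nw: "\<And>m. 1 \<le> n m" "\<And>m i. i \<in> {1..n m} \<Longrightarrow> 0 < w m i"
      "\<And>m. \<bar>(\<Sum>i=1..n m. w m i) / real (n m) - \<mu>\<^sub>1\<bar> < \<tau> m"
      "\<And>m. \<bar>(\<Sum>i=1..n m. (w m i)\<^sup>2) / real (n m) - \<mu>\<^sub>2\<bar> < \<tau> m"
      "\<And>m i. i \<in> {1..n m} \<Longrightarrow> (w m i)\<^sup>2 \<le> \<tau> m * real (n m)"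
    and far: "\<And>m. \<epsilon> \<le> \<bar>bern_expect (weighted_edge_prob (n m) (w m)) (vertex_pairs (n m))
        (\<lambda>g. of_bool (has_counts K a g)) - \<pi>\<bar>"
    by metis
  define A where "A m = (\<Sum>i=1..n m. w m i) / real (n m)" for m
  define B where "B m = (\<Sum>i=1..n m. (w m i)\<^sup>2) / real (n m)" for m
  define y where "y m v = w m v / sqrt (\<Sum>i=1..n m. w m i)" for m v
  define d where "d m = sqrt (\<tau> m / A m)" for m
  have A_lim: "A \<longlonglongrightarrow> \<mu>\<^sub>1" unfolding LIM_zero_iff[symmetric, of A]
    by (rule Lim_null_comparison[OF _ \<tau>0]) (use nw(3) in \<open>auto simp: A_def less_imp_le\<close>)
  have B_lim: "B \<longlonglongrightarrow> \<mu>\<^sub>2" unfolding LIM_zero_iff[symmetric, of B]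
    by (rule Lim_null_comparison[OF _ \<tau>0]) (use nw(4) in \<open>auto simp: B_def less_imp_le\<close>)
  have A_ge: "\<mu>\<^sub>1 / 2 \<le> A m" for m using nw(3)[of m] \<tau>(2)[of m] unfolding A_def by linarith
  have A_pos: "0 < A m" for m using A_ge[of m] \<mu>1 by linarith
  have L: "(\<Sum>i=1..n m. w m i) = A m * real (n m)" for m using nw(1)[of m] by (simp add: A_def)
  have n_pos: "0 < real (n m)" for m using nw(1)[of m] by simp
  have y2: "(y m v)\<^sup>2 = (w m v)\<^sup>2 / (A m * real (n m))" for m v
    unfolding y_def L using A_pos[of m] n_pos[of m] by (simp add: power_divide)
  have y0: "0 \<le> y m v" if "v \<in> {1..n m}" for m v
    unfolding y_def L using nw(2)[OF that] A_pos[of m] n_pos[of m] by simp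
  have rg: "rank_one_graph {1..n m} (y m) (d m)" for m
  proof
    show "d m \<le> 1" "0 \<le> d m"
      unfolding d_def using A_ge[of m] A_pos[of m] \<tau>[of m] by (auto simp: divide_le_eq)
    fix v assume v: "v \<in> {1..n m}"
    then show "0 \<le> y m v" by (rule y0)
    have "(y m v)\<^sup>2 \<le> \<tau> m * real (n m) / (A m * real (n m))"
      unfolding y2 using nw(5)[OF v] A_pos[of m] n_pos[of m] by (intro divide_right_mono) auto
    also have "\<dots> = \<tau> m / A m" using n_pos[of m] by simp
    finally show "y m v \<le> d m" unfolding d_def by (rule real_le_rsqrt)
  qed simp
  have "(\<lambda>m. \<tau> m / A m) \<longlonglongrightarrow> 0 / \<mu>\<^sub>1" using \<mu>1 by (intro tendsto_divide \<tau>0 A_lim) simp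
  then have d0: "d \<longlonglongrightarrow> 0" unfolding d_def using tendsto_real_sqrt by fastforce
  have "(\<lambda>m. B m / A m) \<longlonglongrightarrow> \<mu>\<^sub>2 / \<mu>\<^sub>1" using \<mu>1 by (intro tendsto_divide B_lim A_lim) simp
  moreover have "B m / A m = (\<Sum>v\<in>{1..n m}. (y m v)\<^sup>2)" for m
    unfolding y2 B_def by (simp add: sum_divide_distrib mult.commute)
  ultimately have S: "(\<lambda>m. \<Sum>v\<in>{1..n m}. (y m v)\<^sup>2) \<longlonglongrightarrow> \<mu>\<^sub>2 / \<mu>\<^sub>1" by simp
  have "bern_expect (weighted_edge_prob (n m) (w m)) (vertex_pairs (n m)) (\<lambda>g. of_bool (has_counts K a g))
      = rank_one_graph.law {1..n m} (y m) K a" for m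
    unfolding rank_one_graph.law_def[OF rg] has_counts_def rank_one_graph.E_def[OF rg]
      vertex_pairs_complete_graph[symmetric]
  proof (rule bern_expect_cong_prob)
    fix e assume e: "e \<in> vertex_pairs (n m)"
    show "weighted_edge_prob (n m) (w m) e = rank_one_graph.p (y m) e"
      unfolding rank_one_graph.p_def[OF rg] rank_one_graph.r_def[OF rg] y_def
      by (rule weighted_edge_prob_rank_one[OF nw(2) nw(1) e])
  qed
  then have "(\<lambda>m. bern_expect (weighted_edge_prob (n m) (w m)) (vertex_pairs (n m))
      (\<lambda>g. of_bool (has_counts K a g))) \<longlonglongrightarrow> \<pi>"
    using rank_one_law_tendsto[OF rg d0 S, of K a] unfolding \<pi>_def poisson_product_def by simp
  then have "\<forall>\<^sub>F m in sequentially. dist (bern_expect (weighted_edge_prob (n m) (w m)) (vertex_pairs (n m))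
      (\<lambda>g. of_bool (has_counts K a g))) \<pi> < \<epsilon>"
    using \<epsilon> by (rule tendstoD)
  then show False using far by (auto simp: eventually_sequentially dist_real_def not_less[symmetric])
qed

text \<open>The law of the counts is the mean of the conditional laws given the weights. For typical weights
  these are close to the limit, and the remaining weights have vanishing probability and contribute
  a bounded amount.\<close>

theorem cycle_counts_tendsto:
  fixes M :: "nat \<Rightarrow> 'b measure" and X :: "nat \<Rightarrow> nat \<Rightarrow> 'b \<Rightarrow> real" and G :: "nat \<Rightarrow> 'b \<Rightarrow> nat set set"
    and \<nu> :: "real measure"
  assumes grg: "\<And>n. generalised_random_graph (M n) n \<nu> (X n) (G n)"
    and pos: "AE x in \<nu>. 0 < x" and sq: "integrable \<nu> (\<lambda>x. x\<^sup>2)"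
  shows "(\<lambda>n. measure (M n) {\<omega> \<in> space (M n). has_counts K a (G n \<omega>)}) \<longlonglongrightarrow>
    poisson_product (\<lambda>j. ((\<integral>x. x\<^sup>2 \<partial>\<nu>) / (\<integral>x. x \<partial>\<nu>)) ^ j / (2 * real j)) K a"
proof (rule LIMSEQ_I)
  fix \<epsilon> :: real assume \<epsilon>: "0 < \<epsilon>"
  note g = grg[unfolded generalised_random_graph_def]
  interpret iid: iid_array M X \<nu>
    using g[THEN conjunct1] g[THEN conjunct2, THEN conjunct1]
      g[THEN conjunct2, THEN conjunct2, THEN conjunct1, THEN bspec]
    by (rule iid_array.intro)
  interpret \<nu>: prob_space \<nu> by (rule iid.prob_space_\<nu>)
  have meas\<nu>: "g \<in> borel_measurable \<nu>" if "g \<in> borel_measurable borel" for g :: "real \<Rightarrow> real"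
    using that iid.sets_\<nu> by (simp cong: measurable_cong_sets)
  have abs: "integrable \<nu> (\<lambda>x. \<bar>x\<bar>)"
  proof (rule Bochner_Integration.integrable_bound)
    show "integrable \<nu> (\<lambda>x. 1 + x\<^sup>2)" using sq by simp
    show "AE x in \<nu>. norm \<bar>x\<bar> \<le> norm (1 + x\<^sup>2 :: real)"
    proof (rule AE_I2)
      fix x :: real
      have "0 \<le> (\<bar>x\<bar> - 1)\<^sup>2" by simp
      then have "\<bar>x\<bar> * 2 \<le> 1 + x\<^sup>2" by (simp add: power2_diff)
      then show "norm \<bar>x\<bar> \<le> norm (1 + x\<^sup>2 :: real)" by simp
    qed
  qed (intro meas\<nu>, measurable)
  \<comment> \<open>Positivity holds only almost everywhere, so the laws of large numbers are applied to \<open>\<bar>x\<bar>\<close>.\<close>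
  define \<mu>\<^sub>1 where "\<mu>\<^sub>1 = (\<integral>x. \<bar>x\<bar> \<partial>\<nu>)"
  define \<mu>\<^sub>2 where "\<mu>\<^sub>2 = (\<integral>x. x\<^sup>2 \<partial>\<nu>)"
  have \<mu>1_eq: "(\<integral>x. x \<partial>\<nu>) = \<mu>\<^sub>1"
    unfolding \<mu>\<^sub>1_def using pos by (intro integral_cong_AE meas\<nu>) auto
  have \<mu>1: "0 < \<mu>\<^sub>1"
  proof -
    have "\<mu>\<^sub>1 \<noteq> 0"
    proof
      assume "\<mu>\<^sub>1 = 0"
      then have "AE x in \<nu>. \<bar>x\<bar> = 0"
        unfolding \<mu>\<^sub>1_def using abs by (subst (asm) integral_nonneg_eq_0_iff_AE) auto
      with pos have "AE x in \<nu>. False" by eventually_elim auto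
      then show False by simp
    qed
    moreover have "0 \<le> \<mu>\<^sub>1" unfolding \<mu>\<^sub>1_def by simp
    ultimately show ?thesis by simp
  qed
  define \<pi> where "\<pi> = poisson_product (\<lambda>j. (\<mu>\<^sub>2 / \<mu>\<^sub>1) ^ j / (2 * real j)) K a"
  obtain \<tau> where \<tau>: "0 < \<tau>" and close: "\<And>n w. 1 \<le> n \<Longrightarrow> (\<forall>i\<in>{1..n}. 0 < w i) \<Longrightarrow>
      \<bar>(\<Sum>i=1..n. w i) / real n - \<mu>\<^sub>1\<bar> < \<tau> \<Longrightarrow> \<bar>(\<Sum>i=1..n. (w i)\<^sup>2) / real n - \<mu>\<^sub>2\<bar> < \<tau> \<Longrightarrow>
      (\<forall>i\<in>{1..n}. (w i)\<^sup>2 \<le> \<tau> * real n) \<Longrightarrow>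
      \<bar>bern_expect (weighted_edge_prob n w) (vertex_pairs n) (\<lambda>g. of_bool (has_counts K a g)) - \<pi>\<bar> < \<epsilon> / 2"
    using law_close_for_typical_weights[OF \<mu>1, of "\<epsilon> / 2" \<mu>\<^sub>2 K a] \<epsilon> unfolding \<pi>_def by (auto 0 3)
  define B1 where "B1 n = {\<omega> \<in> space (M n). \<tau> \<le> \<bar>(\<Sum>i=1..n. \<bar>X n i \<omega>\<bar>) / real n - \<mu>\<^sub>1\<bar>}" for n
  define B2 where "B2 n = {\<omega> \<in> space (M n). \<tau> \<le> \<bar>(\<Sum>i=1..n. (X n i \<omega>)\<^sup>2) / real n - \<mu>\<^sub>2\<bar>}" for n
  define B3 where "B3 n = {\<omega> \<in> space (M n). \<exists>i\<in>{1..n}. \<tau> * real n < (X n i \<omega>)\<^sup>2}" for n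
  define bad where "bad n = B1 n \<union> B2 n \<union> B3 n" for n
  have [measurable]: "X n i \<in> borel_measurable (M n)" if "i \<in> {1..n}" for n i
    using that by (rule iid.measurable_X)
  have B_sets: "B1 n \<in> sets (M n)" "B2 n \<in> sets (M n)" "B3 n \<in> sets (M n)" for n
    unfolding B1_def B2_def B3_def by measurable
  have bad_sets: "bad n \<in> sets (M n)" for n unfolding bad_def using B_sets by auto
  have lims: "(\<lambda>n. measure (M n) (B1 n)) \<longlonglongrightarrow> 0" "(\<lambda>n. measure (M n) (B2 n)) \<longlonglongrightarrow> 0"
      "(\<lambda>n. measure (M n) (B3 n)) \<longlonglongrightarrow> 0"
    unfolding B1_def B2_def B3_def \<mu>\<^sub>1_def \<mu>\<^sub>2_def
    using abs sq \<tau> by (intro iid.weak_law_of_large_numbers iid.max_tendsto_0; simp)+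
  define C where "C = 1 + \<bar>\<pi>\<bar>"
  have C: "1 \<le> C" by (simp add: C_def)
  have key: "\<bar>measure (M n) {\<omega> \<in> space (M n). has_counts K a (G n \<omega>)} - \<pi>\<bar>
      \<le> \<epsilon> / 2 + C * (measure (M n) (B1 n) + measure (M n) (B2 n) + measure (M n) (B3 n))" if n: "1 \<le> n" for n
  proof -
    interpret G: random_graph "M n" n \<nu> "X n" "G n" by unfold_locales (use grg pos in auto)
    let ?Z = "\<lambda>g. of_bool (has_counts K a g) :: real"
    let ?Q = "\<lambda>\<omega>. bern_expect (weighted_edge_prob n (\<lambda>i. X n i \<omega>)) (vertex_pairs n) ?Z"
    have Q01: "AE \<omega> in M n. 0 \<le> ?Q \<omega> \<and> ?Q \<omega> \<le> 1"
      using G.AE_P_01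
    proof eventually_elim
      case (elim \<omega>)
      have "bern_expect (weighted_edge_prob n (\<lambda>i. X n i \<omega>)) (vertex_pairs n) (\<lambda>_. 0) \<le> ?Q \<omega>"
          "?Q \<omega> \<le> bern_expect (weighted_edge_prob n (\<lambda>i. X n i \<omega>)) (vertex_pairs n) (\<lambda>_. 1)"
        using elim by (intro bern_expect_mono; simp)+
      then show ?case by (simp add: bern_expect_const finite_vertex_pairs)
    qed
    have iQ: "integrable (M n) ?Q"
    proof (rule G.integrable_const_bound[where B = 1])
      show "AE \<omega> in M n. norm (?Q \<omega>) \<le> 1" using Q01 by eventually_elim simp
    qed (rule G.measurable_bern_expect)
    have "measure (M n) {\<omega> \<in> space (M n). has_counts K a (G n \<omega>)} =
        G.expectation (indicator {\<omega> \<in> space (M n). has_counts K a (G n \<omega>)})"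
      by (simp add: Int_def conj_commute conj_left_commute cong: conj_cong)
    also have "\<dots> = G.expectation (\<lambda>\<omega>. ?Z (G n \<omega>))"
      by (intro Bochner_Integration.integral_cong refl) (auto simp: indicator_def)
    also have "\<dots> = G.expectation ?Q" by (rule G.expect_graph_function)
    finally have "measure (M n) {\<omega> \<in> space (M n). has_counts K a (G n \<omega>)} - \<pi> = G.expectation (\<lambda>\<omega>. ?Q \<omega> - \<pi>)"
      using iQ by (simp add: G.prob_space)
    then have "\<bar>measure (M n) {\<omega> \<in> space (M n). has_counts K a (G n \<omega>)} - \<pi>\<bar> \<le>
        G.expectation (\<lambda>\<omega>. \<bar>?Q \<omega> - \<pi>\<bar>)" by simp
    also have "\<dots> \<le> G.expectation (\<lambda>\<omega>. \<epsilon> / 2 + C * indicator (bad n) \<omega>)"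
    proof (rule integral_mono_AE)
      show "integrable (M n) (\<lambda>\<omega>. \<bar>?Q \<omega> - \<pi>\<bar>)" using iQ by simp
      show "integrable (M n) (\<lambda>\<omega>. \<epsilon> / 2 + C * indicator (bad n) \<omega>)"
        using bad_sets[of n] by (auto simp: less_top[symmetric])
      show "AE \<omega> in M n. \<bar>?Q \<omega> - \<pi>\<bar> \<le> \<epsilon> / 2 + C * indicator (bad n) \<omega>"
        using G.AE_pos Q01 AE_space
      proof eventually_elim
        case (elim \<omega>)
        show ?case
        proof (cases "\<omega> \<in> bad n")
          case True
          have "\<bar>?Q \<omega> - \<pi>\<bar> \<le> C" using elim(2) unfolding C_def by linarith
          then show ?thesis using True \<epsilon> by simp
        next
          case False
          have s: "(\<Sum>i=1..n. \<bar>X n i \<omega>\<bar>) = (\<Sum>i=1..n. X n i \<omega>)"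
            using elim(1) by (intro sum.cong refl abs_of_pos) blast
          have "\<bar>?Q \<omega> - \<pi>\<bar> < \<epsilon> / 2"
            using False elim(1,3) s by (intro close n) (auto simp: bad_def B1_def B2_def B3_def not_le not_less)
          then show ?thesis using False by simp
        qed
      qed
    qed
    also have "\<dots> = \<epsilon> / 2 + C * measure (M n) (bad n)"
      using bad_sets[of n] sets.sets_into_space[OF bad_sets[of n]]
      by (subst Bochner_Integration.integral_add) (auto simp: less_top[symmetric] G.prob_space Int_absorb1)
    also have "\<dots> \<le> \<epsilon> / 2 + C * (measure (M n) (B1 n) + measure (M n) (B2 n) + measure (M n) (B3 n))"
    proof (intro add_left_mono mult_left_mono)
      have "measure (M n) (bad n) \<le> measure (M n) (B1 n \<union> B2 n) + measure (M n) (B3 n)"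
        unfolding bad_def using B_sets[of n] by (intro measure_Un_le) auto
      also have "measure (M n) (B1 n \<union> B2 n) \<le> measure (M n) (B1 n) + measure (M n) (B2 n)"
        using B_sets[of n] by (intro measure_Un_le) auto
      finally show "measure (M n) (bad n) \<le> measure (M n) (B1 n) + measure (M n) (B2 n) + measure (M n) (B3 n)"
        by simp
    qed (use C in simp)
    finally show ?thesis .
  qed
  have "(\<lambda>n. \<epsilon> / 2 + C * (measure (M n) (B1 n) + measure (M n) (B2 n) + measure (M n) (B3 n)))
      \<longlonglongrightarrow> \<epsilon> / 2 + C * (0 + 0 + 0)"
    by (intro tendsto_intros lims)
  then have "\<forall>\<^sub>F n in sequentially. \<epsilon> / 2 + C * (measure (M n) (B1 n) + measure (M n) (B2 n) + measure (M n) (B3 n)) < \<epsilon>"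
    by (rule order_tendstoD) (use \<epsilon> in simp)
  with eventually_ge_at_top[of 1]
  have "\<forall>\<^sub>F n in sequentially. norm (measure (M n) {\<omega> \<in> space (M n). has_counts K a (G n \<omega>)} - \<pi>) < \<epsilon>"
    by eventually_elim (use key in force)
  then show "\<exists>no. \<forall>n\<ge>no. norm (measure (M n) {\<omega> \<in> space (M n). has_counts K a (G n \<omega>)} -
      poisson_product (\<lambda>j. ((\<integral>x. x\<^sup>2 \<partial>\<nu>) / (\<integral>x. x \<partial>\<nu>)) ^ j / (2 * real j)) K a) < \<epsilon>"
    unfolding \<pi>_def \<mu>1_eq \<mu>\<^sub>2_def by (simp add: eventually_sequentially)
qed

section \<open>Convergence in distribution in the vague topology\<close>

lemma counting_measure_singleton:
  assumes "\<mu> \<in> counting_measures S" "j \<in> S"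
  shows "\<exists>m::nat. emeasure \<mu> {j} = of_nat m"
  using assms by (auto simp: counting_measures_def)

text \<open>The count as a natural number; the choice is meaningful for counting measures on a set
  containing \<open>j\<close>.\<close>

definition count_at :: "'a measure \<Rightarrow> 'a \<Rightarrow> nat" where
  "count_at \<mu> j = (SOME m. emeasure \<mu> {j} = of_nat m)"

lemma emeasure_count_at:
  assumes "\<mu> \<in> counting_measures S" "j \<in> S"
  shows "emeasure \<mu> {j} = of_nat (count_at \<mu> j)"
  unfolding count_at_def using counting_measure_singleton[OF assms] by (rule someI_ex)

lemma integral_finite_support:
  fixes f :: "'a \<Rightarrow> real"
  assumes \<mu>: "\<mu> \<in> counting_measures S" and fin: "finite {x \<in> S. f x \<noteq> 0}"
  shows "(\<integral>x. f x \<partial>\<mu>) = (\<Sum>x\<in>{x \<in> S. f x \<noteq> 0}. f x * real (count_at \<mu> x))"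
proof -
  let ?F = "{x \<in> S. f x \<noteq> 0}"
  have sp: "space \<mu> = S" "sets \<mu> = Pow S" using \<mu> by (auto simp: counting_measures_def)
  have int: "integrable \<mu> (\<lambda>x. f y * indicator {y} x)" if "y \<in> ?F" for y
    using that sp emeasure_count_at[OF \<mu>, of y]
    by (intro integrable_mult_right) (simp add: integrable_indicator_iff less_top[symmetric])
  have "(\<integral>x. f x \<partial>\<mu>) = (\<integral>x. (\<Sum>y\<in>?F. f y * indicator {y} x) \<partial>\<mu>)"
  proof (rule Bochner_Integration.integral_cong[OF refl])
    fix x assume "x \<in> space \<mu>"
    then have "x \<in> S" using sp by simp
    have "(\<Sum>y\<in>?F. f y * indicator {y} x) = (\<Sum>y\<in>?F. if y = x then f x else 0)"
      by (intro sum.cong) (auto simp: indicator_def)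
    also have "\<dots> = f x" using fin \<open>x \<in> S\<close> by (simp add: sum.delta)
    finally show "f x = (\<Sum>y\<in>?F. f y * indicator {y} x)" ..
  qed
  also have "\<dots> = (\<Sum>y\<in>?F. f y * measure \<mu> {y})"
    using int sp by (subst Bochner_Integration.integral_sum) auto
  also have "\<dots> = (\<Sum>y\<in>?F. f y * real (count_at \<mu> y))"
    using emeasure_count_at[OF \<mu>] by (intro sum.cong) (auto simp: measure_def)
  finally show ?thesis .
qed

text \<open>The integral of a function of finite support depends on finitely many counts only, and this
  property survives finite intersections and arbitrary unions.\<close>

lemma openin_vague_cylinder:
  fixes S :: "nat set"
  assumes "openin (vague_topology S) U" "\<mu> \<in> U"
  shows "\<exists>K. \<forall>\<mu>'\<in>counting_measures S. (\<forall>j\<in>S \<inter> {..K}. count_at \<mu>' j = count_at \<mu> j) \<longrightarrow> \<mu>' \<in> U"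
proof -
  let ?B = "{{\<mu> \<in> counting_measures S. (\<integral>x. f x \<partial>\<mu>) \<in> U} | (f :: nat \<Rightarrow> real) U.
        finite {x \<in> S. f x \<noteq> 0} \<and> open U}"
  have "generate_topology_on ?B U"
    using assms(1) unfolding vague_topology_def openin_topology_generated_by_iff .
  then show ?thesis using assms(2)
  proof (induction arbitrary: \<mu>)
    case Empty
    then show ?case by simp
  next
    case (Int a b)
    obtain K where K: "\<forall>\<mu>'\<in>counting_measures S. (\<forall>j\<in>S \<inter> {..K}. count_at \<mu>' j = count_at \<mu> j) \<longrightarrow> \<mu>' \<in> a"
      using Int.IH(1)[of \<mu>] Int.prems by auto
    obtain L where L: "\<forall>\<mu>'\<in>counting_measures S. (\<forall>j\<in>S \<inter> {..L}. count_at \<mu>' j = count_at \<mu> j) \<longrightarrow> \<mu>' \<in> b"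
      using Int.IH(2)[of \<mu>] Int.prems by auto
    show ?case
    proof (intro exI[of _ "max K L"] ballI impI IntI)
      fix \<mu>' assume m: "\<mu>' \<in> counting_measures S" "\<forall>j\<in>S \<inter> {..max K L}. count_at \<mu>' j = count_at \<mu> j"
      have "\<forall>j\<in>S \<inter> {..K}. count_at \<mu>' j = count_at \<mu> j" "\<forall>j\<in>S \<inter> {..L}. count_at \<mu>' j = count_at \<mu> j"
        using m(2) by auto
      with K L m(1) show "\<mu>' \<in> a" "\<mu>' \<in> b" by blast+
    qed
  next
    case (UN \<K>)
    then obtain k where k: "k \<in> \<K>" "\<mu> \<in> k" by auto
    then show ?case using UN.IH[OF k] by blast
  next
    case (Basis s)
    then obtain f :: "nat \<Rightarrow> real" and O' where s: "s = {\<mu> \<in> counting_measures S. (\<integral>x. f x \<partial>\<mu>) \<in> O'}"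
        "finite {x \<in> S. f x \<noteq> 0}" by blast
    have \<mu>: "\<mu> \<in> counting_measures S" "(\<integral>x. f x \<partial>\<mu>) \<in> O'" using Basis.prems s by auto
    obtain K where K: "{x \<in> S. f x \<noteq> 0} \<subseteq> {..K}" using s(2) finite_nat_iff_bounded_le by auto
    show ?case
    proof (intro exI[of _ K] ballI impI)
      fix \<mu>' assume m: "\<mu>' \<in> counting_measures S" "\<forall>j\<in>S \<inter> {..K}. count_at \<mu>' j = count_at \<mu> j"
      have "(\<integral>x. f x \<partial>\<mu>') = (\<integral>x. f x \<partial>\<mu>)"
        unfolding integral_finite_support[OF m(1) s(2)] integral_finite_support[OF \<mu>(1) s(2)]
        using K m(2) by (intro sum.cong) auto
      then show "\<mu>' \<in> s" using \<mu> m(1) s(1) by simp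
    qed
  qed
qed

text \<open>The count at \<open>j\<close> is the integral of the indicator of \<open>j\<close>, and the natural numbers are discrete.\<close>

lemma openin_vague_count_at:
  assumes j: "j \<in> S"
  shows "openin (vague_topology S) {\<mu> \<in> counting_measures S. count_at \<mu> j = m}"
proof -
  let ?f = "indicator {j} :: 'a \<Rightarrow> real" and ?U = "{real m - 1/2 <..< real m + 1/2}"
  have F: "{x \<in> S. ?f x \<noteq> 0} = {j}" using j by (auto simp: indicator_def)
  have "{\<mu> \<in> counting_measures S. count_at \<mu> j = m} = {\<mu> \<in> counting_measures S. (\<integral>x. ?f x \<partial>\<mu>) \<in> ?U}"
  proof (intro Collect_cong conj_cong refl)
    fix \<mu> assume \<mu>: "\<mu> \<in> counting_measures S"
    have "(\<integral>x. ?f x \<partial>\<mu>) = real (count_at \<mu> j)"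
      using integral_finite_support[OF \<mu>, of ?f] unfolding F by simp
    then show "count_at \<mu> j = m \<longleftrightarrow> (\<integral>x. ?f x \<partial>\<mu>) \<in> ?U" by auto
  qed
  also have "openin (vague_topology S) \<dots>"
    unfolding vague_topology_def
    by (rule topology_generated_by_Basis) (use F in \<open>auto intro!: exI[of _ ?f] exI[of _ ?U]\<close>)
  finally show ?thesis .
qed

lemma space_borel_of: "space (borel_of T) = topspace T"
  unfolding borel_of_def by (intro space_measure_of) (auto dest: openin_subset)

lemma sets_borel_of_open: "openin T U \<Longrightarrow> U \<in> sets (borel_of T)"
  unfolding borel_of_def by (intro in_measure_of) (auto dest: openin_subset)

lemma continuous_map_borel_of:
  assumes "continuous_map T euclideanreal f"
  shows "f \<in> borel_measurable (borel_of T)"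
proof (rule borel_measurableI)
  fix U :: "real set" assume "open U"
  then have "openin T {x \<in> topspace T. f x \<in> U}"
    using assms by (simp add: continuous_map_def)
  moreover have "f -` U \<inter> space (borel_of T) = {x \<in> topspace T. f x \<in> U}"
    by (auto simp: space_borel_of)
  ultimately show "f -` U \<inter> space (borel_of T) \<in> sets (borel_of T)"
    by (simp add: sets_borel_of_open)
qed

definition count_vector :: "nat set \<Rightarrow> nat \<Rightarrow> nat measure \<Rightarrow> nat \<Rightarrow> nat" where
  "count_vector S K \<mu> = (\<lambda>j\<in>S \<inter> {..K}. count_at \<mu> j)"

lemma count_vector_eq_iff:
  "count_vector S K \<mu> = count_vector S K \<mu>' \<longleftrightarrow> (\<forall>j\<in>S \<inter> {..K}. count_at \<mu> j = count_at \<mu>' j)"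
  by (auto simp: count_vector_def restrict_def fun_eq_iff)

lemma count_vector_in_PiE: "count_vector S K \<mu> \<in> PiE (S \<inter> {..K}) (\<lambda>_. UNIV)"
  by (simp add: count_vector_def)

lemma count_vector_eq_fun:
  assumes "b \<in> PiE (S \<inter> {..K}) (\<lambda>_. UNIV)"
  shows "count_vector S K \<mu> = b \<longleftrightarrow> (\<forall>j\<in>S \<inter> {..K}. count_at \<mu> j = b j)"
proof
  assume "count_vector S K \<mu> = b"
  then show "\<forall>j\<in>S \<inter> {..K}. count_at \<mu> j = b j" unfolding count_vector_def by (metis restrict_apply')
next
  assume eq: "\<forall>j\<in>S \<inter> {..K}. count_at \<mu> j = b j"
  show "count_vector S K \<mu> = b"
  proof
    fix j show "count_vector S K \<mu> j = b j"
    proof (cases "j \<in> S \<inter> {..K}")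
      case True then show ?thesis using eq by (simp add: count_vector_def)
    next
      case False
      then show ?thesis unfolding PiE_arb[OF assms False] count_vector_def restrict_def by (rule if_not_P)
    qed
  qed
qed

lemma sets_count_vector:
  assumes Z: "Z \<in> L \<rightarrow>\<^sub>M borel_of (vague_topology S)"
  shows "{\<omega> \<in> space L. count_vector S K (Z \<omega>) = b} \<in> sets L"
proof (cases "b \<in> PiE (S \<inter> {..K}) (\<lambda>_. UNIV)")
  case True
  have Zsp: "Z \<omega> \<in> counting_measures S" if "\<omega> \<in> space L" for \<omega>
    using measurable_space[OF Z that] by (simp add: space_borel_of topspace_vague_topology)
  have one: "{\<omega> \<in> space L. count_at (Z \<omega>) j = m} \<in> sets L" if "j \<in> S" for j m
  proof -
    have "Z -` {\<mu> \<in> counting_measures S. count_at \<mu> j = m} \<inter> space L \<in> sets L"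
      by (intro measurable_sets[OF Z] sets_borel_of_open openin_vague_count_at that)
    also have "Z -` {\<mu> \<in> counting_measures S. count_at \<mu> j = m} \<inter> space L = {\<omega> \<in> space L. count_at (Z \<omega>) j = m}"
      using Zsp by auto
    finally show ?thesis .
  qed
  have "{\<omega> \<in> space L. count_vector S K (Z \<omega>) = b} = {\<omega> \<in> space L. \<forall>j\<in>S \<inter> {..K}. count_at (Z \<omega>) j = b j}"
  proof (intro Collect_cong conj_cong refl)
    fix \<omega>
    show "count_vector S K (Z \<omega>) = b \<longleftrightarrow> (\<forall>j\<in>S \<inter> {..K}. count_at (Z \<omega>) j = b j)"
      by (rule count_vector_eq_fun[OF True])
  qed
  also have "\<dots> \<in> sets L" by (intro sets.sets_Collect_finite_All one) auto
  finally show ?thesis .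
next
  case False
  then have "{\<omega> \<in> space L. count_vector S K (Z \<omega>) = b} = {}"
    using count_vector_in_PiE by blast
  then show ?thesis by (simp only: sets.empty_sets)
qed

text \<open>If \<open>f\<close> is close to a constant on each of finitely many cylinders, its integral is determined by
  the probabilities of these cylinders, up to the mass outside them.\<close>

lemma integral_cylinder_approx:
  assumes L: "prob_space L" and Z: "Z \<in> L \<rightarrow>\<^sub>M borel_of (vague_topology S)"
    and f: "f \<in> borel_measurable (borel_of (vague_topology S))"
    and fB: "\<And>\<mu>. \<mu> \<in> counting_measures S \<Longrightarrow> \<bar>f \<mu>\<bar> \<le> B"
    and F: "finite F" and \<epsilon>: "0 \<le> \<epsilon>"
    and c: "\<And>\<mu>. \<mu> \<in> counting_measures S \<Longrightarrow> count_vector S K \<mu> \<in> F \<Longrightarrow> \<bar>f \<mu> - c (count_vector S K \<mu>)\<bar> \<le> \<epsilon>"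
  defines "p \<equiv> \<lambda>b. measure L {\<omega> \<in> space L. count_vector S K (Z \<omega>) = b}"
  shows "\<bar>(\<integral>\<omega>. f (Z \<omega>) \<partial>L) - (\<Sum>b\<in>F. c b * p b)\<bar> \<le> \<epsilon> + B * (1 - (\<Sum>b\<in>F. p b))"
proof -
  interpret prob_space L by fact
  define A where "A b = {\<omega> \<in> space L. count_vector S K (Z \<omega>) = b}" for b
  have A: "A b \<in> sets L" for b unfolding A_def by (rule sets_count_vector[OF Z])
  have Zsp: "Z \<omega> \<in> counting_measures S" if "\<omega> \<in> space L" for \<omega>
    using measurable_space[OF Z that] by (simp add: space_borel_of topspace_vague_topology)
  have mf: "(\<lambda>\<omega>. f (Z \<omega>)) \<in> borel_measurable L" by (rule measurable_compose[OF Z f])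
  have intf: "integrable L (\<lambda>\<omega>. f (Z \<omega>))"
    by (rule integrable_const_bound[where B = B]) (use fB Zsp mf in auto)
  have intA: "integrable L (\<lambda>\<omega>. k * indicator (A b) \<omega>)" for k :: real and b
    using A by (intro integrable_mult_right) (simp add: integrable_indicator_iff less_top[symmetric])
  have eA: "expectation (\<lambda>\<omega>. \<Sum>b\<in>F. k b * indicator (A b) \<omega>) = (\<Sum>b\<in>F. k b * p b)" for k
    using intA sets.sets_into_space[OF A]
    by (subst Bochner_Integration.integral_sum) (simp_all add: p_def A_def[symmetric] Int_absorb2)
  have intS: "integrable L (\<lambda>\<omega>. \<Sum>b\<in>F. k b * indicator (A b) \<omega>)" for k :: "_ \<Rightarrow> real"
    by (intro Bochner_Integration.integrable_sum intA)
  have S: "(\<Sum>b\<in>F. k b * indicator (A b) \<omega>) =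
      (if count_vector S K (Z \<omega>) \<in> F then k (count_vector S K (Z \<omega>)) else 0)" if "\<omega> \<in> space L"
    for \<omega> and k :: "_ \<Rightarrow> real"
    using that F by (simp add: A_def indicator_def if_distrib[of "(*) _"] sum.delta cong: if_cong)
  have "\<bar>expectation (\<lambda>\<omega>. f (Z \<omega>)) - (\<Sum>b\<in>F. c b * p b)\<bar> =
      \<bar>expectation (\<lambda>\<omega>. f (Z \<omega>) - (\<Sum>b\<in>F. c b * indicator (A b) \<omega>))\<bar>"
    using intf intS by (simp add: eA)
  also have "\<dots> \<le> expectation (\<lambda>\<omega>. \<bar>f (Z \<omega>) - (\<Sum>b\<in>F. c b * indicator (A b) \<omega>)\<bar>)"
    by simp
  also have "\<dots> \<le> expectation (\<lambda>\<omega>. \<epsilon> + B * (1 - (\<Sum>b\<in>F. 1 * indicator (A b) \<omega>)))"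
  proof (rule integral_mono)
    show "integrable L (\<lambda>\<omega>. \<bar>f (Z \<omega>) - (\<Sum>b\<in>F. c b * indicator (A b) \<omega>)\<bar>)"
      by (intro integrable_abs Bochner_Integration.integrable_diff intf intS)
    show "integrable L (\<lambda>\<omega>. \<epsilon> + B * (1 - (\<Sum>b\<in>F. 1 * indicator (A b) \<omega>)))"
      by (intro Bochner_Integration.integrable_add Bochner_Integration.integrable_diff integrable_mult_right
          intS) auto
    fix \<omega> assume \<omega>: "\<omega> \<in> space L"
    show "\<bar>f (Z \<omega>) - (\<Sum>b\<in>F. c b * indicator (A b) \<omega>)\<bar> \<le> \<epsilon> + B * (1 - (\<Sum>b\<in>F. 1 * indicator (A b) \<omega>))"
      unfolding S[OF \<omega>] using c[OF Zsp[OF \<omega>]] fB[OF Zsp[OF \<omega>]] \<epsilon> by simp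
  qed
  also have "\<dots> = \<epsilon> + B * (1 - (\<Sum>b\<in>F. 1 * p b))"
    using intS[of "\<lambda>_. 1"] by (simp only: Bochner_Integration.integral_add Bochner_Integration.integral_diff
        integrable_mult_right integral_mult_right_zero eA integrable_const Bochner_Integration.integrable_diff)
      (simp add: prob_space)
  finally show ?thesis by simp
qed

text \<open>For suitable \<open>K\<close>, most of the mass of the limit lies in cylinders given by the counts up to \<open>K\<close> on
  which \<open>f\<close> varies by at most \<open>\<epsilon>\<close>, and most of that in finitely many of them. The probabilities of
  these finitely many cylinders converge, so for large \<open>n\<close> they carry most of the mass of \<open>X n\<close> as
  well; this is how tightness enters.\<close>

theorem converges_in_distribution_vague:
  fixes S :: "nat set"
  assumes M: "\<And>n. prob_space (M n)" and N: "prob_space N"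
    and X: "\<And>n. X n \<in> M n \<rightarrow>\<^sub>M borel_of (vague_topology S)"
    and Y: "Y \<in> N \<rightarrow>\<^sub>M borel_of (vague_topology S)"
    and fdd: "\<And>K a. (\<lambda>n. measure (M n) {\<omega> \<in> space (M n). \<forall>j\<in>S \<inter> {..K}. emeasure (X n \<omega>) {j} = of_nat (a j)})
      \<longlonglongrightarrow> measure N {\<omega> \<in> space N. \<forall>j\<in>S \<inter> {..K}. emeasure (Y \<omega>) {j} = of_nat (a j)}"
  shows "converges_in_distribution (vague_topology S) M X N Y"
  unfolding converges_in_distribution_def
proof (intro conjI allI impI X Y)
  fix f :: "nat measure \<Rightarrow> real"
  assume f: "continuous_map (vague_topology S) euclideanreal f \<and> bounded (f ` topspace (vague_topology S))"
  interpret N: prob_space N by (rule N)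
  let ?CM = "counting_measures S" and ?r = "count_vector S"
  have fm: "f \<in> borel_measurable (borel_of (vague_topology S))"
    using f by (intro continuous_map_borel_of) simp
  obtain B where B: "0 < B" "\<And>\<mu>. \<mu> \<in> ?CM \<Longrightarrow> \<bar>f \<mu>\<bar> \<le> B"
    using f unfolding topspace_vague_topology by (auto simp: bounded_pos)
  have Xsp: "X n \<omega> \<in> ?CM" if "\<omega> \<in> space (M n)" for n \<omega>
    using measurable_space[OF X that] by (simp add: space_borel_of topspace_vague_topology)
  have Ysp: "Y \<omega> \<in> ?CM" if "\<omega> \<in> space N" for \<omega>
    using measurable_space[OF Y that] by (simp add: space_borel_of topspace_vague_topology)
  have ev: "?r K \<mu> = b \<longleftrightarrow> (\<forall>j\<in>S \<inter> {..K}. emeasure \<mu> {j} = of_nat (b j))"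
    if "\<mu> \<in> ?CM" "b \<in> PiE (S \<inter> {..K}) (\<lambda>_. UNIV)" for K \<mu> b
  proof -
    have "?r K \<mu> = b \<longleftrightarrow> (\<forall>j\<in>S \<inter> {..K}. count_at \<mu> j = b j)"
      by (rule count_vector_eq_fun[OF that(2)])
    also have "\<dots> \<longleftrightarrow> (\<forall>j\<in>S \<inter> {..K}. emeasure \<mu> {j} = of_nat (b j))"
      using emeasure_count_at[OF that(1)] by (intro ball_cong refl) simp
    finally show ?thesis .
  qed
  note r_PiE = count_vector_in_PiE[of S]
  define pX where "pX n K b = measure (M n) {\<omega> \<in> space (M n). ?r K (X n \<omega>) = b}" for n K b
  define pY where "pY K b = measure N {\<omega> \<in> space N. ?r K (Y \<omega>) = b}" for K b
  have lim: "(\<lambda>n. pX n K b) \<longlonglongrightarrow> pY K b" if "b \<in> PiE (S \<inter> {..K}) (\<lambda>_. UNIV)" for K b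
  proof -
    have "{\<omega> \<in> space (M n). ?r K (X n \<omega>) = b} =
        {\<omega> \<in> space (M n). \<forall>j\<in>S \<inter> {..K}. emeasure (X n \<omega>) {j} = of_nat (b j)}" for n
      using ev[OF Xsp that] by auto
    moreover have "{\<omega> \<in> space N. ?r K (Y \<omega>) = b} =
        {\<omega> \<in> space N. \<forall>j\<in>S \<inter> {..K}. emeasure (Y \<omega>) {j} = of_nat (b j)}"
      using ev[OF Ysp that] by auto
    ultimately show ?thesis unfolding pX_def pY_def using fdd[of K b] by simp
  qed
  show "(\<lambda>n. \<integral>\<omega>. f (X n \<omega>) \<partial>M n) \<longlonglongrightarrow> (\<integral>\<omega>. f (Y \<omega>) \<partial>N)"
  proof (rule LIMSEQ_I)
    fix \<delta> :: real assume \<delta>: "0 < \<delta>"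
    \<comment> \<open>The error below is at most \<open>3 \<epsilon> + 2 B \<epsilon>\<close>.\<close>
    define \<epsilon> where "\<epsilon> = \<delta> / (4 * (1 + B))"
    have \<epsilon>: "0 < \<epsilon>" using \<delta> B by (simp add: \<epsilon>_def)
    define D where "D K = {b. \<forall>\<mu>\<in>?CM. \<forall>\<mu>'\<in>?CM. ?r K \<mu> = b \<longrightarrow> ?r K \<mu>' = b \<longrightarrow> \<bar>f \<mu> - f \<mu>'\<bar> \<le> \<epsilon>}" for K
    define A where "A K = {\<omega> \<in> space N. ?r K (Y \<omega>) \<in> D K}" for K
    have r_mono: "?r K \<mu> = ?r K \<mu>'" if "?r K' \<mu> = ?r K' \<mu>'" "K \<le> K'" for K K' \<mu> \<mu>'
      using that unfolding count_vector_eq_iff by auto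
    have A_inc: "incseq A"
    proof (rule incseq_SucI, rule subsetI)
      fix K \<omega> assume w: "\<omega> \<in> A K"
      have "\<bar>f \<mu> - f \<mu>'\<bar> \<le> \<epsilon>" if m: "\<mu> \<in> ?CM" "\<mu>' \<in> ?CM" "?r (Suc K) \<mu> = ?r (Suc K) (Y \<omega>)"
        "?r (Suc K) \<mu>' = ?r (Suc K) (Y \<omega>)" for \<mu> \<mu>'
        using w m(1,2) r_mono[OF m(3), of K] r_mono[OF m(4), of K] unfolding A_def D_def by auto
      then show "\<omega> \<in> A (Suc K)" using w unfolding A_def D_def by simp
    qed
    have A_UN: "(\<Union>K. A K) = space N"
    proof
      show "space N \<subseteq> (\<Union>K. A K)"
      proof
        fix \<omega> assume \<omega>: "\<omega> \<in> space N"
        let ?U = "{\<mu> \<in> topspace (vague_topology S). f \<mu> \<in> ball (f (Y \<omega>)) (\<epsilon> / 2)}"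
        have "openin (vague_topology S) ?U"
          by (rule openin_continuous_map_preimage[OF f[THEN conjunct1] open_openin[THEN iffD1, OF open_ball]])
        moreover have "Y \<omega> \<in> ?U" using Ysp[OF \<omega>] \<epsilon> by (simp add: topspace_vague_topology)
        ultimately obtain K where K: "\<forall>\<mu>'\<in>?CM. (\<forall>j\<in>S \<inter> {..K}. count_at \<mu>' j = count_at (Y \<omega>) j) \<longrightarrow> \<mu>' \<in> ?U"
          using openin_vague_cylinder by blast
        have "\<bar>f \<mu> - f \<mu>'\<bar> \<le> \<epsilon>" if m: "\<mu> \<in> ?CM" "\<mu>' \<in> ?CM" "?r K \<mu> = ?r K (Y \<omega>)" "?r K \<mu>' = ?r K (Y \<omega>)" for \<mu> \<mu>'
        proof -
          have "\<mu> \<in> ?U" "\<mu>' \<in> ?U" using K m unfolding count_vector_eq_iff by blast+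
          then have "\<bar>f (Y \<omega>) - f \<mu>\<bar> < \<epsilon> / 2" "\<bar>f (Y \<omega>) - f \<mu>'\<bar> < \<epsilon> / 2"
            by (simp_all add: dist_real_def)
          then show ?thesis by linarith
        qed
        then have "\<omega> \<in> A K" using \<omega> unfolding A_def D_def by simp
        then show "\<omega> \<in> (\<Union>K. A K)" by blast
      qed
    qed (auto simp: A_def)
    have r_sets: "{\<omega> \<in> space N. ?r K (Y \<omega>) \<in> H} \<in> sets N" for K H
    proof -
      have "countable (PiE (S \<inter> {..K}) (\<lambda>_. UNIV :: nat set))" by (intro countable_PiE) auto
      then have "countable (H \<inter> PiE (S \<inter> {..K}) (\<lambda>_. UNIV :: nat set))" by (rule countable_subset[rotated]) auto
      then have "(\<Union>b\<in>H \<inter> PiE (S \<inter> {..K}) (\<lambda>_. UNIV). {\<omega> \<in> space N. ?r K (Y \<omega>) = b}) \<in> sets N"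
        by (rule sets.countable_UN') (use sets_count_vector[OF Y] in blast)
      also have "(\<Union>b\<in>H \<inter> PiE (S \<inter> {..K}) (\<lambda>_. UNIV). {\<omega> \<in> space N. ?r K (Y \<omega>) = b}) =
          {\<omega> \<in> space N. ?r K (Y \<omega>) \<in> H}"
        using r_PiE by auto
      finally show ?thesis .
    qed
    have "(\<lambda>K. measure N (A K)) \<longlonglongrightarrow> measure N (\<Union>K. A K)"
    proof (rule N.finite_Lim_measure_incseq[OF _ A_inc])
      show "range A \<subseteq> sets N" unfolding A_def using r_sets by blast
    qed
    then have "(\<lambda>K. measure N (A K)) \<longlonglongrightarrow> 1" by (simp add: A_UN N.prob_space)
    then have "\<forall>\<^sub>F K in sequentially. 1 - \<epsilon> < measure N (A K)"
      by (rule order_tendstoD) (use \<epsilon> in simp)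
    then obtain K where K: "1 - \<epsilon> < measure N (A K)" by (auto simp: eventually_sequentially)
    define box where "box T = PiE (S \<inter> {..K}) (\<lambda>_. {..T::nat})" for T
    define A' where "A' T = {\<omega> \<in> space N. ?r K (Y \<omega>) \<in> D K \<inter> box T}" for T
    have A'_inc: "incseq A'"
      by (rule incseq_SucI) (force simp: A'_def box_def PiE_def Pi_def)
    have "(\<lambda>T. measure N (A' T)) \<longlonglongrightarrow> measure N (\<Union>T. A' T)"
    proof (rule N.finite_Lim_measure_incseq[OF _ A'_inc])
      show "range A' \<subseteq> sets N" unfolding A'_def using r_sets by blast
    qed
    also have "(\<Union>T. A' T) = A K"
    proof
      show "A K \<subseteq> (\<Union>T. A' T)"
      proof
        fix \<omega> assume w: "\<omega> \<in> A K"
        define T where "T = Max (insert 0 (?r K (Y \<omega>) ` (S \<inter> {..K})))"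
        have "?r K (Y \<omega>) j \<le> T" if "j \<in> S \<inter> {..K}" for j
          unfolding T_def using that by (intro Max_ge) auto
        then have "?r K (Y \<omega>) \<in> box T" using r_PiE[of K "Y \<omega>"] by (auto simp: box_def PiE_def)
        then show "\<omega> \<in> (\<Union>T. A' T)" using w by (auto simp: A'_def A_def)
      qed
    qed (auto simp: A_def A'_def)
    finally have "\<forall>\<^sub>F T in sequentially. 1 - \<epsilon> < measure N (A' T)"
      by (rule order_tendstoD) (rule K)
    then obtain T where T: "1 - \<epsilon> < measure N (A' T)" by (auto simp: eventually_sequentially)
    define F where "F = D K \<inter> box T"
    have F: "finite F" "F \<subseteq> PiE (S \<inter> {..K}) (\<lambda>_. UNIV)"
    proof -
      have "finite (box T)" unfolding box_def by (intro finite_PiE) auto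
      then show "finite F" unfolding F_def by simp
      show "F \<subseteq> PiE (S \<inter> {..K}) (\<lambda>_. UNIV)" unfolding F_def box_def by (auto simp: PiE_def)
    qed
    have pF: "1 - \<epsilon> < (\<Sum>b\<in>F. pY K b)"
    proof -
      have "A' T = (\<Union>b\<in>F. {\<omega> \<in> space N. ?r K (Y \<omega>) = b})" by (auto simp: A'_def F_def)
      moreover have "measure N (\<Union>b\<in>F. {\<omega> \<in> space N. ?r K (Y \<omega>) = b}) = (\<Sum>b\<in>F. pY K b)"
        unfolding pY_def using F(1) sets_count_vector[OF Y]
        by (intro N.finite_measure_finite_Union) (auto simp: disjoint_family_on_def)
      ultimately show ?thesis using T by simp
    qed
    define c where "c b = f (SOME \<mu>. \<mu> \<in> ?CM \<and> ?r K \<mu> = b)" for b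
    have c: "\<bar>f \<mu> - c (?r K \<mu>)\<bar> \<le> \<epsilon>" if m: "\<mu> \<in> ?CM" "?r K \<mu> \<in> F" for \<mu>
    proof -
      let ?s = "SOME \<mu>'. \<mu>' \<in> ?CM \<and> ?r K \<mu>' = ?r K \<mu>"
      have "?s \<in> ?CM \<and> ?r K ?s = ?r K \<mu>" by (rule someI[of _ \<mu>]) (simp add: m)
      then show ?thesis using m unfolding c_def F_def D_def by blast
    qed
    have aX: "\<bar>(\<integral>\<omega>. f (X n \<omega>) \<partial>M n) - (\<Sum>b\<in>F. c b * pX n K b)\<bar> \<le> \<epsilon> + B * (1 - (\<Sum>b\<in>F. pX n K b))" for n
      unfolding pX_def using \<epsilon> by (intro integral_cylinder_approx M X fm B(2) F(1) c) auto
    have aY: "\<bar>(\<integral>\<omega>. f (Y \<omega>) \<partial>N) - (\<Sum>b\<in>F. c b * pY K b)\<bar> \<le> \<epsilon> + B * (1 - (\<Sum>b\<in>F. pY K b))"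
      unfolding pY_def using \<epsilon> by (intro integral_cylinder_approx N Y fm B(2) F(1) c) auto
    have lims: "(\<lambda>n. \<Sum>b\<in>F. pX n K b) \<longlonglongrightarrow> (\<Sum>b\<in>F. pY K b)"
      "(\<lambda>n. \<Sum>b\<in>F. c b * pX n K b) \<longlonglongrightarrow> (\<Sum>b\<in>F. c b * pY K b)"
      using F(2) by (intro tendsto_sum tendsto_mult tendsto_const lim; blast)+
    have "\<forall>\<^sub>F n in sequentially. 1 - \<epsilon> < (\<Sum>b\<in>F. pX n K b)"
      using lims(1) pF by (rule order_tendstoD)
    moreover have "\<forall>\<^sub>F n in sequentially. dist (\<Sum>b\<in>F. c b * pX n K b) (\<Sum>b\<in>F. c b * pY K b) < \<epsilon>"
      using lims(2) \<epsilon> by (rule tendstoD)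
    ultimately have "\<forall>\<^sub>F n in sequentially. norm ((\<integral>\<omega>. f (X n \<omega>) \<partial>M n) - (\<integral>\<omega>. f (Y \<omega>) \<partial>N)) < \<delta>"
    proof eventually_elim
      case (elim n)
      have "B * (1 - (\<Sum>b\<in>F. pX n K b)) \<le> B * \<epsilon>" "B * (1 - (\<Sum>b\<in>F. pY K b)) \<le> B * \<epsilon>"
        using elim pF B(1) by (intro mult_left_mono; simp)+
      then have "\<bar>(\<integral>\<omega>. f (X n \<omega>) \<partial>M n) - (\<integral>\<omega>. f (Y \<omega>) \<partial>N)\<bar> < 3 * \<epsilon> + 2 * (B * \<epsilon>)"
        using aX[of n] aY elim(2) unfolding dist_real_def by linarith
      also have "\<dots> \<le> 4 * (1 + B) * \<epsilon>" using B(1) \<epsilon> by (simp add: algebra_simps)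
      also have "\<dots> = \<delta>" using B(1) by (simp add: \<epsilon>_def)
      finally show ?case by simp
    qed
    then show "\<exists>no. \<forall>n\<ge>no. norm ((\<integral>\<omega>. f (X n \<omega>) \<partial>M n) - (\<integral>\<omega>. f (Y \<omega>) \<partial>N)) < \<delta>"
      by (simp add: eventually_sequentially)
  qed
qed

section \<open>The cycle process and its Poisson limit\<close>

lemma (in random_graph) measurable_G: "G \<in> M \<rightarrow>\<^sub>M count_space (Pow (vertex_pairs n))"
proof -
  have "finite (Pow (vertex_pairs n))" using finite_vertex_pairs by simp
  moreover have "G -` {g} \<inter> space M \<in> sets M" if g: "g \<in> Pow (vertex_pairs n)" for g
  proof -
    have "{\<omega> \<in> space M. \<forall>e\<in>vertex_pairs n. e \<in> G \<omega> \<longleftrightarrow> e \<in> g} \<in> sets M"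
    proof (intro sets.sets_Collect_finite_All finite_vertex_pairs)
      fix e assume e: "e \<in> vertex_pairs n"
      show "{\<omega> \<in> space M. e \<in> G \<omega> \<longleftrightarrow> e \<in> g} \<in> sets M"
        using sets_present[OF e] sets.sets_Collect_neg[OF sets_present[OF e]] by (cases "e \<in> g") simp_all
    qed
    also have "{\<omega> \<in> space M. \<forall>e\<in>vertex_pairs n. e \<in> G \<omega> \<longleftrightarrow> e \<in> g} = G -` {g} \<inter> space M"
      using G_subset g by blast
    finally show ?thesis .
  qed
  ultimately show ?thesis using G_subset by (subst measurable_count_space_eq2) auto
qed

lemma (in random_graph) measurable_cycle_process:
  "(\<lambda>\<omega>. cycle_process (G \<omega>)) \<in> M \<rightarrow>\<^sub>M borel_of (vague_topology {3..})"
proof (rule measurable_compose[OF measurable_G])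
  have "finite g" if "g \<in> Pow (vertex_pairs n)" for g
    using that finite_vertex_pairs finite_subset by blast
  then show "cycle_process \<in> count_space (Pow (vertex_pairs n)) \<rightarrow>\<^sub>M borel_of (vague_topology {3..})"
    by (auto simp: measurable_count_space_eq1 space_borel_of topspace_vague_topology
        intro!: cycle_process_counting_measure)
qed

lemma emeasure_cycle_process_eq_iff:
  assumes "finite g"
  shows "(\<forall>j\<in>{3..K}. emeasure (cycle_process g) {j} = of_nat (a j)) \<longleftrightarrow> has_counts K a g"
  unfolding has_counts_def
proof (intro ball_cong refl)
  fix j assume "j \<in> {3..K}"
  then have "emeasure (cycle_process g) {j} = of_nat (card (cycles_of_length g j))"
    using emeasure_cycle_process[OF assms, of "{j}"] by (simp add: cycles_of_length_def)
  then show "emeasure (cycle_process g) {j} = of_nat (a j) \<longleftrightarrow> card (cycles_of_length g j) = a j"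
    by simp
qed

lemma poisson_point_process_fdd:
  fixes \<Lambda> :: "nat measure"
  assumes pp: "poisson_point_process N \<eta> {3..} \<Lambda>"
    and l: "\<And>j. 3 \<le> j \<Longrightarrow> emeasure \<Lambda> {j} = ennreal (l j)" "\<And>j. 0 \<le> l j"
  shows "measure N {\<omega> \<in> space N. \<forall>j\<in>{3..K}. emeasure (\<eta> \<omega>) {j} = of_nat (a j)} = poisson_product l K a"
proof -
  note pp' = pp[unfolded poisson_point_process_def]
  interpret prob_space N using pp'[THEN conjunct1] .
  \<comment> \<open>Independence is available for families indexed by all natural numbers, hence the empty sets.\<close>
  define A :: "nat \<Rightarrow> nat set" where "A i = (if 3 \<le> i then {i} else {})" for i
  have "disjoint_family A" "range A \<subseteq> Pow {3..}"
    by (auto simp: disjoint_family_on_def A_def split: if_splits)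
  then have ind: "indep_vars (\<lambda>_. borel) (\<lambda>i \<omega>. emeasure (\<eta> \<omega>) (A i)) UNIV"
    using pp'[THEN conjunct2, THEN conjunct2, THEN conjunct2, THEN conjunct2, THEN conjunct2, THEN conjunct2]
    by simp
  have one: "prob {\<omega> \<in> space N. emeasure (\<eta> \<omega>) {j} = of_nat m} = l j ^ m / fact m * exp (- l j)"
    if j: "3 \<le> j" for j m
  proof -
    have "measure \<Lambda> {j} = l j" using l(1)[OF j] l(2) by (simp add: measure_def)
    moreover have "emeasure \<Lambda> {j} < \<infinity>" using l(1)[OF j] by simp
    ultimately show ?thesis
      using pp'[THEN conjunct2, THEN conjunct2, THEN conjunct2, THEN conjunct2, THEN conjunct1] j by simp
  qed
  show ?thesis
  proof (cases "{3..K} = {}")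
    case True
    then show ?thesis by (simp add: poisson_product_def prob_space)
  next
    case False
    have "{\<omega> \<in> space N. \<forall>j\<in>{3..K}. emeasure (\<eta> \<omega>) {j} = of_nat (a j)} =
        (\<Inter>j\<in>{3..K}. (\<lambda>\<omega>. emeasure (\<eta> \<omega>) (A j)) -` {of_nat (a j)} \<inter> space N)"
      using False by (auto simp: A_def)
    also have "prob \<dots> = (\<Prod>j\<in>{3..K}. prob ((\<lambda>\<omega>. emeasure (\<eta> \<omega>) (A j)) -` {of_nat (a j)} \<inter> space N))"
      by (rule indep_varsD[OF ind]) (use False in auto)
    also have "\<dots> = (\<Prod>j\<in>{3..K}. l j ^ a j / fact (a j) * exp (- l j))"
    proof (rule prod.cong[OF refl])
      fix j assume j: "j \<in> {3..K}"
      have "(\<lambda>\<omega>. emeasure (\<eta> \<omega>) (A j)) -` {of_nat (a j)} \<inter> space N =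
          {\<omega> \<in> space N. emeasure (\<eta> \<omega>) {j} = of_nat (a j)}"
        using j by (auto simp: A_def)
      then show "prob ((\<lambda>\<omega>. emeasure (\<eta> \<omega>) (A j)) -` {of_nat (a j)} \<inter> space N) = l j ^ a j / fact (a j) * exp (- l j)"
        using one[of j "a j"] j by simp
    qed
    finally show ?thesis by (simp add: poisson_product_def)
  qed
qed

theorem theorem2p1:
  fixes P :: "'a measure" and W :: "'a \<Rightarrow> real"
    and M :: "nat \<Rightarrow> 'b measure" and X :: "nat \<Rightarrow> nat \<Rightarrow> 'b \<Rightarrow> real"
    and G :: "nat \<Rightarrow> 'b \<Rightarrow> nat set set"
    and N :: "'c measure" and \<eta> :: "'c \<Rightarrow> nat measure"
  assumes "prob_space P"
    and "W \<in> borel_measurable P"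
    and "AE \<omega> in P. 0 < W \<omega>"
    and "integrable P (\<lambda>\<omega>. (W \<omega>)\<^sup>2)"
    and "\<And>n. generalised_random_graph (M n) n (distr P borel W) (X n) (G n)"
    and "poisson_point_process N \<eta> {3..} (point_measure {3..} (\<lambda>k. ennreal (cycle_rate P W k)))"
  shows "converges_in_distribution (vague_topology {3..}) M (\<lambda>n \<omega>. cycle_process (G n \<omega>)) N \<eta>"
proof -
  let ?\<nu> = "distr P borel W"
  note [measurable] = assms(2)
  have pos: "AE x in ?\<nu>. 0 < x" using assms(3) by (subst AE_distr_iff) auto
  have sq: "integrable ?\<nu> (\<lambda>x. x\<^sup>2)" using assms(4) by (subst integrable_distr_eq) auto
  have rg: "random_graph (M n) n ?\<nu> (X n) (G n)" for n
    using assms(5) pos by (rule random_graph.intro)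
  note pp = assms(6)[unfolded poisson_point_process_def]
  have rate: "cycle_rate P W j = ((\<integral>x. x\<^sup>2 \<partial>?\<nu>) / (\<integral>x. x \<partial>?\<nu>)) ^ j / (2 * real j)" for j
    by (simp add: cycle_rate_def integral_distr)
  have rate_nonneg: "0 \<le> cycle_rate P W j" for j
  proof -
    have "0 \<le> (\<integral>\<omega>. W \<omega> \<partial>P)" using assms(3) by (intro integral_nonneg_AE) (auto elim: eventually_mono)
    then show ?thesis by (simp add: cycle_rate_def)
  qed
  show ?thesis
  proof (rule converges_in_distribution_vague)
    show "prob_space (M n)" for n using rg[of n] unfolding random_graph_def generalised_random_graph_def by simp
    show "prob_space N" using pp[THEN conjunct1] .
    show "(\<lambda>\<omega>. cycle_process (G n \<omega>)) \<in> M n \<rightarrow>\<^sub>M borel_of (vague_topology {3..})" for n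
      by (rule random_graph.measurable_cycle_process[OF rg])
    show "\<eta> \<in> N \<rightarrow>\<^sub>M borel_of (vague_topology {3..})"
      using pp[THEN conjunct2, THEN conjunct2, THEN conjunct2, THEN conjunct1] .
    fix K :: nat and a :: "nat \<Rightarrow> nat"
    have J: "{3..} \<inter> {..K} = {3..K}" by auto
    have "{\<omega> \<in> space (M n). \<forall>j\<in>{3..K}. emeasure (cycle_process (G n \<omega>)) {j} = of_nat (a j)} =
        {\<omega> \<in> space (M n). has_counts K a (G n \<omega>)}" for n
    proof (intro Collect_cong conj_cong refl emeasure_cycle_process_eq_iff)
      fix \<omega> assume "\<omega> \<in> space (M n)"
      then show "finite (G n \<omega>)"
        using random_graph.G_subset[OF rg] finite_vertex_pairs finite_subset by blast
    qed
    moreover have "measure N {\<omega> \<in> space N. \<forall>j\<in>{3..K}. emeasure (\<eta> \<omega>) {j} = of_nat (a j)} =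
        poisson_product (cycle_rate P W) K a"
    proof (rule poisson_point_process_fdd[OF assms(6) _ rate_nonneg])
      fix j :: nat assume "3 \<le> j"
      then show "emeasure (point_measure {3..} (\<lambda>k. ennreal (cycle_rate P W k))) {j} = ennreal (cycle_rate P W j)"
        by (subst emeasure_point_measure_finite2) auto
    qed
    moreover have "cycle_rate P W = (\<lambda>j. ((\<integral>x. x\<^sup>2 \<partial>?\<nu>) / (\<integral>x. x \<partial>?\<nu>)) ^ j / (2 * real j))"
      by (rule ext) (rule rate)
    ultimately show "(\<lambda>n. measure (M n) {\<omega> \<in> space (M n). \<forall>j\<in>{3..} \<inter> {..K}. emeasure (cycle_process (G n \<omega>)) {j} = of_nat (a j)})
        \<longlonglongrightarrow> measure N {\<omega> \<in> space N. \<forall>j\<in>{3..} \<inter> {..K}. emeasure (\<eta> \<omega>) {j} = of_nat (a j)}"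
      unfolding J using cycle_counts_tendsto[OF assms(5) pos sq, of K a] by simp
  qed
qed

end
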